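(* Assume (A1)–(A4) of the context. Let $\{\theta_t\}_{t=0}^m$ be the sequence generated by ProxHSPGA (see context) with $\widehat B=B$ and parameters $$\beta := 1-\frac{\sqrt B}{\sqrt{N(m+1)}},\qquad \alpha:=\frac{\hat c\,\sqrt2\,B^{3/4}}{\sqrt{3\overline C}\,N^{1/4}(m+1)^{1/4}},\qquad \eta:=\frac{2}{4+L\alpha},$$ where $B$, $\hat c$, $L$ and $\overline C$ are given constants ($L$ and $\overline C$ being those of the context). If $\tilde\theta_T$ is chosen uniformly at random from $\{\theta_t\}_{t=0}^m$, then $$\mathbb E\big[\|\mathcal G_\eta(\tilde\theta_T)\|^2\big]\le \frac{3(4+L)^2\sigma^2}{4[BN(m+1)]^{1/2}}+\frac{(4+L)^2\sqrt{3\overline C}\,N^{1/4}}{4\hat c\sqrt2\,[B(m+1)]^{3/4}}\big[F^*-F(\theta_0)\big].$$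
   Context: **Model.** A Markov decision process has state space $\mathcal S$, action space $\mathcal A$, transition probabilities, reward $\mathcal R(s,a)$, discount factor $\gamma\in(0,1)$ and an initial state distribution. For $\theta\in\mathbb R^q$, $\pi_\theta(a|s)$ (also written $\pi_\theta(s,a)$) is a differentiable parameterized policy density. A trajectory $\tau=\{s_0,a_0,\dots,s_{H-1},a_{H-1}\}$ of length $H$ is drawn by following $\pi_\theta$; $p_\theta(\cdot)$ is the resulting density over trajectories. Put $\mathcal R(\tau)=\sum_{t=0}^{H-1}\gamma^t\mathcal R(s_t,a_t)$ and $J(\theta)=\mathbb E_{\tau\sim p_\theta}[\mathcal R(\tau)]$. The problem is $\max_{\theta\in\mathbb R^q}F(\theta):=J(\theta)-Q(\theta)$. $\|\cdot\|$ is the $\ell_2$-norm. **Assumptions.** (A1) $Q:\mathbb R^q\to\mathbb R\cup\{+\infty\}$ is proper, closed and convex, the domain of $F$ is nonempty, and $F^*:=\sup_\theta F(\theta)<+\infty$. (A2) There is $R>0$ with $|\mathcal R(s,a)|\le R$ for all $s\in\mathcal S,a\in\mathcal A$. (A3) There are $G,M>0$ with $\|\nabla\log\pi_\theta(s,a)\|\le G$ and $\|\nabla^2\log\pi_\theta(s,a)\|\le M$ for all $s\in\mathcal S$, $a\in\mathcal A$ (and all $\theta$). (A4) With $\omega(\tau|\theta_1,\theta_2)=p_{\theta_2}(\tau)/p_{\theta_1}(\tau)$ the importance weight, there is $W\in(0,\infty)$ such that, for each pair of policies (parameters $\theta_1,\theta_2\in\mathbb R^q$) encountered in the algorithm below,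 $\mathrm{Var}[\omega(\tau|\theta_1,\theta_2)]\le W$ for $\tau\sim p_{\theta_1}$. **Stochastic gradient.** $g(\tau|\theta)=\sum_{t=0}^{H-1}\nabla\log\pi_\theta(a_t|s_t)\,(\mathcal R(\tau)-b_t)$ is the REINFORCE estimator with baseline $b_t$ depending at most on $s_t$, and $|b|$ denotes a bound on the baseline: $|b_t|\le|b|$. It satisfies $\mathbb E_{\tau\sim p_\theta}[g(\tau|\theta)]=\nabla J(\theta)$. **Constants.** Under (A2)–(A3) it is known that there are constants $L,\sigma>0$ depending only on $R,G,M,H,\gamma,b$ with $\|\nabla J(\theta_1)-\nabla J(\theta_2)\|\le L\|\theta_1-\theta_2\|$ and $\|g(\tau|\theta)-\nabla J(\theta)\|^2\le\sigma^2$ for all $\theta,\theta_1,\theta_2,\tau$. Further $\overline C:=C_g^2C_\omega+L_g^2$, where $L_g=\frac{HM(R+|b|)}{1-\gamma}$, $C_g=\frac{HG(R+|b|)}{1-\gamma}$, $C_\omega=H(2HG^2+M)(W+1)$. **Algorithm (ProxHSPGA).** Given $\theta_0\in\mathbb R^q$ and positive parameters $m,N,B,\widehat B,\beta,\alpha,\eta$ ($m$ a number of iterations, $N,B,\widehat B$ batch sizes, step-size $\alpha\in[0,1]$, weight $\beta\in[0,1]$ of a convex combination): sample a batch $\tilde{\mathcal B}$ of $N$ independent trajectories from $p_{\theta_0}$, set $v_0=\frac1N\sum_{\tau\in\tilde{\mathcal B}}g(\tau|\theta_0)$, $\widehat\theta_1=\mathrm{prox}_{\eta Q}(\theta_0+\eta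 v_0)$, $\theta_1=(1-\alpha)\theta_0+\alpha\widehat\theta_1$. For $t=1,\dots,m$: sample two independent batches $\mathcal B_t,\widehat{\mathcal B}_t$ of $B$ and $\widehat B$ trajectories from $p_{\theta_t}$, set $$v_t=\beta v_{t-1}+\frac{\beta}{B}\sum_{\tau\in\mathcal B_t}\big[g(\tau|\theta_t)-\omega(\tau|\theta_t,\theta_{t-1})g(\tau|\theta_{t-1})\big]+\frac{1-\beta}{\widehat B}\sum_{\hat\tau\in\widehat{\mathcal B}_t}g(\hat\tau|\theta_t),$$ $\widehat\theta_{t+1}=\mathrm{prox}_{\eta Q}(\theta_t+\eta v_t)$, $\theta_{t+1}=(1-\alpha)\theta_t+\alpha\widehat\theta_{t+1}$. Here $\mathrm{prox}_{Q}(\theta)=\arg\min_{\theta'}\{Q(\theta')+\frac12\|\theta'-\theta\|^2\}$, and the gradient mapping is $\mathcal G_\eta(\theta)=\eta^{-1}[\mathrm{prox}_{\eta Q}(\theta+\eta\nabla J(\theta))-\theta]$. Expectations are over all randomness of the algorithm and of the output choice.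
   Formalization: The constant ĉ is additionally required to satisfy ĉ ≤ 1; for arbitrary ĉ > 0 with α ≤ 1 the bound fails (e.g. one state, two actions, large baseline, α = 1, N → ∞, θ₀ near the maximizer of J). *)

theory Defs
  imports "HOL-Probability.Probability"
begin

text \<open>Gradient with respect to the inner product, as a total function (\<^const>\<open>gderiv\<close> is a
  relation); it is meaningful only where the function is differentiable.\<close>

definition grad :: "(real^'q \<Rightarrow> real) \<Rightarrow> real^'q \<Rightarrow> real^'q" where
  "grad f x = (THE D. GDERIV f x :> D)"

definition prob_density :: "'a measure \<Rightarrow> ('a \<Rightarrow> real) \<Rightarrow> bool" where
  "prob_density \<mu> f \<longleftrightarrow> f \<in> borel_measurable \<mu> \<and> (\<forall>x\<in>space \<mu>. 0 \<le> f x) \<and>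
     (\<integral>\<^sup>+ x. ennreal (f x) \<partial>\<mu>) = 1"


section \<open>Markov decision process, policy and composite objective\<close>

text \<open>\<open>init\<close>, \<open>transition s a\<close> and \<open>policy \<theta> s\<close> are densities with respect to the reference measures
  \<open>state_ref\<close> and \<open>action_ref\<close>; counting measures give the discrete case. The state and action
  spaces are the carriers of these measures. The baseline at time \<open>t\<close> is \<open>baseline t s\<^sub>t\<close>.\<close>

record ('s, 'a, 'q) rl_problem =
  state_ref :: "'s measure"
  action_ref :: "'a measure"
  init :: "'s \<Rightarrow> real"
  transition :: "'s \<Rightarrow> 'a \<Rightarrow> 's \<Rightarrow> real"
  reward :: "'s \<Rightarrow> 'a \<Rightarrow> real"
  discount :: real
  horizon :: nat
  policy :: "real^'q \<Rightarrow> 's \<Rightarrow> 'a \<Rightarrow> real"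
  baseline :: "nat \<Rightarrow> 's \<Rightarrow> real"
  regularizer :: "real^'q \<Rightarrow> ereal"

definition rl_model :: "('s, 'a, 'q::finite) rl_problem \<Rightarrow> bool" where
  "rl_model P \<longleftrightarrow>
     sigma_finite_measure (state_ref P) \<and> sigma_finite_measure (action_ref P) \<and>
     prob_density (state_ref P) (init P) \<and>
     (\<lambda>(s, a, s'). transition P s a s')
        \<in> borel_measurable (state_ref P \<Otimes>\<^sub>M action_ref P \<Otimes>\<^sub>M state_ref P) \<and>
     (\<forall>s\<in>space (state_ref P). \<forall>a\<in>space (action_ref P).
        prob_density (state_ref P) (transition P s a)) \<and>
     (\<lambda>(s, a). reward P s a) \<in> borel_measurable (state_ref P \<Otimes>\<^sub>M action_ref P) \<and>
     0 < discount P \<and> discount P < 1 \<and>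
     0 < horizon P \<and>
     (\<lambda>(\<theta>, s, a). policy P \<theta> s a)
        \<in> borel_measurable (borel \<Otimes>\<^sub>M state_ref P \<Otimes>\<^sub>M action_ref P) \<and>
     (\<forall>\<theta>. \<forall>s\<in>space (state_ref P). prob_density (action_ref P) (policy P \<theta> s)) \<and>
     (\<forall>t<horizon P. baseline P t \<in> borel_measurable (state_ref P))"

text \<open>A trajectory of length \<open>H\<close> is an (extensional) function mapping \<open>t < H\<close> to \<open>(s\<^sub>t, a\<^sub>t)\<close>.\<close>

definition traj_ref :: "('s, 'a, 'q::finite) rl_problem \<Rightarrow> (nat \<Rightarrow> 's \<times> 'a) measure" where
  "traj_ref P = PiM {..<horizon P} (\<lambda>_. state_ref P \<Otimes>\<^sub>M action_ref P)"

definition traj_density ::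
  "('s, 'a, 'q::finite) rl_problem \<Rightarrow> real^'q \<Rightarrow> (nat \<Rightarrow> 's \<times> 'a) \<Rightarrow> real" where
  "traj_density P \<theta> \<tau> =
     init P (fst (\<tau> 0)) *
     (\<Prod>t<horizon P. policy P \<theta> (fst (\<tau> t)) (snd (\<tau> t))) *
     (\<Prod>t<horizon P - 1. transition P (fst (\<tau> t)) (snd (\<tau> t)) (fst (\<tau> (Suc t))))"

definition traj_law ::
  "('s, 'a, 'q::finite) rl_problem \<Rightarrow> real^'q \<Rightarrow> (nat \<Rightarrow> 's \<times> 'a) measure" where
  "traj_law P \<theta> = density (traj_ref P) (\<lambda>\<tau>. ennreal (traj_density P \<theta> \<tau>))"

definition traj_return :: "('s, 'a, 'q::finite) rl_problem \<Rightarrow> (nat \<Rightarrow> 's \<times> 'a) \<Rightarrow> real" where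
  "traj_return P \<tau> = (\<Sum>t<horizon P. discount P ^ t * reward P (fst (\<tau> t)) (snd (\<tau> t)))"

definition J :: "('s, 'a, 'q::finite) rl_problem \<Rightarrow> real^'q \<Rightarrow> real" where
  "J P \<theta> = (\<integral>\<tau>. traj_return P \<tau> \<partial>traj_law P \<theta>)"

definition F :: "('s, 'a, 'q::finite) rl_problem \<Rightarrow> real^'q \<Rightarrow> ereal" where
  "F P \<theta> = ereal (J P \<theta>) - regularizer P \<theta>"

definition F_opt :: "('s, 'a, 'q::finite) rl_problem \<Rightarrow> ereal" where
  "F_opt P = (SUP \<theta>. F P \<theta>)"


section \<open>Stochastic policy gradient and importance weight\<close>

definition score :: "('s, 'a, 'q::finite) rl_problem \<Rightarrow> real^'q \<Rightarrow> 's \<Rightarrow> 'a \<Rightarrow> real^'q" where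
  "score P \<theta> s a = grad (\<lambda>\<theta>'. ln (policy P \<theta>' s a)) \<theta>"

definition grad_est ::
  "('s, 'a, 'q::finite) rl_problem \<Rightarrow> (nat \<Rightarrow> 's \<times> 'a) \<Rightarrow> real^'q \<Rightarrow> real^'q" where
  "grad_est P \<tau> \<theta> =
     (\<Sum>t<horizon P. (traj_return P \<tau> - baseline P t (fst (\<tau> t))) *\<^sub>R
        score P \<theta> (fst (\<tau> t)) (snd (\<tau> t)))"

definition imp_weight ::
  "('s, 'a, 'q::finite) rl_problem \<Rightarrow> (nat \<Rightarrow> 's \<times> 'a) \<Rightarrow> real^'q \<Rightarrow> real^'q \<Rightarrow> real" where
  "imp_weight P \<tau> \<theta>\<^sub>1 \<theta>\<^sub>2 = traj_density P \<theta>\<^sub>2 \<tau> / traj_density P \<theta>\<^sub>1 \<tau>"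

definition imp_weight_var ::
  "('s, 'a, 'q::finite) rl_problem \<Rightarrow> real^'q \<Rightarrow> real^'q \<Rightarrow> real" where
  "imp_weight_var P \<theta>\<^sub>1 \<theta>\<^sub>2 =
     (\<integral>\<tau>. (imp_weight P \<tau> \<theta>\<^sub>1 \<theta>\<^sub>2
            - (\<integral>\<tau>'. imp_weight P \<tau>' \<theta>\<^sub>1 \<theta>\<^sub>2 \<partial>traj_law P \<theta>\<^sub>1))\<^sup>2 \<partial>traj_law P \<theta>\<^sub>1)"


section \<open>Proximal operator and gradient mapping\<close>

definition prox :: "(real^'q \<Rightarrow> ereal) \<Rightarrow> real^'q \<Rightarrow> real^'q" where
  "prox f x = arg_min (\<lambda>y. f y + ereal (1/2 * (norm (y - x))\<^sup>2)) (\<lambda>_. True)"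

definition prox_reg ::
  "('s, 'a, 'q::finite) rl_problem \<Rightarrow> real \<Rightarrow> real^'q \<Rightarrow> real^'q" where
  "prox_reg P \<eta> = prox (\<lambda>y. ereal \<eta> * regularizer P y)"

definition grad_mapping ::
  "('s, 'a, 'q::finite) rl_problem \<Rightarrow> real \<Rightarrow> real^'q \<Rightarrow> real^'q" where
  "grad_mapping P \<eta> \<theta> = (1/\<eta>) *\<^sub>R (prox_reg P \<eta> (\<theta> + \<eta> *\<^sub>R grad (J P) \<theta>) - \<theta>)"


section \<open>ProxHSPGA\<close>

definition prox_step ::
  "('s, 'a, 'q::finite) rl_problem \<Rightarrow> real \<Rightarrow> real \<Rightarrow> real^'q \<Rightarrow> real^'q \<Rightarrow> real^'q" where
  "prox_step P \<alpha> \<eta> \<theta> v = (1 - \<alpha>) *\<^sub>R \<theta> + \<alpha> *\<^sub>R prox_reg P \<eta> (\<theta> + \<eta> *\<^sub>R v)"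

definition init_est ::
  "('s, 'a, 'q::finite) rl_problem \<Rightarrow> nat \<Rightarrow> real^'q \<Rightarrow> (nat \<Rightarrow> nat \<Rightarrow> 's \<times> 'a) \<Rightarrow> real^'q" where
  "init_est P N \<theta>\<^sub>0 X = (1 / real N) *\<^sub>R (\<Sum>i<N. grad_est P (X i) \<theta>\<^sub>0)"

definition hybrid_est ::
  "('s, 'a, 'q::finite) rl_problem \<Rightarrow> nat \<Rightarrow> nat \<Rightarrow> real \<Rightarrow> real^'q \<Rightarrow> real^'q \<Rightarrow> real^'q \<Rightarrow>
     (nat \<Rightarrow> nat \<Rightarrow> 's \<times> 'a) \<Rightarrow> (nat \<Rightarrow> nat \<Rightarrow> 's \<times> 'a) \<Rightarrow> real^'q" where
  "hybrid_est P B B' \<beta> v_prev \<theta>_prev \<theta> X Y =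
     \<beta> *\<^sub>R v_prev
     + (\<beta> / real B) *\<^sub>R
         (\<Sum>i<B. grad_est P (X i) \<theta> - imp_weight P (X i) \<theta> \<theta>_prev *\<^sub>R grad_est P (X i) \<theta>_prev)
     + ((1 - \<beta>) / real B') *\<^sub>R (\<Sum>i<B'. grad_est P (Y i) \<theta>)"

definition batch_law ::
  "('s, 'a, 'q::finite) rl_problem \<Rightarrow> nat \<Rightarrow> real^'q \<Rightarrow> (nat \<Rightarrow> nat \<Rightarrow> 's \<times> 'a) measure" where
  "batch_law P n \<theta> = PiM {..<n} (\<lambda>_. traj_law P \<theta>)"

definition run_space :: "((nat \<Rightarrow> real^'q) \<times> (real^'q)) measure" where
  "run_space = PiM UNIV (\<lambda>_. borel) \<Otimes>\<^sub>M borel"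

text \<open>\<open>run P N B B' \<alpha> \<beta> \<eta> \<theta>\<^sub>0 t\<close> is the joint law of the iterates and of \<open>v\<^sub>t\<close> once iteration \<open>t\<close> is
  complete. A sample is \<open>(\<theta>s, v\<^sub>t)\<close> where \<open>\<theta>s\<close> holds \<open>\<theta>\<^sub>0, \<dots>, \<theta>\<^bsub>t+1\<^esub>\<close> at the indices up to
  \<open>t + 1\<close> and the irrelevant value \<open>\<theta>\<^sub>0\<close> beyond. In iteration \<open>t + 1\<close> the two batches are
  drawn, conditionally on the past, independently from the trajectory law of the current
  iterate.\<close>

primrec run ::
  "('s, 'a, 'q::finite) rl_problem \<Rightarrow> nat \<Rightarrow> nat \<Rightarrow> nat \<Rightarrow> real \<Rightarrow> real \<Rightarrow> real \<Rightarrow> real^'q \<Rightarrow> nat \<Rightarrow>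
     ((nat \<Rightarrow> real^'q) \<times> (real^'q)) measure" where
  "run P N B B' \<alpha> \<beta> \<eta> \<theta>\<^sub>0 0 =
     distr (batch_law P N \<theta>\<^sub>0) run_space
       (\<lambda>X. let v = init_est P N \<theta>\<^sub>0 X in ((\<lambda>_. \<theta>\<^sub>0)(1 := prox_step P \<alpha> \<eta> \<theta>\<^sub>0 v), v))"
| "run P N B B' \<alpha> \<beta> \<eta> \<theta>\<^sub>0 (Suc t) =
     Giry_Monad.bind (run P N B B' \<alpha> \<beta> \<eta> \<theta>\<^sub>0 t) (\<lambda>(\<theta>s, v_prev).
       distr (batch_law P B (\<theta>s (Suc t)) \<Otimes>\<^sub>M batch_law P B' (\<theta>s (Suc t))) run_space
         (\<lambda>(X, Y).
            let v = hybrid_est P B B' \<beta> v_prev (\<theta>s t) (\<theta>s (Suc t)) X Y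
            in (\<theta>s(Suc (Suc t) := prox_step P \<alpha> \<eta> (\<theta>s (Suc t)) v), v)))"

text \<open>Law of the output: an iterate with index drawn uniformly from \<open>{0..m}\<close>, independently of
  the run.\<close>

definition output_law ::
  "('s, 'a, 'q::finite) rl_problem \<Rightarrow> nat \<Rightarrow> nat \<Rightarrow> nat \<Rightarrow> real \<Rightarrow> real \<Rightarrow> real \<Rightarrow> real^'q \<Rightarrow> nat \<Rightarrow>
     (real^'q) measure" where
  "output_law P N B B' \<alpha> \<beta> \<eta> \<theta>\<^sub>0 m =
     Giry_Monad.bind (run P N B B' \<alpha> \<beta> \<eta> \<theta>\<^sub>0 m)
       (\<lambda>(\<theta>s, v). distr (uniform_count_measure {0..m}) borel (\<lambda>T. \<theta>s T))"


section \<open>Assumptions\<close>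

definition epigraph :: "(real^'q \<Rightarrow> ereal) \<Rightarrow> ((real^'q) \<times> real) set" where
  "epigraph f = {(x, r). f x \<le> ereal r}"

definition assumption_A1 :: "('s, 'a, 'q::finite) rl_problem \<Rightarrow> bool" where
  "assumption_A1 P \<longleftrightarrow>
     (\<forall>\<theta>. regularizer P \<theta> \<noteq> -\<infinity>) \<and> (\<exists>\<theta>. regularizer P \<theta> \<noteq> \<infinity>) \<and>
     closed (epigraph (regularizer P)) \<and> convex (epigraph (regularizer P)) \<and>
     {\<theta>. F P \<theta> > -\<infinity>} \<noteq> {} \<and> F_opt P < \<infinity>"

definition assumption_A2 :: "('s, 'a, 'q::finite) rl_problem \<Rightarrow> real \<Rightarrow> bool" where
  "assumption_A2 P R \<longleftrightarrow> R > 0 \<and>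
     (\<forall>s\<in>space (state_ref P). \<forall>a\<in>space (action_ref P). \<bar>reward P s a\<bar> \<le> R)"

text \<open>The Hessian of \<open>log \<pi>\<^sub>\<theta>(s,a)\<close> is the derivative of the score, measured in the operator norm
  induced by the Euclidean norm. Positivity of the policy makes the logarithm meaningful.\<close>

definition assumption_A3 :: "('s, 'a, 'q::finite) rl_problem \<Rightarrow> real \<Rightarrow> real \<Rightarrow> bool" where
  "assumption_A3 P G M \<longleftrightarrow> G > 0 \<and> M > 0 \<and>
     (\<forall>\<theta>. \<forall>s\<in>space (state_ref P). \<forall>a\<in>space (action_ref P).
        policy P \<theta> s a > 0 \<and>
        (\<lambda>\<theta>'. ln (policy P \<theta>' s a)) differentiable (at \<theta>) \<and>
        norm (score P \<theta> s a) \<le> G \<and>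
        (\<lambda>\<theta>'. score P \<theta>' s a) differentiable (at \<theta>) \<and>
        onorm (frechet_derivative (\<lambda>\<theta>'. score P \<theta>' s a) (at \<theta>)) \<le> M)"

text \<open>The pairs encountered in a run are \<open>(\<theta>\<^sub>t, \<theta>\<^bsub>t-1\<^esub>)\<close> for \<open>t = 1, \<dots>, m\<close>, the arguments of the
  importance weights that the algorithm evaluates.\<close>

definition assumption_A4 ::
  "('s, 'a, 'q::finite) rl_problem \<Rightarrow> nat \<Rightarrow> nat \<Rightarrow> nat \<Rightarrow> real \<Rightarrow> real \<Rightarrow> real \<Rightarrow> real^'q \<Rightarrow> nat \<Rightarrow>
     real \<Rightarrow> bool" where
  "assumption_A4 P N B B' \<alpha> \<beta> \<eta> \<theta>\<^sub>0 m W \<longleftrightarrow> W > 0 \<and>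
     (AE (\<theta>s, v) in run P N B B' \<alpha> \<beta> \<eta> \<theta>\<^sub>0 m.
        \<forall>t\<in>{1..m}. imp_weight_var P (\<theta>s t) (\<theta>s (t - 1)) \<le> W)"


section \<open>Constants\<close>

definition L_g :: "('s, 'a, 'q::finite) rl_problem \<Rightarrow> real \<Rightarrow> real \<Rightarrow> real \<Rightarrow> real" where
  "L_g P R M b = real (horizon P) * M * (R + b) / (1 - discount P)"

definition C_g :: "('s, 'a, 'q::finite) rl_problem \<Rightarrow> real \<Rightarrow> real \<Rightarrow> real \<Rightarrow> real" where
  "C_g P R G b = real (horizon P) * G * (R + b) / (1 - discount P)"

definition C_\<omega> :: "('s, 'a, 'q::finite) rl_problem \<Rightarrow> real \<Rightarrow> real \<Rightarrow> real \<Rightarrow> real" where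
  "C_\<omega> P G M W = real (horizon P) * (2 * real (horizon P) * G\<^sup>2 + M) * (W + 1)"

definition C_bar ::
  "('s, 'a, 'q::finite) rl_problem \<Rightarrow> real \<Rightarrow> real \<Rightarrow> real \<Rightarrow> real \<Rightarrow> real \<Rightarrow> real" where
  "C_bar P R G M b W = (C_g P R G b)\<^sup>2 * C_\<omega> P G M W + (L_g P R M b)\<^sup>2"

end

(*
  Write d for the displacement of a proximal step, e for the error v - grad J of the estimator and
  d* for the displacement that the exact gradient would give, so that norm d* = eta * norm G_eta.
  L-smoothness of J and the subgradient inequalities at both proximal points yield
    |d*|^2 + 2/3 |d|^2 <= (F(theta') - F(theta)) / alpha + |e|^2.
  The estimator error obeys E|e'|^2 <= beta^2 |e|^2 + 2 beta^2 Cbar alpha^2 |d|^2 / B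
  + (1 - beta)^2 sigma^2 / B, because both batches are unbiased and independent and because the
  variance of an importance weight is at most quadratic in the distance of the parameters. Adding
  lam |e|^2 with lam = beta^2 / (1 - beta^2) to the partial sums of |d*|^2, the gap F* - F and
  2/3 |d|^2 gives a potential that grows in expectation by at most
  (1 + lam) (1 - beta)^2 sigma^2 / B per iteration; the choice of alpha is what makes the |d|^2
  terms cancel.
*)
theory Submission
  imports Defs
begin

section \<open>Proximal operator of a closed convex function\<close>

text \<open>The rule for \<open>\<eta>\<close> says 1 / \<eta> = 2 + L \<alpha> / 2. The summand L
  \<alpha> / 2 pays for the curvature of J along the averaged step; the summand 2 is what remains
  for the two squared displacements. The weight lam is the fixed point of lam = (1 + lam) \<beta>^2,
  so the error carried over has the same weight before and after an iteration. The value of \<beta>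
  balances the variance sigma^2 / N of the initial batch against the fresh noise summed over the
  run. Three obstacles shape the development. The start may lie outside the domain of Q and F need
  not be known to be integrable along the run: the gap F* - F therefore takes values in
  \<open>ennreal\<close> and expectations are nonnegative integrals. Differentiability of J and
  unbiasedness of the estimator are derived from the model: each change of parameter becomes the
  exponential of a log-likelihood ratio under one fixed trajectory law, and the bounds on score and
  Hessian make its first-order expansion uniform over trajectories. Finally, each iteration draws
  from a law that depends on the current iterate, so trajectory laws, batches and steps have to be
  shown to be measurable kernels.\<close>

definition closed_convex_proper :: "(real^'q \<Rightarrow> ereal) \<Rightarrow> bool" where
  "closed_convex_proper f \<longleftrightarrow>
     (\<forall>x. f x \<noteq> -\<infinity>) \<and> (\<exists>x. f x \<noteq> \<infinity>) \<and> closed (epigraph f) \<and> convex (epigraph f)"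

text \<open>Real upper bounds in place of the values of \<open>f\<close> keep infinite values out of
  the arithmetic.\<close>

lemma ccp_convexD:
  assumes "closed_convex_proper f" "f x \<le> ereal a" "f y \<le> ereal c" "0 \<le> t" "t \<le> 1"
  shows "f ((1 - t) *\<^sub>R x + t *\<^sub>R y) \<le> ereal ((1 - t) * a + t * c)"
proof -
  have "(1 - t) *\<^sub>R (x, a) + t *\<^sub>R (y, c) \<in> epigraph f"
    using assms by (intro convexD) (auto simp: closed_convex_proper_def epigraph_def)
  then show ?thesis by (simp add: epigraph_def)
qed

text \<open>Separate the epigraph from a point one unit below the graph. The hyperplane cannot be
  vertical, because a point of the epigraph lies directly above the separated one; hence its last
  coefficient \<open>k\<close> is positive and can be divided out.\<close>

lemma ccp_affine_minorant:
  fixes f :: "real^'q \<Rightarrow> ereal"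
  assumes "closed_convex_proper f"
  obtains c d where "\<And>x r. f x \<le> ereal r \<Longrightarrow> c \<bullet> x + d \<le> r"
proof -
  have ccp: "\<And>x. f x \<noteq> -\<infinity>" "closed (epigraph f)" "convex (epigraph f)"
    using assms by (auto simp: closed_convex_proper_def)
  from assms obtain a s where a: "f a = ereal s"
    unfolding closed_convex_proper_def by (metis ereal_cases)
  have "(a, s - 1) \<notin> epigraph f" by (simp add: epigraph_def a)
  from separating_hyperplane_closed_point[OF ccp(3,2) this]
  obtain w \<beta> where w: "w \<bullet> (a, s - 1) < \<beta>" "\<And>z. z \<in> epigraph f \<Longrightarrow> w \<bullet> z > \<beta>" by blast
  obtain u k where uk: "w = (u, k)" by force
  have "(a, s) \<in> epigraph f" by (simp add: epigraph_def a)
  from w(2)[OF this] w(1) have k: "k > 0" by (simp add: uk inner_Pair algebra_simps)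
  show thesis
  proof (rule that[of "(-1/k) *\<^sub>R u" "\<beta> / k"])
    fix x r assume "f x \<le> ereal r"
    then have "(x, r) \<in> epigraph f" by (simp add: epigraph_def)
    from w(2)[OF this] have "u \<bullet> x + k * r > \<beta>" by (simp add: uk inner_Pair)
    then show "((-1/k) *\<^sub>R u) \<bullet> x + \<beta> / k \<le> r" using k by (simp add: field_simps)
  qed
qed

text \<open>The minimisation is moved to the epigraph, where the objective \<open>h\<close> is
  continuous although \<open>f\<close> is only lower semicontinuous. Compactness of a sublevel set
  comes from the affine minorant, which the quadratic term dominates.\<close>

lemma prox_minimizer_exists:
  fixes f :: "real^'q \<Rightarrow> ereal"
  assumes f: "closed_convex_proper f"
  shows "\<exists>p. \<forall>z. f p + ereal (1/2 * (norm (p - x))\<^sup>2) \<le> f z + ereal (1/2 * (norm (z - x))\<^sup>2)"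
proof -
  obtain c d where cd: "\<And>x r. f x \<le> ereal r \<Longrightarrow> c \<bullet> x + d \<le> r"
    using ccp_affine_minorant[OF f] by metis
  obtain a s where a: "f a = ereal s"
    using f unfolding closed_convex_proper_def by (metis ereal_cases)
  define h where "h = (\<lambda>(y::real^'q, r::real). r + 1/2 * (norm (y - x))\<^sup>2)"
  define T where "T = h (a, s)"
  define S where "S = epigraph f \<inter> {z. h z \<le> T}"
  have h_cont: "continuous_on A h" for A
    unfolding h_def case_prod_beta by (intro continuous_intros)
  have "closed S" unfolding S_def using f h_cont
    by (intro closed_Int closed_Collect_le)
      (auto simp: closed_convex_proper_def)
  moreover have "bounded S"
  proof -
    \<comment> \<open>The radius comes from completing the square: adding the minorant inequality
      and \<open>h z \<le> T\<close> bounds the distance of \<open>y\<close> from the shifted centre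
      \<open>x - c\<close>.\<close>
    define \<rho> where "\<rho> = norm (x - c) + sqrt (2 * \<bar>T\<bar> + 2 * \<bar>d\<bar> + (norm (x - c))\<^sup>2 + (norm x)\<^sup>2)"
    have "S \<subseteq> cball 0 \<rho> \<times> {- (norm c * \<rho> + \<bar>d\<bar>) .. T}"
    proof
      fix z assume z: "z \<in> S"
      obtain y r where yr: "z = (y, r)" by force
      have 1: "c \<bullet> y + d \<le> r" using cd z by (auto simp: S_def epigraph_def yr)
      have 2: "r + 1/2 * (norm (y - x))\<^sup>2 \<le> T" using z by (auto simp: S_def h_def yr)
      have "(norm (y - (x - c)))\<^sup>2 = (norm (y - x))\<^sup>2 + 2 * (c \<bullet> y) - 2 * (c \<bullet> x) + (norm c)\<^sup>2"
        by (simp add: power2_norm_eq_inner inner_diff_left inner_diff_right inner_commute)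
      also have "\<dots> \<le> 2 * T - 2 * d - 2 * (c \<bullet> x) + (norm c)\<^sup>2" using 1 2 by simp
      also have "\<dots> = 2 * T - 2 * d + (norm (x - c))\<^sup>2 - (norm x)\<^sup>2"
        by (simp add: power2_norm_eq_inner inner_diff_left inner_diff_right inner_commute)
      also have "\<dots> \<le> 2 * \<bar>T\<bar> + 2 * \<bar>d\<bar> + (norm (x - c))\<^sup>2 + (norm x)\<^sup>2"
        using zero_le_power2[of "norm x"] abs_ge_self[of T] abs_ge_minus_self[of d] by linarith
      finally have "norm (y - (x - c)) \<le> sqrt (2 * \<bar>T\<bar> + 2 * \<bar>d\<bar> + (norm (x - c))\<^sup>2 + (norm x)\<^sup>2)"
        by (rule real_le_rsqrt)
      then have ny: "norm y \<le> \<rho>" unfolding \<rho>_def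
        using norm_triangle_ineq[of "x - c" "y - (x - c)"] by simp
      have "\<bar>c \<bullet> y\<bar> \<le> norm c * \<rho>"
        using Cauchy_Schwarz_ineq2[of c y] mult_left_mono[OF ny norm_ge_zero[of c]] by linarith
      then have "- (norm c * \<rho> + \<bar>d\<bar>) \<le> r" using 1 by (simp add: abs_if split: if_splits)
      moreover have "r \<le> T" using 2 zero_le_power2[of "norm (y - x)"] by linarith
      ultimately show "z \<in> cball 0 \<rho> \<times> {- (norm c * \<rho> + \<bar>d\<bar>) .. T}" using ny by (simp add: yr)
    qed
    then show ?thesis by (rule bounded_subset[rotated]) (intro bounded_Times bounded_cball bounded_closed_interval)
  qed
  ultimately have "compact S" by (simp add: compact_eq_bounded_closed)
  moreover have "(a, s) \<in> S" by (simp add: S_def T_def epigraph_def a)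
  ultimately obtain z0 where z0: "z0 \<in> S" "\<And>z. z \<in> S \<Longrightarrow> h z0 \<le> h z"
    using continuous_attains_inf[of S h] h_cont by blast
  obtain p r where pr: "z0 = (p, r)" by force
  have fp: "f p \<le> ereal r" using z0(1) by (simp add: S_def epigraph_def pr)
  have "f p + ereal (1/2 * (norm (p - x))\<^sup>2) \<le> f z + ereal (1/2 * (norm (z - x))\<^sup>2)" for z
  proof (cases "f z")
    case (real q)
    have "h z0 \<le> h (z, q)"
    proof (cases "h (z, q) \<le> T")
      case True
      then show ?thesis by (intro z0(2)) (simp add: S_def epigraph_def real)
    next
      case False
      then show ?thesis using z0(1) by (simp add: S_def)
    qed
    then have "ereal r + ereal (1/2 * (norm (p - x))\<^sup>2) \<le> f z + ereal (1/2 * (norm (z - x))\<^sup>2)"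
      by (simp add: h_def pr real)
    moreover have "f p + ereal (1/2 * (norm (p - x))\<^sup>2) \<le> ereal r + ereal (1/2 * (norm (p - x))\<^sup>2)"
      using fp by (rule add_right_mono)
    ultimately show ?thesis by (rule order_trans[rotated])
  next
    case MInf
    then show ?thesis using f by (auto simp: closed_convex_proper_def)
  qed simp
  then show ?thesis by blast
qed

text \<open>This is the optimality condition: x - prox f x is a subgradient of \<open>f\<close> at
  the proximal point. It follows by comparing the minimiser with points of the segment towards
  \<open>z\<close>, cancelling one factor \<open>t\<close> and letting \<open>t\<close> tend to 0.
  The value at the proximal point is delivered as a real number so that later inequalities are
  purely real.\<close>

lemma prox_subgradient:
  fixes f :: "real^'q \<Rightarrow> ereal"
  assumes f: "closed_convex_proper f"
  obtains r where "f (prox f x) = ereal r"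
    "\<And>z q. f z = ereal q \<Longrightarrow> r + (x - prox f x) \<bullet> (z - prox f x) \<le> q"
proof -
  define p where "p = prox f x"
  have "is_arg_min (\<lambda>y. f y + ereal (1/2 * (norm (y - x))\<^sup>2)) (\<lambda>_. True) p"
    unfolding p_def prox_def arg_min_def
    by (rule someI_ex) (use prox_minimizer_exists[OF f, of x] in \<open>auto simp: is_arg_min_def not_less\<close>)
  then have min: "f p + ereal (1/2 * (norm (p - x))\<^sup>2) \<le> f z + ereal (1/2 * (norm (z - x))\<^sup>2)" for z
    by (auto simp: is_arg_min_def not_less)
  obtain a s where a: "f a = ereal s"
    using f unfolding closed_convex_proper_def by (metis ereal_cases)
  from min[of a] obtain r where r: "f p = ereal r"
    using f unfolding closed_convex_proper_def by (cases "f p") (auto simp: a)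
  show thesis
  proof (rule that[of r])
    show "f (prox f x) = ereal r" using r by (simp add: p_def)
    fix z q assume z: "f z = ereal q"
    \<comment> \<open>Minimality at the point \<open>y\<close> on the segment gives this inequality
      times \<open>t\<close>; only the last term, which is of second order in \<open>t\<close>
      before the division, vanishes in the limit.\<close>
    have *: "0 \<le> (q - r) + (p - x) \<bullet> (z - p) + t * ((norm (z - p))\<^sup>2 / 2)" if t: "0 < t" "t < 1" for t
    proof -
      define y where "y = (1 - t) *\<^sub>R p + t *\<^sub>R z"
      have "f y \<le> ereal ((1 - t) * r + t * q)" unfolding y_def
        using t by (intro ccp_convexD[OF f]) (auto simp: r z)
      then have "f y + ereal (1/2 * (norm (y - x))\<^sup>2)
          \<le> ereal ((1 - t) * r + t * q) + ereal (1/2 * (norm (y - x))\<^sup>2)" by (rule add_right_mono)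
      from order_trans[OF min[of y] this]
      have "r + 1/2 * (norm (p - x))\<^sup>2 \<le> (1 - t) * r + t * q + 1/2 * (norm (y - x))\<^sup>2"
        by (simp add: r)
      moreover have "y - x = (p - x) + t *\<^sub>R (z - p)" by (simp add: y_def algebra_simps)
      moreover have gen: "(norm (a + t *\<^sub>R b))\<^sup>2 = (norm a)\<^sup>2 + 2 * t * (a \<bullet> b) + t\<^sup>2 * (norm b)\<^sup>2"
        for a b :: "real^'q"
        unfolding power2_norm_eq_inner
        by (simp add: inner_add_left inner_add_right inner_commute power2_eq_square algebra_simps)
      ultimately have "r + 1/2 * (norm (p - x))\<^sup>2 \<le> (1 - t) * r + t * q + 1/2 *
          ((norm (p - x))\<^sup>2 + 2 * t * ((p - x) \<bullet> (z - p)) + t\<^sup>2 * (norm (z - p))\<^sup>2)"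
        by (simp only: gen)
      then have "0 \<le> t * ((q - r) + (p - x) \<bullet> (z - p) + t * ((norm (z - p))\<^sup>2 / 2))"
        by (simp add: algebra_simps power2_eq_square)
      then show ?thesis using t by (simp add: zero_le_mult_iff)
    qed
    have "((\<lambda>t. (q - r) + (p - x) \<bullet> (z - p) + t * ((norm (z - p))\<^sup>2 / 2)) \<longlongrightarrow>
        (q - r) + (p - x) \<bullet> (z - p) + 0 * ((norm (z - p))\<^sup>2 / 2)) (at_right (0::real))"
      by (intro tendsto_intros)
    then have "0 \<le> (q - r) + (p - x) \<bullet> (z - p) + 0 * ((norm (z - p))\<^sup>2 / 2)"
      by (rule tendsto_lowerbound)
        (use * in \<open>auto simp: eventually_at_right_field intro!: exI[of _ 1]\<close>)
    then show "r + (x - prox f x) \<bullet> (z - prox f x) \<le> q"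
      by (simp add: p_def inner_diff_left)
  qed
qed

text \<open>Each of the two subgradient inequalities is tested at the other proximal point; in the
  sum the function values cancel.\<close>

lemma prox_firmly_nonexpansive:
  fixes f :: "real^'q \<Rightarrow> ereal"
  assumes f: "closed_convex_proper f"
  shows "(norm (prox f x - prox f y))\<^sup>2 \<le> (x - y) \<bullet> (prox f x - prox f y)"
proof -
  obtain r where r: "f (prox f x) = ereal r"
    "\<And>z q. f z = ereal q \<Longrightarrow> r + (x - prox f x) \<bullet> (z - prox f x) \<le> q"
    using prox_subgradient[OF f] by metis
  obtain s where s: "f (prox f y) = ereal s"
    "\<And>z q. f z = ereal q \<Longrightarrow> s + (y - prox f y) \<bullet> (z - prox f y) \<le> q"
    using prox_subgradient[OF f] by metis
  from r(2)[OF s(1)] s(2)[OF r(1)] show ?thesis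
    by (simp add: power2_norm_eq_inner inner_diff_left inner_diff_right inner_commute)
qed

lemma prox_nonexpansive:
  fixes f :: "real^'q \<Rightarrow> ereal"
  assumes f: "closed_convex_proper f"
  shows "norm (prox f x - prox f y) \<le> norm (x - y)"
proof -
  have "(norm (prox f x - prox f y))\<^sup>2 \<le> norm (x - y) * norm (prox f x - prox f y)"
    using prox_firmly_nonexpansive[OF f, of x y] norm_cauchy_schwarz order_trans by blast
  then show ?thesis
    by (cases "norm (prox f x - prox f y) = 0") (auto simp: power2_eq_square)
qed

text \<open>The epigraph of the scaled function is the preimage of the original one under the linear
  map (x, r) to (x, r / \<eta>), which transports closedness and convexity at once.\<close>

lemma ccp_scale:
  fixes f :: "real^'q \<Rightarrow> ereal"
  assumes f: "closed_convex_proper f" and \<eta>: "\<eta> > 0"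
  shows "closed_convex_proper (\<lambda>x. ereal \<eta> * f x)"
proof -
  define T where "T = (\<lambda>(x::real^'q, r::real). (x, r / \<eta>))"
  have T: "linear T" unfolding T_def
    by (rule linearI) (auto simp: add_divide_distrib)
  have "ereal \<eta> * f x \<le> ereal r \<longleftrightarrow> f x \<le> ereal (r / \<eta>)" for x r
    using \<eta> by (cases "f x") (auto simp: field_simps)
  then have *: "epigraph (\<lambda>x. ereal \<eta> * f x) = T -` epigraph f"
    by (auto simp: epigraph_def T_def)
  have "closed (T -` epigraph f)"
    using f T by (intro continuous_closed_vimage linear_continuous_at)
      (auto simp: closed_convex_proper_def linear_conv_bounded_linear)
  moreover have "convex (T -` epigraph f)"
    using f T by (intro convex_linear_vimage) (auto simp: closed_convex_proper_def)
  ultimately show ?thesis using f \<eta> unfolding * closed_convex_proper_def by auto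
qed

text \<open>Sublevel sets are horizontal slices of the closed epigraph. The result is needed to
  integrate the optimality gap over random iterates.\<close>

lemma ccp_measurable:
  fixes f :: "real^'q \<Rightarrow> ereal"
  assumes f: "closed_convex_proper f"
  shows "f \<in> borel_measurable borel"
proof (subst borel_measurable_iff_Iic_ereal, intro allI)
  have sub: "{x. f x \<le> ereal r} \<in> sets borel" for r
  proof -
    have "{x. f x \<le> ereal r} = (\<lambda>x. (x, r)) -` epigraph f" by (auto simp: epigraph_def)
    moreover have "closed ((\<lambda>x. (x, r)) -` epigraph f)"
      using f by (intro continuous_closed_vimage continuous_intros) (auto simp: closed_convex_proper_def)
    ultimately show ?thesis by simp
  qed
  fix a :: ereal
  show "f -` {..a} \<inter> space borel \<in> sets borel"
  proof (cases a)
    case (real r)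
    then show ?thesis using sub[of r] by (simp add: vimage_def)
  next
    case PInf
    then have "f -` {..a} \<inter> space borel = UNIV" by auto
    then show ?thesis by simp
  next
    case MInf
    then have "f -` {..a} \<inter> space borel = {}" using f by (auto simp: closed_convex_proper_def)
    then show ?thesis by simp
  qed
qed


section \<open>One inexact proximal gradient step with averaging\<close>

lemma smooth_lower_bound:
  fixes f :: "'v::real_inner \<Rightarrow> real"
  assumes f: "\<And>x. GDERIV f x :> g x"
    and L: "\<And>x y. norm (g x - g y) \<le> L * norm (x - y)"
  shows "f x + g x \<bullet> (y - x) - L / 2 * (norm (y - x))\<^sup>2 \<le> f y"
proof -
  define d where "d = y - x"
  \<comment> \<open>The quadratic correction makes \<open>\<phi>\<close> nondecreasing on [0, 1], so
    a sign of the derivative replaces integration of the gradient along the segment.\<close>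
  define \<phi> where "\<phi> = (\<lambda>s. f (x + s *\<^sub>R d) - s * (g x \<bullet> d) + L / 2 * s\<^sup>2 * (norm d)\<^sup>2)"
  have deriv: "(\<phi> has_real_derivative g (x + s *\<^sub>R d) \<bullet> d - g x \<bullet> d + L * s * (norm d)\<^sup>2) (at s)" for s
  proof -
    have "((\<lambda>s. x + s *\<^sub>R d) has_derivative (\<lambda>h. h *\<^sub>R d)) (at s)"
      by (auto intro!: derivative_eq_intros)
    from diff_chain_at[OF this, of f "\<lambda>h. h \<bullet> g (x + s *\<^sub>R d)"]
    have "((\<lambda>s. f (x + s *\<^sub>R d)) has_derivative (\<lambda>h. (h *\<^sub>R d) \<bullet> g (x + s *\<^sub>R d))) (at s)"
      using f[of "x + s *\<^sub>R d"] by (simp add: gderiv_def o_def)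
    then have "((\<lambda>s. f (x + s *\<^sub>R d)) has_real_derivative g (x + s *\<^sub>R d) \<bullet> d) (at s)"
      by (rule has_derivative_imp_has_field_derivative) (simp add: inner_commute)
    then show ?thesis unfolding \<phi>_def
      by (auto intro!: derivative_eq_intros)
  qed
  have "\<phi> 0 \<le> \<phi> 1"
  proof (rule DERIV_nonneg_imp_nondecreasing[of 0 1])
    fix s :: real assume s: "0 \<le> s" "s \<le> 1"
    have "(g x - g (x + s *\<^sub>R d)) \<bullet> d \<le> norm (g x - g (x + s *\<^sub>R d)) * norm d"
      by (rule norm_cauchy_schwarz)
    also have "\<dots> \<le> (L * norm (x - (x + s *\<^sub>R d))) * norm d"
      by (intro mult_right_mono L) simp
    also have "\<dots> = L * s * (norm d)\<^sup>2" using s by (simp add: power2_eq_square)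
    finally show "\<exists>y. (\<phi> has_real_derivative y) (at s) \<and> 0 \<le> y"
      using deriv[of s] by (auto simp: inner_diff_left)
  qed simp
  then show ?thesis by (simp add: \<phi>_def d_def)
qed

text \<open>Here \<open>d\<close> is the displacement of the proximal step, \<open>e\<close> the error of the gradient estimate and
  \<open>f\<close> the deviation from the exact proximal point. The cross term \<open>e \<bullet> f\<close> is of second order in \<open>e\<close>,
  which would not be true of the usual \<open>e \<bullet> d\<close>.\<close>

lemma prox_step_quadratic:
  fixes d f e :: "'v::real_inner"
  assumes k: "0 \<le> k" and f: "(2 + k) * norm f \<le> norm e"
  shows "(norm (d - f))\<^sup>2 + 2/3 * (norm d)\<^sup>2
    \<le> (2 + k) * ((norm d)\<^sup>2 - d \<bullet> f + (norm f)\<^sup>2) - k * (norm d)\<^sup>2 - e \<bullet> f + (norm e)\<^sup>2"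
proof -
  have 1: "(norm (d - f))\<^sup>2 = (norm d)\<^sup>2 - 2 * (d \<bullet> f) + (norm f)\<^sup>2"
    by (simp add: power2_norm_eq_inner inner_diff_left inner_diff_right inner_commute)
  have "k * norm f \<le> norm e" using f norm_ge_zero[of f] by (simp only: distrib_right)
  then have "norm d * (k * norm f) \<le> norm d * norm e" by (rule mult_left_mono) simp
  moreover have "k * (d \<bullet> f) \<le> k * (norm d * norm f)"
    by (intro mult_left_mono norm_cauchy_schwarz k)
  ultimately have 2: "k * (d \<bullet> f) \<le> norm d * norm e" by (simp add: algebra_simps)
  have 3: "0 \<le> (norm f)\<^sup>2 - e \<bullet> f + (norm e)\<^sup>2 / 4"
    using zero_le_power2[of "norm (f - (1/2) *\<^sub>R e)"]
    by (simp add: power2_norm_eq_inner inner_diff_left inner_diff_right inner_commute)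
  \<comment> \<open>The available |e|^2 is split as 1/4 for the cross term with \<open>f\<close> and
    3/4 for the one with \<open>d\<close>. Against 3/4 the smallest sufficient share of |d|^2 is
    1/3, which is why 2/3 of it can be kept on the left-hand side.\<close>
  have 4: "0 \<le> (norm d)\<^sup>2 / 3 - norm d * norm e + 3/4 * (norm e)\<^sup>2"
    using zero_le_power2[of "norm d - 3/2 * norm e"]
    by (simp add: power2_eq_square algebra_simps)
  have 5: "0 \<le> k * (norm f)\<^sup>2" using k by simp
  show ?thesis using 1 2 3 4 5 by (simp add: algebra_simps)
qed

text \<open>The actual and the exact proximal point are compared directly. The averaging factor
  \<alpha> scales both the gain in F and, squared, the curvature term; after division by \<alpha>
  the curvature loss is k |d|^2 with k = L \<alpha> / 2, the very \<open>k\<close> that \<eta> was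
  chosen to absorb.\<close>

lemma prox_gradient_step:
  fixes Q :: "real^'q \<Rightarrow> ereal" and g :: "real^'q \<Rightarrow> real^'q" and v :: "real^'q"
  assumes Q: "closed_convex_proper Q"
    and f: "\<And>x. GDERIV f x :> g x"
    and L: "0 < L" "\<And>x y. norm (g x - g y) \<le> L * norm (x - y)"
    and \<alpha>: "0 < \<alpha>" "\<alpha> \<le> 1" and \<eta>: "\<eta> = 2 / (4 + L * \<alpha>)"
    and x: "Q x = ereal q"
  defines "p \<equiv> prox (\<lambda>y. ereal \<eta> * Q y) (x + \<eta> *\<^sub>R v)"
    and "ps \<equiv> prox (\<lambda>y. ereal \<eta> * Q y) (x + \<eta> *\<^sub>R g x)"
    and "x' \<equiv> (1 - \<alpha>) *\<^sub>R x + \<alpha> *\<^sub>R prox (\<lambda>y. ereal \<eta> * Q y) (x + \<eta> *\<^sub>R v)"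
  obtains q' where "Q x' = ereal q'"
    "(norm (ps - x))\<^sup>2 + 2/3 * (norm (p - x))\<^sup>2 \<le> (f x' - q' - (f x - q)) / \<alpha> + (norm (v - g x))\<^sup>2"
proof -
  define k where "k = L * \<alpha> / 2"
  have k: "0 \<le> k" using L \<alpha> by (simp add: k_def)
  have \<eta>k: "\<eta> * (2 + k) = 1" "0 < \<eta>" using k unfolding k_def \<eta> by (auto simp: field_simps)
  have Q': "closed_convex_proper (\<lambda>y. ereal \<eta> * Q y)" using ccp_scale[OF Q] \<eta>k by simp
  have real_case: "\<exists>s. Q y = ereal s \<and> r = \<eta> * s" if "ereal \<eta> * Q y = ereal r" for y r
    using that \<eta>k(2) by (cases "Q y") auto
  obtain r where r: "ereal \<eta> * Q p = ereal r"
    "\<And>z s. ereal \<eta> * Q z = ereal s \<Longrightarrow> r + (x + \<eta> *\<^sub>R v - p) \<bullet> (z - p) \<le> s"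
    using prox_subgradient[OF Q', of "x + \<eta> *\<^sub>R v"] unfolding p_def by metis
  obtain t where t: "ereal \<eta> * Q ps = ereal t"
    "\<And>z s. ereal \<eta> * Q z = ereal s \<Longrightarrow> t + (x + \<eta> *\<^sub>R g x - ps) \<bullet> (z - ps) \<le> s"
    using prox_subgradient[OF Q', of "x + \<eta> *\<^sub>R g x"] unfolding ps_def by metis
  obtain a where a: "Q p = ereal a" "r = \<eta> * a" using real_case[OF r(1)] by blast
  have "Q x' \<le> ereal ((1 - \<alpha>) * q + \<alpha> * a)" unfolding x'_def p_def[symmetric]
    using \<alpha> by (intro ccp_convexD[OF Q]) (auto simp: x a)
  moreover have "Q x' \<noteq> -\<infinity>" using Q by (auto simp: closed_convex_proper_def)
  \<comment> \<open>Convexity bounds Q at the averaged point by its values at \<open>x\<close> and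
    at the proximal point, so the averaged iterate stays in the domain.\<close>
  ultimately obtain q' where q': "Q x' = ereal q'" "q' \<le> (1 - \<alpha>) * q + \<alpha> * a"
    by (cases "Q x'") auto
  define d where "d = p - x"
  define h where "h = p - ps"
  define e where "e = v - g x"
  have "(norm h)\<^sup>2 \<le> ((x + \<eta> *\<^sub>R v) - (x + \<eta> *\<^sub>R g x)) \<bullet> h"
    using prox_firmly_nonexpansive[OF Q'] unfolding h_def p_def ps_def .
  have "norm h \<le> norm ((x + \<eta> *\<^sub>R v) - (x + \<eta> *\<^sub>R g x))"
    using prox_nonexpansive[OF Q'] unfolding h_def p_def ps_def .
  also have "(x + \<eta> *\<^sub>R v) - (x + \<eta> *\<^sub>R g x) = \<eta> *\<^sub>R e" by (simp add: e_def algebra_simps)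
  finally have "(2 + k) * norm h \<le> (2 + k) * (\<eta> * norm e)" using k \<eta>k(2) by (intro mult_left_mono) auto
  also have "(2 + k) * (\<eta> * norm e) = (\<eta> * (2 + k)) * norm e" by (simp only: mult_ac)
  finally have h: "(2 + k) * norm h \<le> norm e" by (simp only: \<eta>k(1) mult_1)
  \<comment> \<open>Chaining the subgradient inequality at \<open>p\<close>, tested at \<open>ps\<close>, with the one at \<open>ps\<close>, tested at
    \<open>x\<close>, makes the error act only on \<open>h\<close>.\<close>
  have "\<eta> * a + (x + \<eta> *\<^sub>R v - p) \<bullet> (ps - p) + (x + \<eta> *\<^sub>R g x - ps) \<bullet> (x - ps) \<le> \<eta> * q"
    using r(2)[OF t(1)] t(2)[of x "\<eta> * q"] by (simp add: a x)
  moreover have "x + \<eta> *\<^sub>R v - p = \<eta> *\<^sub>R (g x + e) - d" "ps - p = - h"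
    "x + \<eta> *\<^sub>R g x - ps = \<eta> *\<^sub>R g x - (d - h)" "x - ps = - (d - h)"
    by (simp_all add: d_def h_def e_def algebra_simps)
  ultimately have "\<eta> * a + (\<eta> *\<^sub>R (g x + e) - d) \<bullet> (- h) + (\<eta> *\<^sub>R g x - (d - h)) \<bullet> (- (d - h)) \<le> \<eta> * q"
    by simp
  then have "(norm d)\<^sup>2 - d \<bullet> h + (norm h)\<^sup>2 \<le> \<eta> * (q - a + g x \<bullet> d + e \<bullet> h)"
    by (simp add: power2_norm_eq_inner inner_diff_left inner_diff_right inner_add_left inner_commute
        algebra_simps)
  then have "(2 + k) * ((norm d)\<^sup>2 - d \<bullet> h + (norm h)\<^sup>2) \<le> (2 + k) * (\<eta> * (q - a + g x \<bullet> d + e \<bullet> h))"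
    using k by (intro mult_left_mono) auto
  also have "\<dots> = (\<eta> * (2 + k)) * (q - a + g x \<bullet> d + e \<bullet> h)" by (simp only: mult_ac)
  finally have main: "(2 + k) * ((norm d)\<^sup>2 - d \<bullet> h + (norm h)\<^sup>2) \<le> q - a + g x \<bullet> d + e \<bullet> h"
    by (simp only: \<eta>k(1) mult_1)
  have x': "x' - x = \<alpha> *\<^sub>R d" unfolding x'_def p_def[symmetric] by (simp add: d_def algebra_simps)
  have "f x + g x \<bullet> (x' - x) - L / 2 * (norm (x' - x))\<^sup>2 \<le> f x'"
    by (rule smooth_lower_bound[OF f L(2)])
  then have "\<alpha> * (g x \<bullet> d - k * (norm d)\<^sup>2) \<le> f x' - f x"
    unfolding x' using \<alpha> by (simp add: k_def power2_eq_square algebra_simps)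
  then have "\<alpha> * (g x \<bullet> d - k * (norm d)\<^sup>2 + q - a) \<le> f x' - q' - (f x - q)"
    using q'(2) by (simp add: algebra_simps)
  then have "g x \<bullet> d - k * (norm d)\<^sup>2 + q - a \<le> (f x' - q' - (f x - q)) / \<alpha>"
    using \<alpha> by (simp add: field_simps)
  with main prox_step_quadratic[OF k h, of d]
  have "(norm (d - h))\<^sup>2 + 2/3 * (norm d)\<^sup>2 \<le> (f x' - q' - (f x - q)) / \<alpha> + (norm e)\<^sup>2" by linarith
  moreover have dh: "d - h = ps - x" by (simp add: d_def h_def)
  ultimately show thesis using that[OF q'(1)] unfolding dh unfolding d_def e_def by blast
qed

section \<open>Perturbed expectations and mini-batches\<close>

lemma gderiv_unique:
  fixes f :: "'v::real_inner \<Rightarrow> real"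
  assumes "GDERIV f x :> D" "GDERIV f x :> E"
  shows "D = E"
proof -
  have "(\<lambda>h. h \<bullet> D) = (\<lambda>h. h \<bullet> E)"
    using assms unfolding gderiv_def by (rule has_derivative_unique)
  then have "(D - E) \<bullet> D = (D - E) \<bullet> E" by (rule fun_cong)
  then have "(D - E) \<bullet> (D - E) = 0" unfolding inner_diff_right by simp
  then show ?thesis by simp
qed

lemma grad_eqI: "GDERIV f x :> D \<Longrightarrow> grad f x = D"
  unfolding grad_def by (rule the_equality) (auto intro: gderiv_unique)

section \<open>Differentiating expectations through exponential weights\<close>

lemma exp_second_order_bound:
  fixes x :: real
  assumes "\<bar>x\<bar> \<le> 1/2"
  shows "\<bar>exp x - 1 - x\<bar> \<le> 2 * x\<^sup>2"
proof -
  have "1 - x \<le> exp (- x)" using exp_ge_add_one_self[of "-x"] by simp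
  then have "(1 - x) * exp x \<le> exp (- x) * exp x" by (intro mult_right_mono) auto
  then have 1: "(1 - x) * exp x \<le> 1" by (simp flip: exp_add)
  have "0 \<le> x\<^sup>2 * (1 - 2 * x)" using assms by (intro mult_nonneg_nonneg) auto
  then have "1 \<le> (1 - x) * (1 + x + 2 * x\<^sup>2)" by (simp add: power2_eq_square algebra_simps)
  with 1 have "(1 - x) * exp x \<le> (1 - x) * (1 + x + 2 * x\<^sup>2)" by linarith
  then have "exp x \<le> 1 + x + 2 * x\<^sup>2" using assms by (subst (asm) mult_le_cancel_left_pos) auto
  moreover have "1 + x \<le> exp x" by (rule exp_ge_add_one_self)
  ultimately show ?thesis using zero_le_power2[of x] by linarith
qed

lemma gderivI_quadratic:
  fixes f :: "'v::real_inner \<Rightarrow> real"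
  assumes "0 < r" and bound: "\<And>y. norm (y - x) \<le> r \<Longrightarrow> \<bar>f y - f x - D \<bullet> (y - x)\<bar> \<le> K * (norm (y - x))\<^sup>2"
  shows "GDERIV f x :> D"
  unfolding gderiv_def has_derivative_iff_norm
proof
  show "bounded_linear (\<lambda>h. h \<bullet> D)" by (rule bounded_linear_inner_left)
  show "((\<lambda>y. norm (f y - f x - (y - x) \<bullet> D) / norm (y - x)) \<longlongrightarrow> 0) (at x)"
  proof (rule tendsto_sandwich)
    show "\<forall>\<^sub>F y in at x. 0 \<le> norm (f y - f x - (y - x) \<bullet> D) / norm (y - x)" by simp
    have "\<forall>\<^sub>F y in at x. y \<noteq> x \<and> norm (y - x) < r"
      using \<open>0 < r\<close> by (auto simp: eventually_at dist_norm)
    then show "\<forall>\<^sub>F y in at x. norm (f y - f x - (y - x) \<bullet> D) / norm (y - x) \<le> K * norm (y - x)"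
      by (rule eventually_mono)
        (use bound in \<open>auto simp: inner_commute divide_simps power2_eq_square mult.assoc\<close>)
    show "((\<lambda>y. K * norm (y - x)) \<longlongrightarrow> 0) (at x)"
      by (auto intro!: tendsto_eq_intros)
  qed simp
qed

text \<open>\<open>D y\<close> plays the role of a log-likelihood ratio with gradient
  \<open>s\<close> at \<open>x\<close>. Since its remainder is quadratic uniformly over the sample
  space, exp (D y) - 1 - s \<bullet> (y - x) is also of second order uniformly, and the difference
  quotient is estimated directly. The lemma is applied both to whole trajectories, for the gradient
  of J, and to a single time step, for the baseline.\<close>

lemma (in prob_space) gderiv_integral_exp:
  fixes s :: "'a \<Rightarrow> 'v::euclidean_space" and Z :: "'a \<Rightarrow> real" and D :: "'v \<Rightarrow> 'a \<Rightarrow> real"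
  assumes [measurable]: "Z \<in> borel_measurable M" "s \<in> borel_measurable M"
      "\<And>y. D y \<in> borel_measurable M"
    and Z: "\<And>\<tau>. \<tau> \<in> space M \<Longrightarrow> \<bar>Z \<tau>\<bar> \<le> C"
    and s: "\<And>\<tau>. \<tau> \<in> space M \<Longrightarrow> norm (s \<tau>) \<le> g"
    and D: "\<And>y \<tau>. \<tau> \<in> space M \<Longrightarrow> \<bar>D y \<tau> - s \<tau> \<bullet> (y - x)\<bar> \<le> h * (norm (y - x))\<^sup>2"
  shows "GDERIV (\<lambda>y. \<integral>\<tau>. Z \<tau> * exp (D y \<tau>) \<partial>M) x :> (\<integral>\<tau>. Z \<tau> *\<^sub>R s \<tau> \<partial>M)"
proof -
  obtain \<tau>0 where \<tau>0: "\<tau>0 \<in> space M" using not_empty by blast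
  have C: "0 \<le> C" using Z[OF \<tau>0] by linarith
  have g: "0 \<le> g" using s[OF \<tau>0] norm_ge_zero order_trans by blast
  define h' where "h' = \<bar>h\<bar>"
  have h': "0 \<le> h'" by (simp add: h'_def)
  have D: "\<bar>D y \<tau> - s \<tau> \<bullet> (y - x)\<bar> \<le> h' * (norm (y - x))\<^sup>2" if "\<tau> \<in> space M" for y \<tau>
    using D[OF that, of y] abs_ge_self[of h] unfolding h'_def
    by (meson mult_right_mono order_trans zero_le_power2)
  define a where "a = g + h'"
  \<comment> \<open>Within this radius |D y| is at most 1/2, as the second-order bound on the
    exponential requires, and the distance is at most 1, so that its square can be bounded by
    itself.\<close>
  define r where "r = 1 / (2 * (a + 1))"
  have a: "0 \<le> a" and r: "0 < r" "r \<le> 1" "a * r \<le> 1/2"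
    using g h' by (auto simp: a_def r_def field_simps)
  have int_Zs: "integrable M (\<lambda>\<tau>. Z \<tau> *\<^sub>R s \<tau>)"
    by (rule integrable_const_bound[where B="C * g"])
      (auto intro!: mult_mono Z s C simp: C)
  show ?thesis
  proof (rule gderivI_quadratic[OF r(1)])
    fix y assume y: "norm (y - x) \<le> r"
    define u where "u = norm (y - x)"
    have u: "0 \<le> u" "u \<le> 1" "a * u \<le> 1/2"
      using y r a mult_left_mono[OF y a] by (auto simp: u_def)
    have Du: "\<bar>D y \<tau>\<bar> \<le> a * u" if "\<tau> \<in> space M" for \<tau>
    proof -
      have "\<bar>s \<tau> \<bullet> (y - x)\<bar> \<le> g * u"
        using Cauchy_Schwarz_ineq2[of "s \<tau>" "y - x"] mult_right_mono[OF s[OF that] u(1)]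
        by (simp add: u_def)
      moreover have "h' * u\<^sup>2 \<le> h' * u"
        using u h' by (intro mult_left_mono) (auto simp: power2_eq_square mult_left_le)
      ultimately show ?thesis using D[OF that, of y] by (simp add: u_def[symmetric] a_def distrib_right)
    qed
    \<comment> \<open>The quadratic remainder bound at \<open>y = x\<close> forces the log ratio to
      vanish there, so the unperturbed integrand is just \<open>Z\<close>.\<close>
    have D0: "D x \<tau> = 0" if "\<tau> \<in> space M" for \<tau>
      using D[OF that, of x] by simp
    have bd: "\<bar>exp (D y \<tau>) - 1 - s \<tau> \<bullet> (y - x)\<bar> \<le> (2 * a\<^sup>2 + h') * u\<^sup>2" if "\<tau> \<in> space M" for \<tau>
    proof -
      have "\<bar>exp (D y \<tau>) - 1 - D y \<tau>\<bar> \<le> 2 * (D y \<tau>)\<^sup>2"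
        using Du[OF that] u(3) by (intro exp_second_order_bound) linarith
      also have "(D y \<tau>)\<^sup>2 \<le> (a * u)\<^sup>2"
        using power_mono[OF Du[OF that] abs_ge_zero, of 2] by simp
      finally show ?thesis using D[OF that, of y]
        by (simp add: u_def[symmetric] power_mult_distrib distrib_right)
    qed
    have int_exp: "integrable M (\<lambda>\<tau>. Z \<tau> * exp (D y \<tau>))"
    proof (rule integrable_const_bound[where B="C * exp (a * u)"])
      have "norm (Z \<tau> * exp (D y \<tau>)) \<le> C * exp (a * u)" if "\<tau> \<in> space M" for \<tau>
      proof -
        have "exp (D y \<tau>) \<le> exp (a * u)" using Du[OF that] by simp
        from mult_mono[OF Z[OF that] this] show ?thesis using C by (simp add: abs_mult)
      qed
      then show "AE \<tau> in M. norm (Z \<tau> * exp (D y \<tau>)) \<le> C * exp (a * u)" by (rule AE_I2)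
    qed simp
    have int_Z: "integrable M Z"
      by (rule integrable_const_bound[where B=C]) (auto intro: Z)
    have int_in: "integrable M (\<lambda>\<tau>. Z \<tau> * (s \<tau> \<bullet> (y - x)))"
    proof -
      have "integrable M (\<lambda>\<tau>. (Z \<tau> *\<^sub>R s \<tau>) \<bullet> (y - x))"
        by (rule integrable_inner_left) (rule int_Zs)
      then show ?thesis by simp
    qed
    have "(\<integral>\<tau>. Z \<tau> * exp (D x \<tau>) \<partial>M) = (\<integral>\<tau>. Z \<tau> \<partial>M)"
      by (intro Bochner_Integration.integral_cong) (auto simp: D0)
    moreover have "(\<integral>\<tau>. Z \<tau> *\<^sub>R s \<tau> \<partial>M) \<bullet> (y - x) = (\<integral>\<tau>. Z \<tau> * (s \<tau> \<bullet> (y - x)) \<partial>M)"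
      using int_Zs by (subst integral_inner_left[symmetric]) (auto simp: ac_simps)
    ultimately have "(\<integral>\<tau>. Z \<tau> * exp (D y \<tau>) \<partial>M) - (\<integral>\<tau>. Z \<tau> * exp (D x \<tau>) \<partial>M)
        - (\<integral>\<tau>. Z \<tau> *\<^sub>R s \<tau> \<partial>M) \<bullet> (y - x)
      = (\<integral>\<tau>. Z \<tau> * (exp (D y \<tau>) - 1 - s \<tau> \<bullet> (y - x)) \<partial>M)"
      using int_exp int_Z int_in by (simp add: right_diff_distrib)
    also have "\<bar>\<dots>\<bar> \<le> C * ((2 * a\<^sup>2 + h') * u\<^sup>2)"
    proof -
      let ?f = "\<lambda>\<tau>. Z \<tau> * (exp (D y \<tau>) - 1 - s \<tau> \<bullet> (y - x))"
      have int: "integrable M ?f"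
        using int_exp int_Z int_in by (simp add: right_diff_distrib)
      have "\<bar>\<integral>\<tau>. ?f \<tau> \<partial>M\<bar> \<le> (\<integral>\<tau>. \<bar>?f \<tau>\<bar> \<partial>M)"
        by (rule integral_abs_bound)
      also have "\<dots> \<le> (\<integral>\<tau>. C * ((2 * a\<^sup>2 + h') * u\<^sup>2) \<partial>M)"
      proof (rule integral_mono)
        show "\<bar>?f \<tau>\<bar> \<le> C * ((2 * a\<^sup>2 + h') * u\<^sup>2)" if "\<tau> \<in> space M" for \<tau>
          using mult_mono[OF Z[OF that] bd[OF that] C] by (simp add: abs_mult)
      qed (use int in auto)
      finally have "\<bar>\<integral>\<tau>. ?f \<tau> \<partial>M\<bar> \<le> (\<integral>\<tau>. C * ((2 * a\<^sup>2 + h') * u\<^sup>2) \<partial>M)" .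
      then show ?thesis by (simp add: prob_space)
    qed
    finally show "\<bar>(\<integral>\<tau>. Z \<tau> * exp (D y \<tau>) \<partial>M) - (\<integral>\<tau>. Z \<tau> * exp (D x \<tau>) \<partial>M)
        - (\<integral>\<tau>. Z \<tau> *\<^sub>R s \<tau> \<partial>M) \<bullet> (y - x)\<bar> \<le> (C * (2 * a\<^sup>2 + h')) * (norm (y - x))\<^sup>2"
      by (simp add: u_def mult.assoc)
  qed
qed

section \<open>Second moments of mini-batch averages\<close>

lemma (in prob_space) nn_integral_centered_square:
  fixes f :: "'a \<Rightarrow> 'v::euclidean_space"
  assumes f: "integrable M f" "integrable M (\<lambda>x. (norm (f x))\<^sup>2)"
    and mean: "(\<integral>x. f x \<partial>M) = 0" and s: "(\<integral>x. (norm (f x))\<^sup>2 \<partial>M) \<le> s"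
  shows "(\<integral>\<^sup>+x. ennreal ((norm (c + a *\<^sub>R f x))\<^sup>2) \<partial>M) \<le> ennreal ((norm c)\<^sup>2 + a\<^sup>2 * s)"
proof -
  have eq: "(norm (c + a *\<^sub>R f x))\<^sup>2 = (norm c)\<^sup>2 + 2 * a * (c \<bullet> f x) + a\<^sup>2 * (norm (f x))\<^sup>2" for x
    unfolding power2_norm_eq_inner
    by (simp add: inner_add_left inner_add_right inner_commute power2_eq_square algebra_simps)
  have int: "integrable M (\<lambda>x. c \<bullet> f x)" using f(1) by simp
  have "(\<integral>\<^sup>+x. ennreal ((norm (c + a *\<^sub>R f x))\<^sup>2) \<partial>M) = ennreal (\<integral>x. (norm (c + a *\<^sub>R f x))\<^sup>2 \<partial>M)"
  proof (rule nn_integral_eq_integral)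
    show "integrable M (\<lambda>x. (norm (c + a *\<^sub>R f x))\<^sup>2)" unfolding eq using f int by simp
  qed simp
  also have "(\<integral>x. (norm (c + a *\<^sub>R f x))\<^sup>2 \<partial>M)
      = (norm c)\<^sup>2 + 2 * a * (c \<bullet> (\<integral>x. f x \<partial>M)) + a\<^sup>2 * (\<integral>x. (norm (f x))\<^sup>2 \<partial>M)"
    unfolding eq using f int by (simp add: prob_space)
  also have "\<dots> \<le> (norm c)\<^sup>2 + a\<^sup>2 * s"
    using mult_left_mono[OF s, of "a\<^sup>2"] by (simp add: mean)
  finally show ?thesis by (simp add: ennreal_leI)
qed

text \<open>The newest sample is integrated out while the earlier ones are absorbed into the
  constant \<open>c\<close>; centring kills its cross term. Independence thus enters only through
  the product measure, and no pairwise orthogonality has to be established.\<close>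

lemma (in prob_space) nn_integral_batch_square:
  fixes f :: "'a \<Rightarrow> 'v::euclidean_space"
  assumes f: "integrable M f" "integrable M (\<lambda>x. (norm (f x))\<^sup>2)"
    and mean: "(\<integral>x. f x \<partial>M) = 0" and s: "(\<integral>x. (norm (f x))\<^sup>2 \<partial>M) \<le> s"
  shows "(\<integral>\<^sup>+X. ennreal ((norm (c + a *\<^sub>R (\<Sum>i<n. f (X i))))\<^sup>2) \<partial>PiM {..<n} (\<lambda>_. M))
    \<le> ennreal ((norm c)\<^sup>2 + real n * (a\<^sup>2 * s))"
proof (induction n)
  case 0
  interpret E: prob_space "PiM {} (\<lambda>_::nat. M)" by (rule prob_space_PiM) simp
  show ?case by (simp add: E.emeasure_space_1)
next
  case (Suc n)
  interpret Pn: prob_space "PiM {..<n} (\<lambda>_::nat. M)" by (intro prob_space_PiM prob_space_axioms)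
  interpret PS: product_sigma_finite "\<lambda>_::nat. M" by unfold_locales
  have [measurable]: "f \<in> borel_measurable M" using f by simp
  have s0: "0 \<le> s" using s by (rule order_trans[rotated]) (rule integral_nonneg_AE, simp)
  let ?h = "\<lambda>n X. ennreal ((norm (c + a *\<^sub>R (\<Sum>i<n. f (X i))))\<^sup>2)"
  have "(\<integral>\<^sup>+X. ?h (Suc n) X \<partial>PiM {..<Suc n} (\<lambda>_. M))
      = (\<integral>\<^sup>+X. ?h (Suc n) X \<partial>PiM (insert n {..<n}) (\<lambda>_. M))"
    by (simp add: lessThan_Suc)
  also have "\<dots> = (\<integral>\<^sup>+X. (\<integral>\<^sup>+y. ?h (Suc n) (X(n := y)) \<partial>M) \<partial>PiM {..<n} (\<lambda>_. M))"
    by (rule PS.product_nn_integral_insert) auto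
  also have "\<dots> \<le> (\<integral>\<^sup>+X. ?h n X + ennreal (a\<^sup>2 * s) \<partial>PiM {..<n} (\<lambda>_. M))"
  proof (rule nn_integral_mono)
    fix X
    have "(\<integral>\<^sup>+y. ?h (Suc n) (X(n := y)) \<partial>M)
        = (\<integral>\<^sup>+y. ennreal ((norm ((c + a *\<^sub>R (\<Sum>i<n. f (X i))) + a *\<^sub>R f y))\<^sup>2) \<partial>M)"
      by (intro nn_integral_cong) (simp add: scaleR_add_right add.assoc)
    also have "\<dots> \<le> ennreal ((norm (c + a *\<^sub>R (\<Sum>i<n. f (X i))))\<^sup>2 + a\<^sup>2 * s)"
      by (rule nn_integral_centered_square[OF f mean s])
    finally show "(\<integral>\<^sup>+y. ?h (Suc n) (X(n := y)) \<partial>M) \<le> ?h n X + ennreal (a\<^sup>2 * s)"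
      using s0 by (simp add: ennreal_plus)
  qed
  also have "\<dots> = (\<integral>\<^sup>+X. ?h n X \<partial>PiM {..<n} (\<lambda>_. M)) + ennreal (a\<^sup>2 * s)"
    by (subst nn_integral_add) (auto simp: Pn.emeasure_space_1)
  also have "\<dots> \<le> ennreal ((norm c)\<^sup>2 + real n * (a\<^sup>2 * s)) + ennreal (a\<^sup>2 * s)"
    by (intro add_right_mono Suc.IH)
  also have "\<dots> = ennreal ((norm c)\<^sup>2 + real (Suc n) * (a\<^sup>2 * s))"
    using s0 by (subst ennreal_plus[symmetric]) (auto simp: algebra_simps)
  finally show ?case .
qed

text \<open>By Fubini the second batch is integrated first, with the contribution of the first batch
  as part of the constant.\<close>

lemma (in prob_space) nn_integral_two_batches_square:
  fixes f f' :: "'a \<Rightarrow> 'v::euclidean_space"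
  assumes f: "integrable M f" "integrable M (\<lambda>x. (norm (f x))\<^sup>2)"
      "(\<integral>x. f x \<partial>M) = 0" "(\<integral>x. (norm (f x))\<^sup>2 \<partial>M) \<le> s"
    and f': "integrable M f'" "integrable M (\<lambda>x. (norm (f' x))\<^sup>2)"
      "(\<integral>x. f' x \<partial>M) = 0" "(\<integral>x. (norm (f' x))\<^sup>2 \<partial>M) \<le> s'"
  shows "(\<integral>\<^sup>+(X, Y). ennreal ((norm (c + a *\<^sub>R (\<Sum>i<n. f (X i)) + a' *\<^sub>R (\<Sum>i<n'. f' (Y i))))\<^sup>2)
            \<partial>(PiM {..<n} (\<lambda>_. M) \<Otimes>\<^sub>M PiM {..<n'} (\<lambda>_. M)))
    \<le> ennreal ((norm c)\<^sup>2 + real n * (a\<^sup>2 * s) + real n' * (a'\<^sup>2 * s'))"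
proof -
  interpret X: prob_space "PiM {..<n} (\<lambda>_::nat. M)" by (intro prob_space_PiM prob_space_axioms)
  interpret Y: prob_space "PiM {..<n'} (\<lambda>_::nat. M)" by (intro prob_space_PiM prob_space_axioms)
  have [measurable]: "f \<in> borel_measurable M" "f' \<in> borel_measurable M" using f f' by auto
  have s0: "0 \<le> s" using f(4) by (rule order_trans[rotated]) (rule integral_nonneg_AE, simp)
  have s'0: "0 \<le> s'" using f'(4) by (rule order_trans[rotated]) (rule integral_nonneg_AE, simp)
  let ?c = "\<lambda>X. c + a *\<^sub>R (\<Sum>i<n. f (X i))"
  have "(\<integral>\<^sup>+(X, Y). ennreal ((norm (?c X + a' *\<^sub>R (\<Sum>i<n'. f' (Y i))))\<^sup>2)
            \<partial>(PiM {..<n} (\<lambda>_. M) \<Otimes>\<^sub>M PiM {..<n'} (\<lambda>_. M)))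
      = (\<integral>\<^sup>+X. \<integral>\<^sup>+Y. ennreal ((norm (?c X + a' *\<^sub>R (\<Sum>i<n'. f' (Y i))))\<^sup>2)
            \<partial>PiM {..<n'} (\<lambda>_. M) \<partial>PiM {..<n} (\<lambda>_. M))"
    by (subst Y.nn_integral_fst[symmetric]) (auto simp: case_prod_beta)
  also have "\<dots> \<le> (\<integral>\<^sup>+X. ennreal ((norm (?c X))\<^sup>2 + real n' * (a'\<^sup>2 * s')) \<partial>PiM {..<n} (\<lambda>_. M))"
    by (intro nn_integral_mono nn_integral_batch_square[OF f'])
  also have "\<dots> = (\<integral>\<^sup>+X. ennreal ((norm (?c X))\<^sup>2) + ennreal (real n' * (a'\<^sup>2 * s')) \<partial>PiM {..<n} (\<lambda>_. M))"
    using s'0 by (simp add: ennreal_plus)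
  also have "\<dots> = (\<integral>\<^sup>+X. ennreal ((norm (?c X))\<^sup>2) \<partial>PiM {..<n} (\<lambda>_. M)) + ennreal (real n' * (a'\<^sup>2 * s'))"
    by (subst nn_integral_add) (auto simp: X.emeasure_space_1)
  also have "\<dots> \<le> ennreal ((norm c)\<^sup>2 + real n * (a\<^sup>2 * s)) + ennreal (real n' * (a'\<^sup>2 * s'))"
    by (intro add_right_mono nn_integral_batch_square[OF f])
  also have "\<dots> = ennreal ((norm c)\<^sup>2 + real n * (a\<^sup>2 * s) + real n' * (a'\<^sup>2 * s'))"
    using s0 s'0 by (subst ennreal_plus[symmetric]) auto
  finally show ?thesis .
qed

section \<open>Trajectory densities\<close>

text \<open>Here only the model and its bounds are fixed: the facts about trajectories and
  estimators hold for arbitrary parameters, independently of any run of the algorithm.\<close>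

locale rl_setting =
  fixes P :: "('s, 'a, 'q::finite) rl_problem" and R G M b :: real
  assumes model: "rl_model P"
    and A2: "assumption_A2 P R"
    and A3: "assumption_A3 P G M"
    and baseline_bound: "\<And>t s. t < horizon P \<Longrightarrow> s \<in> space (state_ref P) \<Longrightarrow> \<bar>baseline P t s\<bar> \<le> b"
begin

abbreviation "SA \<equiv> state_ref P \<Otimes>\<^sub>M action_ref P"

lemma sigma_finite_S: "sigma_finite_measure (state_ref P)"
  and sigma_finite_A: "sigma_finite_measure (action_ref P)"
  and init_density: "prob_density (state_ref P) (init P)"
  and transition_measurable3: "(\<lambda>(s, a, s'). transition P s a s')
        \<in> borel_measurable (state_ref P \<Otimes>\<^sub>M action_ref P \<Otimes>\<^sub>M state_ref P)"
  and transition_density: "\<And>s a. s \<in> space (state_ref P) \<Longrightarrow> a \<in> space (action_ref P) \<Longrightarrow>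
        prob_density (state_ref P) (transition P s a)"
  and reward_measurable2: "(\<lambda>(s, a). reward P s a) \<in> borel_measurable SA"
  and discount: "0 < discount P" "discount P < 1"
  and horizon: "0 < horizon P"
  and policy_measurable3: "(\<lambda>(\<theta>, s, a). policy P \<theta> s a)
        \<in> borel_measurable (borel \<Otimes>\<^sub>M state_ref P \<Otimes>\<^sub>M action_ref P)"
  and policy_density: "\<And>\<theta> s. s \<in> space (state_ref P) \<Longrightarrow> prob_density (action_ref P) (policy P \<theta> s)"
  and baseline_measurable: "\<And>t. t < horizon P \<Longrightarrow> baseline P t \<in> borel_measurable (state_ref P)"
  using model unfolding rl_model_def by blast+

lemma R_pos: "0 < R" and reward_bound: "\<And>s a. s \<in> space (state_ref P) \<Longrightarrow> a \<in> space (action_ref P) \<Longrightarrow> \<bar>reward P s a\<bar> \<le> R"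
  using A2 unfolding assumption_A2_def by blast+

lemma G_pos: "0 < G" and M_pos: "0 < M"
  using A3 unfolding assumption_A3_def by blast+

sublocale S: sigma_finite_measure "state_ref P" by (rule sigma_finite_S)
sublocale A: sigma_finite_measure "action_ref P" by (rule sigma_finite_A)
sublocale SA: pair_sigma_finite "state_ref P" "action_ref P" ..

lemma sigma_finite_SA: "sigma_finite_measure SA" ..

sublocale traj: product_sigma_finite "\<lambda>_::nat. SA"
  by (rule product_sigma_finite.intro) (rule sigma_finite_SA)

lemma init_measurable [measurable]: "init P \<in> borel_measurable (state_ref P)"
  using init_density by (simp add: prob_density_def)

lemma transition_measurable [measurable (raw)]:
  assumes [measurable]: "f \<in> N \<rightarrow>\<^sub>M state_ref P" "g \<in> N \<rightarrow>\<^sub>M action_ref P" "h \<in> N \<rightarrow>\<^sub>M state_ref P"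
  shows "(\<lambda>x. transition P (f x) (g x) (h x)) \<in> borel_measurable N"
proof -
  have "(\<lambda>x. (f x, g x, h x)) \<in> N \<rightarrow>\<^sub>M state_ref P \<Otimes>\<^sub>M action_ref P \<Otimes>\<^sub>M state_ref P" by measurable
  from measurable_compose[OF this transition_measurable3] show ?thesis by simp
qed

lemma reward_measurable [measurable (raw)]:
  assumes [measurable]: "f \<in> N \<rightarrow>\<^sub>M state_ref P" "g \<in> N \<rightarrow>\<^sub>M action_ref P"
  shows "(\<lambda>x. reward P (f x) (g x)) \<in> borel_measurable N"
proof -
  have "(\<lambda>x. (f x, g x)) \<in> N \<rightarrow>\<^sub>M SA" by measurable
  from measurable_compose[OF this reward_measurable2] show ?thesis by simp
qed

lemma policy_measurable [measurable (raw)]: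
  assumes [measurable]: "\<theta> \<in> borel_measurable N" "f \<in> N \<rightarrow>\<^sub>M state_ref P" "g \<in> N \<rightarrow>\<^sub>M action_ref P"
  shows "(\<lambda>x. policy P (\<theta> x) (f x) (g x)) \<in> borel_measurable N"
proof -
  have "(\<lambda>x. (\<theta> x, f x, g x)) \<in> N \<rightarrow>\<^sub>M borel \<Otimes>\<^sub>M state_ref P \<Otimes>\<^sub>M action_ref P" by measurable
  from measurable_compose[OF this policy_measurable3] show ?thesis by simp
qed

lemma policy_pos: "s \<in> space (state_ref P) \<Longrightarrow> a \<in> space (action_ref P) \<Longrightarrow> 0 < policy P \<theta> s a"
  using A3 unfolding assumption_A3_def by blast

lemma policy_nonneg: "s \<in> space (state_ref P) \<Longrightarrow> a \<in> space (action_ref P) \<Longrightarrow> 0 \<le> policy P \<theta> s a"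
  using policy_pos less_imp_le by blast

lemma score_bound: "s \<in> space (state_ref P) \<Longrightarrow> a \<in> space (action_ref P) \<Longrightarrow> norm (score P \<theta> s a) \<le> G"
  using A3 unfolding assumption_A3_def by blast

text \<open>\<open>grad\<close> is a definite description and says something only once a
  representing vector exists. In finite dimension that vector is assembled from the values of the
  derivative on the basis.\<close>

lemma gderiv_log_policy:
  assumes "s \<in> space (state_ref P)" "a \<in> space (action_ref P)"
  shows "GDERIV (\<lambda>\<theta>'. ln (policy P \<theta>' s a)) \<theta> :> score P \<theta> s a"
proof -
  let ?f = "\<lambda>\<theta>'. ln (policy P \<theta>' s a)"
  have "?f differentiable (at \<theta>)" using A3 assms unfolding assumption_A3_def by blast
  then obtain D where D: "(?f has_derivative D) (at \<theta>)" by (auto simp: differentiable_def)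
  then have lin: "linear D" by (rule has_derivative_linear)
  have "D = (\<lambda>h. h \<bullet> (\<Sum>i\<in>Basis. D i *\<^sub>R i))"
  proof
    fix h
    have "D h = D (\<Sum>i\<in>Basis. (h \<bullet> i) *\<^sub>R i)" by (simp add: euclidean_representation)
    also have "\<dots> = h \<bullet> (\<Sum>i\<in>Basis. D i *\<^sub>R i)"
      by (simp add: linear_sum[OF lin] linear_scale[OF lin] inner_sum_right mult.commute)
    finally show "D h = h \<bullet> (\<Sum>i\<in>Basis. D i *\<^sub>R i)" .
  qed
  with D have "GDERIV ?f \<theta> :> (\<Sum>i\<in>Basis. D i *\<^sub>R i)" unfolding gderiv_def by simp
  with grad_eqI[OF this] show ?thesis by (simp add: score_def)
qed

lemma score_lipschitz:
  assumes "s \<in> space (state_ref P)" "a \<in> space (action_ref P)"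
  shows "norm (score P \<theta> s a - score P \<theta>' s a) \<le> M * norm (\<theta> - \<theta>')"
proof (rule differentiable_bound[where S=UNIV])
  show "((\<lambda>\<theta>'. score P \<theta>' s a) has_derivative frechet_derivative (\<lambda>\<theta>'. score P \<theta>' s a) (at x)) (at x within UNIV)" for x
    using A3 assms unfolding assumption_A3_def by (metis frechet_derivative_works)
  show "onorm (frechet_derivative (\<lambda>\<theta>'. score P \<theta>' s a) (at x)) \<le> M" for x
    using A3 assms unfolding assumption_A3_def by blast
qed auto

text \<open>Measurability is given for the policy only, so each coordinate of the score is obtained
  as a limit of difference quotients of its logarithm with step 1 / (n + 1).\<close>

lemma score_measurable [measurable (raw)]:
  assumes [measurable]: "\<theta> \<in> borel_measurable N" "f \<in> N \<rightarrow>\<^sub>M state_ref P" "g \<in> N \<rightarrow>\<^sub>M action_ref P"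
  shows "(\<lambda>x. score P (\<theta> x) (f x) (g x)) \<in> borel_measurable N"
proof (subst borel_measurable_euclidean_space, intro ballI)
  fix i :: "real^'q" assume "i \<in> Basis"
  let ?q = "\<lambda>n x. (ln (policy P (\<theta> x + (1 / real (Suc n)) *\<^sub>R i) (f x) (g x)) - ln (policy P (\<theta> x) (f x) (g x)))
      * real (Suc n)"
  show "(\<lambda>x. score P (\<theta> x) (f x) (g x) \<bullet> i) \<in> borel_measurable N"
  proof (rule borel_measurable_LIMSEQ_real)
    show "?q n \<in> borel_measurable N" for n by measurable
    fix x assume x: "x \<in> space N"
    let ?h = "\<lambda>t. ln (policy P (\<theta> x + t *\<^sub>R i) (f x) (g x))"
    have fg: "f x \<in> space (state_ref P)" "g x \<in> space (action_ref P)"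
      using measurable_space[OF assms(2) x] measurable_space[OF assms(3) x] by auto
    have "((\<lambda>t. \<theta> x + t *\<^sub>R i) has_derivative (\<lambda>t. t *\<^sub>R i)) (at 0)"
      by (auto intro!: derivative_eq_intros)
    from diff_chain_at[OF this, of "\<lambda>\<theta>'. ln (policy P \<theta>' (f x) (g x))"
        "\<lambda>h. h \<bullet> score P (\<theta> x) (f x) (g x)"]
    have "(?h has_derivative (\<lambda>t. (t *\<^sub>R i) \<bullet> score P (\<theta> x) (f x) (g x))) (at 0)"
      using gderiv_log_policy[OF fg] by (simp add: gderiv_def o_def)
    then have "(?h has_real_derivative (score P (\<theta> x) (f x) (g x) \<bullet> i)) (at 0)"
      by (rule has_derivative_imp_has_field_derivative) (simp add: inner_commute)
    then have "(\<lambda>t. (?h (0 + t) - ?h 0) / t) \<midarrow>0\<rightarrow> score P (\<theta> x) (f x) (g x) \<bullet> i"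
      by (simp only: DERIV_def)
    moreover have "filterlim (\<lambda>n. 1 / real (Suc n)) (at 0) sequentially"
      unfolding filterlim_at using LIMSEQ_inverse_real_of_nat by (auto simp: inverse_eq_divide)
    ultimately have "(\<lambda>n. (?h (0 + 1 / real (Suc n)) - ?h 0) / (1 / real (Suc n)))
        \<longlonglongrightarrow> score P (\<theta> x) (f x) (g x) \<bullet> i"
      by (rule filterlim_compose)
    then show "(\<lambda>n. ?q n x) \<longlonglongrightarrow> score P (\<theta> x) (f x) (g x) \<bullet> i" by simp
  qed
qed

lemma traj_coord_space:
  assumes "\<tau> \<in> space (traj_ref P)" "t < horizon P"
  shows "fst (\<tau> t) \<in> space (state_ref P)" "snd (\<tau> t) \<in> space (action_ref P)"
  using assms by (auto simp: traj_ref_def space_PiM space_pair_measure PiE_iff mem_Times_iff)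

lemma traj_state_measurable [measurable (raw)]:
  assumes "T \<in> N \<rightarrow>\<^sub>M traj_ref P" "t < horizon P"
  shows "(\<lambda>x. fst (T x t)) \<in> N \<rightarrow>\<^sub>M state_ref P"
proof -
  have "(\<lambda>x. T x t) \<in> N \<rightarrow>\<^sub>M SA"
    using assms by (auto intro!: measurable_compose[OF _ measurable_component_singleton] simp: traj_ref_def)
  then show ?thesis by (rule measurable_compose) simp
qed

lemma traj_action_measurable [measurable (raw)]:
  assumes "T \<in> N \<rightarrow>\<^sub>M traj_ref P" "t < horizon P"
  shows "(\<lambda>x. snd (T x t)) \<in> N \<rightarrow>\<^sub>M action_ref P"
proof -
  have "(\<lambda>x. T x t) \<in> N \<rightarrow>\<^sub>M SA"
    using assms by (auto intro!: measurable_compose[OF _ measurable_component_singleton] simp: traj_ref_def)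
  then show ?thesis by (rule measurable_compose) simp
qed

lemma traj_density_measurable [measurable (raw)]:
  assumes [measurable]: "\<theta> \<in> borel_measurable N" "T \<in> N \<rightarrow>\<^sub>M traj_ref P"
  shows "(\<lambda>x. traj_density P (\<theta> x) (T x)) \<in> borel_measurable N"
  using horizon unfolding traj_density_def
  by (intro borel_measurable_times borel_measurable_prod measurable_compose[OF _ init_measurable]) auto

lemma traj_return_measurable [measurable (raw)]:
  assumes [measurable]: "T \<in> N \<rightarrow>\<^sub>M traj_ref P"
  shows "(\<lambda>x. traj_return P (T x)) \<in> borel_measurable N"
  unfolding traj_return_def by (intro borel_measurable_sum) auto

lemma grad_est_measurable [measurable (raw)]:
  assumes [measurable]: "\<theta> \<in> borel_measurable N" "T \<in> N \<rightarrow>\<^sub>M traj_ref P"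
  shows "(\<lambda>x. grad_est P (T x) (\<theta> x)) \<in> borel_measurable N"
  unfolding grad_est_def
  by (intro borel_measurable_sum borel_measurable_scaleR borel_measurable_diff
      measurable_compose[OF _ baseline_measurable]) auto

lemma imp_weight_measurable [measurable (raw)]:
  assumes [measurable]: "\<theta> \<in> borel_measurable N" "\<theta>' \<in> borel_measurable N" "T \<in> N \<rightarrow>\<^sub>M traj_ref P"
  shows "(\<lambda>x. imp_weight P (T x) (\<theta> x) (\<theta>' x)) \<in> borel_measurable N"
  unfolding imp_weight_def by measurable


section \<open>Marginals of the trajectory density\<close>

definition arrival :: "(nat \<Rightarrow> 's \<times> 'a) \<Rightarrow> nat \<Rightarrow> 's \<Rightarrow> real" where
  "arrival \<tau> t s = (case t of 0 \<Rightarrow> init P s | Suc r \<Rightarrow> transition P (fst (\<tau> r)) (snd (\<tau> r)) s)"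

text \<open>The policy parameter may vary with time: comparing two parameters at a single time step shows
  that a baseline does not bias the estimator.\<close>

definition path_density :: "(nat \<Rightarrow> real^'q) \<Rightarrow> nat \<Rightarrow> (nat \<Rightarrow> 's \<times> 'a) \<Rightarrow> ennreal" where
  "path_density \<Theta> n \<tau> =
     (\<Prod>t<n. ennreal (arrival \<tau> t (fst (\<tau> t)) * policy P (\<Theta> t) (fst (\<tau> t)) (snd (\<tau> t))))"

abbreviation "paths n \<equiv> PiM {..<n} (\<lambda>_::nat. SA)"

lemma paths_coord_space:
  assumes "\<tau> \<in> space (paths n)" "t < n"
  shows "fst (\<tau> t) \<in> space (state_ref P)" "snd (\<tau> t) \<in> space (action_ref P)"
  using assms by (auto simp: space_PiM space_pair_measure PiE_iff mem_Times_iff)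

lemma arrival_density:
  assumes "\<tau> \<in> space (paths n)"
  shows "prob_density (state_ref P) (arrival \<tau> n)"
  using assms init_density transition_density paths_coord_space
  by (cases n) (auto simp: arrival_def[abs_def])

lemma paths_coord_measurable [measurable (raw)]:
  assumes "T \<in> N \<rightarrow>\<^sub>M paths n" "t < n"
  shows "(\<lambda>x. T x t) \<in> N \<rightarrow>\<^sub>M SA"
  using assms by (auto intro!: measurable_compose[OF _ measurable_component_singleton])

lemma paths_state_measurable:
  assumes "t < n"
  shows "(\<lambda>\<tau>. fst (\<tau> t)) \<in> paths n \<rightarrow>\<^sub>M state_ref P"
  using paths_coord_measurable[OF measurable_ident assms] by simp

lemma arrival_measurable [measurable (raw)]:
  assumes T: "T \<in> N \<rightarrow>\<^sub>M paths n" "t \<le> n" and [measurable]: "f \<in> N \<rightarrow>\<^sub>M state_ref P"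
  shows "(\<lambda>x. arrival (T x) t (f x)) \<in> borel_measurable N"
proof (cases t)
  case (Suc r)
  then have [measurable]: "(\<lambda>x. T x r) \<in> N \<rightarrow>\<^sub>M SA" using T by simp
  show ?thesis by (simp add: Suc arrival_def)
qed (simp add: arrival_def measurable_compose[OF _ init_measurable])

lemma path_density_measurable [measurable (raw)]:
  assumes T: "T \<in> N \<rightarrow>\<^sub>M paths n"
  shows "(\<lambda>x. path_density \<Theta> n (T x)) \<in> borel_measurable N"
  unfolding path_density_def
proof (intro borel_measurable_prod_ennreal measurable_compose[OF _ measurable_ennreal] borel_measurable_times)
  fix t assume "t \<in> {..<n}"
  then have [measurable]: "(\<lambda>x. T x t) \<in> N \<rightarrow>\<^sub>M SA" and "t \<le> n" using T by auto
  show "(\<lambda>x. arrival (T x) t (fst (T x t))) \<in> borel_measurable N"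
    by (rule arrival_measurable[OF T \<open>t \<le> n\<close>]) simp
  show "(\<lambda>x. policy P (\<Theta> t) (fst (T x t)) (snd (T x t))) \<in> borel_measurable N" by measurable
qed

text \<open>The last action integrates to 1 against its policy, whatever the parameter. This is the
  source of the insensitivity of the state law to the policy used at the same time step.\<close>

lemma nn_integral_last_step:
  assumes \<tau>: "\<tau> \<in> space (paths n)" and [measurable]: "u \<in> borel_measurable (state_ref P)"
  shows "(\<integral>\<^sup>+y. ennreal (arrival \<tau> n (fst y) * policy P \<theta> (fst y) (snd y)) * u (fst y) \<partial>SA)
    = (\<integral>\<^sup>+s. ennreal (arrival \<tau> n s) * u s \<partial>state_ref P)"
proof -
  have arr: "arrival \<tau> n \<in> borel_measurable (state_ref P)"
      "\<And>s. s \<in> space (state_ref P) \<Longrightarrow> 0 \<le> arrival \<tau> n s"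
    using arrival_density[OF \<tau>] by (auto simp: prob_density_def)
  note arr(1)[measurable]
  have "(\<integral>\<^sup>+y. ennreal (arrival \<tau> n (fst y) * policy P \<theta> (fst y) (snd y)) * u (fst y) \<partial>SA)
     = (\<integral>\<^sup>+s. \<integral>\<^sup>+a. ennreal (arrival \<tau> n s * policy P \<theta> s a) * u s \<partial>action_ref P \<partial>state_ref P)"
    by (subst A.nn_integral_fst[symmetric]) auto
  also have "\<dots> = (\<integral>\<^sup>+s. ennreal (arrival \<tau> n s) * u s \<partial>state_ref P)"
  proof (rule nn_integral_cong)
    fix s assume s: "s \<in> space (state_ref P)"
    have [measurable]: "(\<lambda>a. ennreal (policy P \<theta> s a)) \<in> borel_measurable (action_ref P)"
      using policy_density[OF s] by (simp add: prob_density_def)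
    have "(\<integral>\<^sup>+a. ennreal (arrival \<tau> n s * policy P \<theta> s a) * u s \<partial>action_ref P)
      = (\<integral>\<^sup>+a. (ennreal (arrival \<tau> n s) * u s) * ennreal (policy P \<theta> s a) \<partial>action_ref P)"
      using arr(2)[OF s] policy_pos[OF s]
      by (intro nn_integral_cong) (simp add: ennreal_mult less_imp_le ac_simps)
    also have "\<dots> = (ennreal (arrival \<tau> n s) * u s) * (\<integral>\<^sup>+a. ennreal (policy P \<theta> s a) \<partial>action_ref P)"
      by (rule nn_integral_cmult) simp
    also have "(\<integral>\<^sup>+a. ennreal (policy P \<theta> s a) \<partial>action_ref P) = 1"
      using policy_density[OF s] by (simp add: prob_density_def)
    finally show "(\<integral>\<^sup>+a. ennreal (arrival \<tau> n s * policy P \<theta> s a) * u s \<partial>action_ref P)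
      = ennreal (arrival \<tau> n s) * u s" by simp
  qed
  finally show ?thesis .
qed

text \<open>\<open>arrival\<close> at time \<open>t\<close> reads only coordinate
  \<open>t - 1\<close>, with the initial density in its place at time 0. Overwriting coordinate
  \<open>n\<close> therefore leaves all arrival factors up to and including time \<open>n\<close>
  unchanged.\<close>

lemma path_density_update:
  "path_density \<Theta> (Suc n) (\<tau>(n := y))
    = path_density \<Theta> n \<tau> * ennreal (arrival \<tau> n (fst y) * policy P (\<Theta> n) (fst y) (snd y))"
proof -
  have "arrival (\<tau>(n := y)) t = arrival \<tau> t" if "t \<le> n" for t
    using that by (cases t) (auto simp: arrival_def fun_eq_iff)
  then show ?thesis by (simp add: path_density_def)
qed

lemma nn_integral_path_Suc:
  assumes h: "h \<in> borel_measurable (paths (Suc n))"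
  shows "(\<integral>\<^sup>+\<tau>. path_density \<Theta> (Suc n) \<tau> * h \<tau> \<partial>paths (Suc n))
    = (\<integral>\<^sup>+\<tau>. path_density \<Theta> n \<tau> * (\<integral>\<^sup>+y. ennreal (arrival \<tau> n (fst y) *
          policy P (\<Theta> n) (fst y) (snd y)) * h (\<tau>(n := y)) \<partial>SA) \<partial>paths n)"
proof -
  have meas: "(\<lambda>\<tau>. path_density \<Theta> (Suc n) \<tau> * h \<tau>) \<in> borel_measurable (paths (Suc n))"
    using h by measurable
  have "(\<integral>\<^sup>+\<tau>. path_density \<Theta> (Suc n) \<tau> * h \<tau> \<partial>paths (Suc n))
    = (\<integral>\<^sup>+\<tau>. (\<integral>\<^sup>+y. path_density \<Theta> (Suc n) (\<tau>(n := y)) * h (\<tau>(n := y)) \<partial>SA) \<partial>paths n)"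
    unfolding lessThan_Suc
    by (rule traj.product_nn_integral_insert) (use meas in \<open>auto simp: lessThan_Suc\<close>)
  also have "\<dots> = (\<integral>\<^sup>+\<tau>. path_density \<Theta> n \<tau> * (\<integral>\<^sup>+y. ennreal (arrival \<tau> n (fst y) *
          policy P (\<Theta> n) (fst y) (snd y)) * h (\<tau>(n := y)) \<partial>SA) \<partial>paths n)"
  proof (rule nn_integral_cong)
    fix \<tau> assume \<tau>: "\<tau> \<in> space (paths n)"
    have upd: "(\<lambda>y. \<tau>(n := y)) \<in> SA \<rightarrow>\<^sub>M paths (Suc n)"
      unfolding lessThan_Suc by (rule measurable_component_update[OF \<tau>]) simp
    have [measurable]: "(\<lambda>y. h (\<tau>(n := y))) \<in> borel_measurable SA"
      using measurable_compose[OF upd h] .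
    have [measurable]: "arrival \<tau> n \<in> borel_measurable (state_ref P)"
      using arrival_density[OF \<tau>] by (simp add: prob_density_def)
    show "(\<integral>\<^sup>+y. path_density \<Theta> (Suc n) (\<tau>(n := y)) * h (\<tau>(n := y)) \<partial>SA)
      = path_density \<Theta> n \<tau> * (\<integral>\<^sup>+y. ennreal (arrival \<tau> n (fst y) *
          policy P (\<Theta> n) (fst y) (snd y)) * h (\<tau>(n := y)) \<partial>SA)"
      unfolding path_density_update mult.assoc by (rule nn_integral_cmult) measurable
  qed
  finally show ?thesis .
qed

lemma nn_integral_path_state_Suc:
  assumes u: "u \<in> borel_measurable (state_ref P)" and t: "t < n"
  shows "(\<integral>\<^sup>+\<tau>. path_density \<Theta> (Suc n) \<tau> * u (fst (\<tau> t)) \<partial>paths (Suc n))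
    = (\<integral>\<^sup>+\<tau>. path_density \<Theta> n \<tau> * u (fst (\<tau> t)) \<partial>paths n)"
proof -
  have h: "(\<lambda>\<tau>. u (fst (\<tau> t))) \<in> borel_measurable (paths (Suc n))"
    using t by (intro measurable_compose[OF _ u] paths_state_measurable) simp
  have "(\<integral>\<^sup>+y. ennreal (arrival \<tau> n (fst y) * policy P (\<Theta> n) (fst y) (snd y)) * u (fst ((\<tau>(n := y)) t)) \<partial>SA)
    = u (fst (\<tau> t))" if \<tau>: "\<tau> \<in> space (paths n)" for \<tau>
  proof -
    have [measurable]: "arrival \<tau> n \<in> borel_measurable (state_ref P)" and one: "(\<integral>\<^sup>+s. ennreal (arrival \<tau> n s) \<partial>state_ref P) = 1"
      using arrival_density[OF \<tau>] by (auto simp: prob_density_def)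
    have "(\<integral>\<^sup>+y. ennreal (arrival \<tau> n (fst y) * policy P (\<Theta> n) (fst y) (snd y)) * u (fst ((\<tau>(n := y)) t)) \<partial>SA)
      = (\<integral>\<^sup>+y. ennreal (arrival \<tau> n (fst y) * policy P (\<Theta> n) (fst y) (snd y)) * u (fst (\<tau> t)) \<partial>SA)"
      using t by simp
    also have "\<dots> = (\<integral>\<^sup>+s. ennreal (arrival \<tau> n s) * u (fst (\<tau> t)) \<partial>state_ref P)"
      by (rule nn_integral_last_step[OF \<tau>]) simp
    also have "\<dots> = u (fst (\<tau> t))" by (simp add: nn_integral_multc one)
    finally show ?thesis .
  qed
  then show ?thesis unfolding nn_integral_path_Suc[OF h] by (intro nn_integral_cong) simp
qed

lemma nn_integral_path_state:
  assumes u: "u \<in> borel_measurable (state_ref P)" and t: "t < n"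
  shows "(\<integral>\<^sup>+\<tau>. path_density \<Theta> n \<tau> * u (fst (\<tau> t)) \<partial>paths n)
    = (\<integral>\<^sup>+\<tau>. path_density \<Theta> t \<tau> * (\<integral>\<^sup>+s. ennreal (arrival \<tau> t s) * u s \<partial>state_ref P) \<partial>paths t)"
proof -
  from t have "Suc t \<le> n" by simp
  then have "(\<integral>\<^sup>+\<tau>. path_density \<Theta> n \<tau> * u (fst (\<tau> t)) \<partial>paths n)
    = (\<integral>\<^sup>+\<tau>. path_density \<Theta> (Suc t) \<tau> * u (fst (\<tau> t)) \<partial>paths (Suc t))"
    by (induction n rule: dec_induct) (auto simp: nn_integral_path_state_Suc[OF u])
  also have "\<dots> = (\<integral>\<^sup>+\<tau>. path_density \<Theta> t \<tau> * (\<integral>\<^sup>+s. ennreal (arrival \<tau> t s) * u s \<partial>state_ref P) \<partial>paths t)"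
  proof (subst nn_integral_path_Suc)
    show "(\<lambda>\<tau>. u (fst (\<tau> t))) \<in> borel_measurable (paths (Suc t))"
      by (intro measurable_compose[OF _ u] paths_state_measurable) simp
  qed (auto intro!: nn_integral_cong simp: nn_integral_last_step[OF _ u])
  finally show ?thesis .
qed

text \<open>Causality: the law of the state at time \<open>t\<close> involves only the parameters
  used strictly before \<open>t\<close>. The baseline argument applies it with a parameter changed
  at time \<open>t\<close> itself.\<close>

lemma nn_integral_path_state_cong:
  assumes u: "u \<in> borel_measurable (state_ref P)" and t: "t < n" and "\<And>j. j < t \<Longrightarrow> \<Theta> j = \<Theta>' j"
  shows "(\<integral>\<^sup>+\<tau>. path_density \<Theta> n \<tau> * u (fst (\<tau> t)) \<partial>paths n)
    = (\<integral>\<^sup>+\<tau>. path_density \<Theta>' n \<tau> * u (fst (\<tau> t)) \<partial>paths n)"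
proof -
  have "path_density \<Theta> t = path_density \<Theta>' t" using assms(3) by (simp add: path_density_def fun_eq_iff)
  then show ?thesis by (simp add: nn_integral_path_state[OF u t])
qed

lemma nn_integral_path_density: "(\<integral>\<^sup>+\<tau>. path_density \<Theta> n \<tau> \<partial>paths n) = 1"
proof (induction n)
  case 0
  show ?case by (simp add: path_density_def PiM_empty nn_integral_count_space_finite)
next
  case (Suc n)
  have "(\<integral>\<^sup>+s. ennreal (arrival \<tau> n s) \<partial>state_ref P) = 1" if "\<tau> \<in> space (paths n)" for \<tau>
    using arrival_density[OF that] by (simp add: prob_density_def)
  moreover have "(\<integral>\<^sup>+\<tau>. path_density \<Theta> (Suc n) \<tau> * 1 \<partial>paths (Suc n)) =
      (\<integral>\<^sup>+\<tau>. path_density \<Theta> n \<tau> * (\<integral>\<^sup>+s. ennreal (arrival \<tau> n s) * 1 \<partial>state_ref P) \<partial>paths n)"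
    by (rule nn_integral_path_state) auto
  ultimately show ?case using Suc by (simp cong: nn_integral_cong)
qed

lemma traj_ref_eq: "traj_ref P = paths (horizon P)"
  by (simp add: traj_ref_def)

lemma traj_density_nonneg:
  assumes "\<tau> \<in> space (traj_ref P)"
  shows "0 \<le> traj_density P \<theta> \<tau>"
proof -
  have "0 \<le> transition P (fst (\<tau> t)) (snd (\<tau> t)) (fst (\<tau> (Suc t)))" if "t < horizon P - 1" for t
    using that traj_coord_space[OF assms] transition_density by (auto simp: prob_density_def)
  moreover have "0 \<le> init P (fst (\<tau> 0))"
    using traj_coord_space[OF assms] horizon init_density by (auto simp: prob_density_def)
  ultimately show ?thesis using traj_coord_space[OF assms]
    by (auto simp: traj_density_def intro!: mult_nonneg_nonneg prod_nonneg policy_nonneg)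
qed

text \<open>The transition factor out of step \<open>t\<close> is regrouped with the policy factor
  at \<open>t + 1\<close>, as its arrival density; this is why one product has
  \<open>horizon P - 1\<close> factors and the other \<open>horizon P\<close>.\<close>

lemma traj_density_eq_path_density:
  assumes \<tau>: "\<tau> \<in> space (traj_ref P)"
  shows "ennreal (traj_density P \<theta> \<tau>) = path_density (\<lambda>_. \<theta>) (horizon P) \<tau>"
proof -
  obtain h where h: "horizon P = Suc h" using horizon by (cases "horizon P") auto
  have nn: "0 \<le> arrival \<tau> t (fst (\<tau> t))" if "t < horizon P" for t
    using that traj_coord_space[OF \<tau>] transition_density init_density horizon
    by (cases t) (auto simp: prob_density_def arrival_def)
  have "(\<Prod>t<Suc h. arrival \<tau> t (fst (\<tau> t)))
     = init P (fst (\<tau> 0)) * (\<Prod>t<h. transition P (fst (\<tau> t)) (snd (\<tau> t)) (fst (\<tau> (Suc t))))"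
    unfolding prod.lessThan_Suc_shift by (simp add: arrival_def)
  then have "traj_density P \<theta> \<tau> = (\<Prod>t<horizon P. arrival \<tau> t (fst (\<tau> t)) * policy P \<theta> (fst (\<tau> t)) (snd (\<tau> t)))"
    by (simp add: traj_density_def prod.distrib h)
  then show ?thesis unfolding path_density_def using nn traj_coord_space[OF \<tau>]
    by (subst prod_ennreal) (auto intro!: mult_nonneg_nonneg policy_nonneg)
qed

lemma sets_traj_law [measurable_cong, simp]: "sets (traj_law P \<theta>) = sets (traj_ref P)"
  by (simp add: traj_law_def)

lemma space_traj_law [simp]: "space (traj_law P \<theta>) = space (traj_ref P)"
  by (simp add: traj_law_def)

lemma nn_integral_traj_law:
  assumes [measurable]: "f \<in> borel_measurable (traj_ref P)"
  shows "(\<integral>\<^sup>+\<tau>. f \<tau> \<partial>traj_law P \<theta>) = (\<integral>\<^sup>+\<tau>. path_density (\<lambda>_. \<theta>) (horizon P) \<tau> * f \<tau> \<partial>traj_ref P)"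
  unfolding traj_law_def
  by (subst nn_integral_density) (auto intro!: nn_integral_cong simp: traj_density_eq_path_density)

lemma prob_space_traj_law: "prob_space (traj_law P \<theta>)"
proof
  have "emeasure (traj_law P \<theta>) (space (traj_law P \<theta>)) = (\<integral>\<^sup>+\<tau>. 1 \<partial>traj_law P \<theta>)" by simp
  also have "\<dots> = 1" by (subst nn_integral_traj_law) (auto simp: traj_ref_eq nn_integral_path_density)
  finally show "emeasure (traj_law P \<theta>) (space (traj_law P \<theta>)) = 1" .
qed

end

section \<open>Policy gradient\<close>

text \<open>With y = exp x between exp (-a) and exp a, expand (exp a - y) (y - exp (-a)) \<ge> 0.
  This is the pointwise form of the Bhatia-Davis inequality for a variable of mean 1.\<close>

lemma square_exp_diff_bound:
  fixes x :: real
  assumes "\<bar>x\<bar> \<le> a"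
  shows "(exp x - 1)\<^sup>2 \<le> (exp a + exp (- a) - 2) * exp x"
proof -
  have "0 \<le> (exp a - exp x) * (exp x - exp (- a))"
    using assms by (intro mult_nonneg_nonneg) auto
  moreover have "exp a * exp (- a) = 1" by (simp flip: exp_add)
  ultimately show ?thesis by (simp add: power2_eq_square algebra_simps)
qed

text \<open>The left-hand side factors as (exp a - 1) (1 - exp (-a)), and each factor is linear in
  \<open>a\<close> on [0, 1].\<close>

lemma exp_plus_exp_minus_bound:
  fixes a :: real
  assumes "0 \<le> a" "a \<le> 1"
  shows "exp a + exp (- a) - 2 \<le> 2 * a\<^sup>2"
proof -
  have 1: "exp a - 1 \<le> 2 * a"
    using exp_bound[OF assms] mult_left_mono[OF assms(2,1)] by (simp add: power2_eq_square)
  have 2: "1 - exp (- a) \<le> a" using exp_ge_add_one_self[of "-a"] by simp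
  have "(exp a - 1) * (1 - exp (- a)) \<le> (2 * a) * a"
    using assms by (intro mult_mono 1 2) auto
  moreover have "exp a * exp (- a) = 1" by (simp flip: exp_add)
  ultimately show ?thesis by (simp add: power2_eq_square algebra_simps)
qed

context rl_setting
begin

section \<open>Log-likelihood ratios of policies\<close>

definition log_ratio :: "real^'q \<Rightarrow> real^'q \<Rightarrow> 's \<times> 'a \<Rightarrow> real" where
  "log_ratio \<theta> \<theta>' y = ln (policy P \<theta>' (fst y) (snd y)) - ln (policy P \<theta> (fst y) (snd y))"

definition traj_log_ratio :: "real^'q \<Rightarrow> real^'q \<Rightarrow> (nat \<Rightarrow> 's \<times> 'a) \<Rightarrow> real" where
  "traj_log_ratio \<theta> \<theta>' \<tau> = (\<Sum>t<horizon P. log_ratio \<theta> \<theta>' (\<tau> t))"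

lemma exp_log_ratio:
  assumes "y \<in> space SA"
  shows "policy P \<theta>' (fst y) (snd y) = policy P \<theta> (fst y) (snd y) * exp (log_ratio \<theta> \<theta>' y)"
proof -
  have "fst y \<in> space (state_ref P)" "snd y \<in> space (action_ref P)"
    using assms by (auto simp: space_pair_measure)
  from policy_pos[OF this, of \<theta>] policy_pos[OF this, of \<theta>'] show ?thesis
    by (simp add: log_ratio_def exp_diff)
qed

text \<open>The one-sided smoothness bound is applied to the log-policy and to its negative.\<close>

lemma log_ratio_first_order:
  assumes "y \<in> space SA"
  shows "\<bar>log_ratio \<theta> \<theta>' y - score P \<theta> (fst y) (snd y) \<bullet> (\<theta>' - \<theta>)\<bar> \<le> M * (norm (\<theta>' - \<theta>))\<^sup>2"
proof -
  have y: "fst y \<in> space (state_ref P)" "snd y \<in> space (action_ref P)"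
    using assms by (auto simp: space_pair_measure)
  let ?f = "\<lambda>\<theta>. ln (policy P \<theta> (fst y) (snd y))" and ?g = "\<lambda>\<theta>. score P \<theta> (fst y) (snd y)"
  have "?f \<theta> + ?g \<theta> \<bullet> (\<theta>' - \<theta>) - M / 2 * (norm (\<theta>' - \<theta>))\<^sup>2 \<le> ?f \<theta>'"
    by (rule smooth_lower_bound[OF gderiv_log_policy[OF y] score_lipschitz[OF y]])
  moreover have "- ?f \<theta> + (- ?g \<theta>) \<bullet> (\<theta>' - \<theta>) - M / 2 * (norm (\<theta>' - \<theta>))\<^sup>2 \<le> - ?f \<theta>'"
  proof (rule smooth_lower_bound)
    show "GDERIV (\<lambda>\<theta>. - ?f \<theta>) \<theta> :> - ?g \<theta>" for \<theta>
      by (rule GDERIV_minus) (rule gderiv_log_policy[OF y])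
    show "norm (- ?g \<theta> - - ?g \<theta>') \<le> M * norm (\<theta> - \<theta>')" for \<theta> \<theta>'
      using score_lipschitz[OF y, of \<theta> \<theta>'] by (simp add: norm_minus_commute)
  qed
  moreover have "0 \<le> M * (norm (\<theta>' - \<theta>))\<^sup>2" using M_pos by simp
  ultimately show ?thesis by (simp add: log_ratio_def)
qed

lemma log_ratio_bound:
  assumes "y \<in> space SA"
  shows "\<bar>log_ratio \<theta> \<theta>' y\<bar> \<le> G * norm (\<theta>' - \<theta>)"
proof -
  have y: "fst y \<in> space (state_ref P)" "snd y \<in> space (action_ref P)"
    using assms by (auto simp: space_pair_measure)
  have "norm (ln (policy P \<theta>' (fst y) (snd y)) - ln (policy P \<theta> (fst y) (snd y))) \<le> G * norm (\<theta>' - \<theta>)"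
  proof (rule differentiable_bound[where S=UNIV])
    show "((\<lambda>\<theta>. ln (policy P \<theta> (fst y) (snd y))) has_derivative (\<lambda>h. h \<bullet> score P x (fst y) (snd y)))
        (at x within UNIV)" for x
      using gderiv_log_policy[OF y] by (simp add: gderiv_def)
    show "onorm (\<lambda>h. h \<bullet> score P x (fst y) (snd y)) \<le> G" for x
    proof (rule onorm_le)
      fix h
      have "\<bar>h \<bullet> score P x (fst y) (snd y)\<bar> \<le> norm h * norm (score P x (fst y) (snd y))"
        by (rule Cauchy_Schwarz_ineq2)
      also have "\<dots> \<le> norm h * G" by (intro mult_left_mono score_bound y) simp
      finally show "norm (h \<bullet> score P x (fst y) (snd y)) \<le> G * norm h" by (simp add: mult.commute)
    qed
  qed auto
  then show ?thesis by (simp add: log_ratio_def)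
qed

lemma traj_coord_SA: "\<tau> \<in> space (traj_ref P) \<Longrightarrow> t < horizon P \<Longrightarrow> \<tau> t \<in> space SA"
  by (simp add: space_pair_measure mem_Times_iff traj_coord_space)

lemma log_ratio_traj_measurable [measurable]:
  assumes [measurable]: "t < horizon P"
  shows "(\<lambda>\<tau>. log_ratio \<theta> \<theta>' (\<tau> t)) \<in> borel_measurable (traj_ref P)"
  unfolding log_ratio_def by measurable

lemma traj_log_ratio_measurable [measurable]:
  "traj_log_ratio \<theta> \<theta>' \<in> borel_measurable (traj_ref P)"
proof -
  have "(\<lambda>\<tau>. \<Sum>t<horizon P. log_ratio \<theta> \<theta>' (\<tau> t)) \<in> borel_measurable (traj_ref P)"
    by (intro borel_measurable_sum log_ratio_traj_measurable) simp
  then show ?thesis by (simp add: traj_log_ratio_def[abs_def])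
qed

text \<open>Initial and transition densities do not depend on the parameter, so only the policy
  factors change. Written as a product, the identity also holds where the density vanishes, unlike
  the quotient in \<open>imp_weight\<close>.\<close>

lemma traj_density_exp:
  assumes "\<tau> \<in> space (traj_ref P)"
  shows "traj_density P \<theta>' \<tau> = traj_density P \<theta> \<tau> * exp (traj_log_ratio \<theta> \<theta>' \<tau>)"
proof -
  have "(\<Prod>t<horizon P. policy P \<theta>' (fst (\<tau> t)) (snd (\<tau> t)))
    = (\<Prod>t<horizon P. policy P \<theta> (fst (\<tau> t)) (snd (\<tau> t)) * exp (log_ratio \<theta> \<theta>' (\<tau> t)))"
    using traj_coord_SA[OF assms] by (intro prod.cong refl exp_log_ratio) auto
  then show ?thesis by (simp add: traj_density_def traj_log_ratio_def exp_sum prod.distrib)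
qed

lemma traj_log_ratio_bound:
  assumes "\<tau> \<in> space (traj_ref P)"
  shows "\<bar>traj_log_ratio \<theta> \<theta>' \<tau>\<bar> \<le> real (horizon P) * G * norm (\<theta>' - \<theta>)"
proof -
  have "\<bar>traj_log_ratio \<theta> \<theta>' \<tau>\<bar> \<le> (\<Sum>t<horizon P. \<bar>log_ratio \<theta> \<theta>' (\<tau> t)\<bar>)"
    unfolding traj_log_ratio_def by (rule sum_abs)
  also have "\<dots> \<le> (\<Sum>t<horizon P. G * norm (\<theta>' - \<theta>))"
    using traj_coord_SA[OF assms] by (intro sum_mono log_ratio_bound) auto
  finally show ?thesis by (simp add: mult.assoc)
qed

lemma integral_traj_law_change:
  fixes f :: "_ \<Rightarrow> 'v::euclidean_space"
  assumes [measurable]: "f \<in> borel_measurable (traj_ref P)"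
  shows "(\<integral>\<tau>. f \<tau> \<partial>traj_law P \<theta>') = (\<integral>\<tau>. exp (traj_log_ratio \<theta> \<theta>' \<tau>) *\<^sub>R f \<tau> \<partial>traj_law P \<theta>)"
proof -
  have "(\<integral>\<tau>. f \<tau> \<partial>traj_law P \<theta>') = (\<integral>\<tau>. traj_density P \<theta>' \<tau> *\<^sub>R f \<tau> \<partial>traj_ref P)"
    unfolding traj_law_def by (rule integral_density) (auto simp: traj_density_nonneg)
  also have "\<dots> = (\<integral>\<tau>. traj_density P \<theta> \<tau> *\<^sub>R (exp (traj_log_ratio \<theta> \<theta>' \<tau>) *\<^sub>R f \<tau>) \<partial>traj_ref P)"
    by (intro Bochner_Integration.integral_cong) (auto simp: traj_density_exp[of _ \<theta>' \<theta>])
  also have "\<dots> = (\<integral>\<tau>. exp (traj_log_ratio \<theta> \<theta>' \<tau>) *\<^sub>R f \<tau> \<partial>traj_law P \<theta>)"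
    unfolding traj_law_def by (rule integral_density[symmetric]) (auto simp: traj_density_nonneg)
  finally show ?thesis .
qed

lemma path_density_single_change:
  assumes \<tau>: "\<tau> \<in> space (traj_ref P)" and t: "t < horizon P"
  shows "path_density ((\<lambda>_. \<theta>)(t := \<theta>')) (horizon P) \<tau>
    = path_density (\<lambda>_. \<theta>) (horizon P) \<tau> * ennreal (exp (log_ratio \<theta> \<theta>' (\<tau> t)))"
proof -
  have "path_density ((\<lambda>_. \<theta>)(t := \<theta>')) (horizon P) \<tau> =
    (\<Prod>j<horizon P. ennreal (arrival \<tau> j (fst (\<tau> j)) * policy P \<theta> (fst (\<tau> j)) (snd (\<tau> j))) *
       (if j = t then ennreal (exp (log_ratio \<theta> \<theta>' (\<tau> t))) else 1))"
    unfolding path_density_def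
    by (intro prod.cong refl)
      (auto simp: exp_log_ratio[OF traj_coord_SA[OF \<tau> t], of \<theta>' \<theta>] ennreal_mult''[symmetric] mult.assoc)
  then show ?thesis using t by (simp add: prod.distrib path_density_def)
qed

text \<open>The weight switches the policy to the new parameter at time \<open>t\<close> alone, and
  the state at time \<open>t\<close> has been drawn before that switch.\<close>

lemma expectation_state_exp_log_ratio:
  assumes [measurable]: "u \<in> borel_measurable (state_ref P)"
    and u: "\<And>s. s \<in> space (state_ref P) \<Longrightarrow> 0 \<le> u s" and t[measurable]: "t < horizon P"
  shows "(\<integral>\<tau>. u (fst (\<tau> t)) * exp (log_ratio \<theta> \<theta>' (\<tau> t)) \<partial>traj_law P \<theta>) = (\<integral>\<tau>. u (fst (\<tau> t)) \<partial>traj_law P \<theta>)"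
proof -
  have u': "AE \<tau> in traj_law P \<theta>. 0 \<le> u (fst (\<tau> t))"
    using u traj_coord_space t by (auto intro!: AE_I2)
  have "(\<integral>\<^sup>+\<tau>. ennreal (u (fst (\<tau> t)) * exp (log_ratio \<theta> \<theta>' (\<tau> t))) \<partial>traj_law P \<theta>)
    = (\<integral>\<^sup>+\<tau>. path_density ((\<lambda>_. \<theta>)(t := \<theta>')) (horizon P) \<tau> * ennreal (u (fst (\<tau> t))) \<partial>paths (horizon P))"
    by (subst nn_integral_traj_law)
      (auto intro!: nn_integral_cong simp: path_density_single_change[OF _ t] ennreal_mult'' ac_simps
        simp flip: traj_ref_eq)
  also have "\<dots> = (\<integral>\<^sup>+\<tau>. path_density (\<lambda>_. \<theta>) (horizon P) \<tau> * ennreal (u (fst (\<tau> t))) \<partial>paths (horizon P))"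
    by (rule nn_integral_path_state_cong[where u="\<lambda>s. ennreal (u s)"]) (auto simp: t)
  also have "\<dots> = (\<integral>\<^sup>+\<tau>. ennreal (u (fst (\<tau> t))) \<partial>traj_law P \<theta>)"
    by (subst nn_integral_traj_law) (auto simp: traj_ref_eq[symmetric])
  finally show ?thesis
    using u' by (subst (1 2) integral_eq_nn_integral) auto
qed

text \<open>The expectation in the preceding identity is constant in the new parameter, while its
  gradient is the integral in question. Nonnegativity of \<open>u\<close> is inherited from the
  argument by nonnegative integrals.\<close>

lemma expectation_state_score:
  assumes [measurable]: "u \<in> borel_measurable (state_ref P)"
    and u: "\<And>s. s \<in> space (state_ref P) \<Longrightarrow> 0 \<le> u s \<and> u s \<le> K" and t[measurable]: "t < horizon P"
  shows "(\<integral>\<tau>. u (fst (\<tau> t)) *\<^sub>R score P \<theta> (fst (\<tau> t)) (snd (\<tau> t)) \<partial>traj_law P \<theta>) = 0"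
proof -
  interpret T: prob_space "traj_law P \<theta>" by (rule prob_space_traj_law)
  have "GDERIV (\<lambda>\<theta>'. \<integral>\<tau>. u (fst (\<tau> t)) * exp (log_ratio \<theta> \<theta>' (\<tau> t)) \<partial>traj_law P \<theta>) \<theta> :>
     (\<integral>\<tau>. u (fst (\<tau> t)) *\<^sub>R score P \<theta> (fst (\<tau> t)) (snd (\<tau> t)) \<partial>traj_law P \<theta>)"
    by (rule T.gderiv_integral_exp[where C=K and g=G and h=M])
      (use u t traj_coord_space traj_coord_SA log_ratio_first_order score_bound in auto)
  then have "GDERIV (\<lambda>\<theta>'. \<integral>\<tau>. u (fst (\<tau> t)) \<partial>traj_law P \<theta>) \<theta> :>
     (\<integral>\<tau>. u (fst (\<tau> t)) *\<^sub>R score P \<theta> (fst (\<tau> t)) (snd (\<tau> t)) \<partial>traj_law P \<theta>)"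
    using u by (subst (asm) expectation_state_exp_log_ratio) (auto simp: t)
  then show ?thesis using GDERIV_const by (rule gderiv_unique)
qed

section \<open>Bounds and expectation of the gradient estimator\<close>

lemma bound_nonneg: "0 \<le> b"
proof -
  interpret T: prob_space "traj_law P 0" by (rule prob_space_traj_law)
  obtain \<tau> where "\<tau> \<in> space (traj_ref P)" using T.not_empty by auto
  from baseline_bound[OF horizon traj_coord_space(1)[OF this horizon]] show ?thesis by linarith
qed

lemma return_bound:
  assumes \<tau>: "\<tau> \<in> space (traj_ref P)"
  shows "\<bar>traj_return P \<tau>\<bar> \<le> R / (1 - discount P)"
proof -
  have "\<bar>traj_return P \<tau>\<bar> \<le> (\<Sum>t<horizon P. discount P ^ t * R)"
    unfolding traj_return_def
    by (rule order_trans[OF sum_abs sum_mono])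
      (use discount reward_bound traj_coord_space[OF \<tau>] in \<open>auto simp: abs_mult intro!: mult_left_mono\<close>)
  also have "\<dots> = R * ((1 - discount P ^ horizon P) / (1 - discount P))"
    using discount by (simp add: sum_gp_strict flip: sum_distrib_right)
  also have "\<dots> \<le> R * (1 / (1 - discount P))"
    using discount R_pos by (intro mult_left_mono divide_right_mono) auto
  finally show ?thesis by simp
qed

text \<open>The return carries the factor 1 / (1 - discount) from the geometric series; the baseline
  is enlarged by the same factor so that both fit the shape of \<open>C_g\<close> and
  \<open>L_g\<close>.\<close>

lemma return_baseline_bound:
  assumes \<tau>: "\<tau> \<in> space (traj_ref P)" and t: "t < horizon P"
  shows "\<bar>traj_return P \<tau> - baseline P t (fst (\<tau> t))\<bar> \<le> (R + b) / (1 - discount P)"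
proof -
  have "b * (1 - discount P) \<le> b * 1" using bound_nonneg discount by (intro mult_left_mono) auto
  then have "b \<le> b / (1 - discount P)" using discount by (simp add: field_simps)
  then show ?thesis
    using return_bound[OF \<tau>] baseline_bound[OF t traj_coord_space(1)[OF \<tau> t]]
    by (simp add: add_divide_distrib)
qed

lemma grad_est_bound:
  assumes \<tau>: "\<tau> \<in> space (traj_ref P)"
  shows "norm (grad_est P \<tau> \<theta>) \<le> C_g P R G b"
proof -
  have "norm (grad_est P \<tau> \<theta>) \<le> (\<Sum>t<horizon P. (R + b) / (1 - discount P) * G)"
    unfolding grad_est_def
  proof (rule sum_norm_le)
    fix t assume "t \<in> {..<horizon P}"
    then have t: "t < horizon P" by simp
    show "norm ((traj_return P \<tau> - baseline P t (fst (\<tau> t))) *\<^sub>R score P \<theta> (fst (\<tau> t)) (snd (\<tau> t)))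
        \<le> (R + b) / (1 - discount P) * G"
      using return_baseline_bound[OF \<tau> t] score_bound[OF traj_coord_space[OF \<tau> t]] discount R_pos bound_nonneg
      by (simp only: norm_scaleR, intro mult_mono) auto
  qed
  then show ?thesis by (simp add: C_g_def mult_ac)
qed

lemma grad_est_lipschitz:
  assumes \<tau>: "\<tau> \<in> space (traj_ref P)"
  shows "norm (grad_est P \<tau> \<theta> - grad_est P \<tau> \<theta>') \<le> L_g P R M b * norm (\<theta> - \<theta>')"
proof -
  have "norm (grad_est P \<tau> \<theta> - grad_est P \<tau> \<theta>') \<le> (\<Sum>t<horizon P. (R + b) / (1 - discount P) * (M * norm (\<theta> - \<theta>')))"
    unfolding grad_est_def sum_subtractf[symmetric] scaleR_diff_right[symmetric]
  proof (rule sum_norm_le)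
    fix t assume "t \<in> {..<horizon P}"
    then have t: "t < horizon P" by simp
    show "norm ((traj_return P \<tau> - baseline P t (fst (\<tau> t))) *\<^sub>R
          (score P \<theta> (fst (\<tau> t)) (snd (\<tau> t)) - score P \<theta>' (fst (\<tau> t)) (snd (\<tau> t))))
        \<le> (R + b) / (1 - discount P) * (M * norm (\<theta> - \<theta>'))"
      using return_baseline_bound[OF \<tau> t] score_lipschitz[OF traj_coord_space[OF \<tau> t]] discount R_pos bound_nonneg
      by (simp only: norm_scaleR, intro mult_mono) auto
  qed
  then show ?thesis by (simp add: L_g_def mult_ac)
qed

lemma integrable_traj_law:
  fixes f :: "_ \<Rightarrow> 'v::euclidean_space"
  assumes [measurable]: "f \<in> borel_measurable (traj_ref P)" and "\<And>\<tau>. \<tau> \<in> space (traj_ref P) \<Longrightarrow> norm (f \<tau>) \<le> K"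
  shows "integrable (traj_law P \<theta>) f"
proof -
  interpret T: prob_space "traj_law P \<theta>" by (rule prob_space_traj_law)
  show ?thesis by (rule T.integrable_const_bound[where B=K]) (use assms in auto)
qed

text \<open>J at a nearby parameter is rewritten under the trajectory law of the point of
  differentiation, which leaves the exponential weight as the only dependence on the new
  parameter.\<close>

lemma gderiv_J_expectation:
  "GDERIV (J P) \<theta> :> (\<integral>\<tau>. traj_return P \<tau> *\<^sub>R (\<Sum>t<horizon P. score P \<theta> (fst (\<tau> t)) (snd (\<tau> t))) \<partial>traj_law P \<theta>)"
proof -
  interpret T: prob_space "traj_law P \<theta>" by (rule prob_space_traj_law)
  have J: "J P = (\<lambda>\<theta>'. \<integral>\<tau>. traj_return P \<tau> * exp (traj_log_ratio \<theta> \<theta>' \<tau>) \<partial>traj_law P \<theta>)"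
    unfolding J_def by (rule ext, subst integral_traj_law_change[of _ _ \<theta>]) (auto simp: mult.commute)
  show ?thesis unfolding J
  proof (rule T.gderiv_integral_exp)
    show "\<bar>traj_return P \<tau>\<bar> \<le> R / (1 - discount P)" if "\<tau> \<in> space (traj_law P \<theta>)" for \<tau>
      using return_bound that by simp
    show "norm (\<Sum>t<horizon P. score P \<theta> (fst (\<tau> t)) (snd (\<tau> t))) \<le> (\<Sum>t<horizon P. G)"
      if "\<tau> \<in> space (traj_law P \<theta>)" for \<tau>
      using that traj_coord_space by (intro sum_norm_le score_bound) auto
    fix \<theta>' \<tau> assume \<tau>: "\<tau> \<in> space (traj_law P \<theta>)"
    have "\<bar>traj_log_ratio \<theta> \<theta>' \<tau> - (\<Sum>t<horizon P. score P \<theta> (fst (\<tau> t)) (snd (\<tau> t))) \<bullet> (\<theta>' - \<theta>)\<bar>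
      = \<bar>\<Sum>t<horizon P. log_ratio \<theta> \<theta>' (\<tau> t) - score P \<theta> (fst (\<tau> t)) (snd (\<tau> t)) \<bullet> (\<theta>' - \<theta>)\<bar>"
      by (simp add: traj_log_ratio_def inner_sum_left sum_subtractf)
    also have "\<dots> \<le> (\<Sum>t<horizon P. M * (norm (\<theta>' - \<theta>))\<^sup>2)"
      using \<tau> traj_coord_SA by (intro order_trans[OF sum_abs sum_mono] log_ratio_first_order) auto
    finally show "\<bar>traj_log_ratio \<theta> \<theta>' \<tau> - (\<Sum>t<horizon P. score P \<theta> (fst (\<tau> t)) (snd (\<tau> t))) \<bullet> (\<theta>' - \<theta>)\<bar>
       \<le> (real (horizon P) * M) * (norm (\<theta>' - \<theta>))\<^sup>2" by (simp add: mult.assoc)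
  next
    show "(\<lambda>\<tau>. \<Sum>t<horizon P. score P \<theta> (fst (\<tau> t)) (snd (\<tau> t))) \<in> borel_measurable (traj_law P \<theta>)"
      by (intro borel_measurable_sum) simp
  qed simp_all
qed

lemma gderiv_J: "GDERIV (J P) \<theta> :> grad (J P) \<theta>"
  unfolding grad_eqI[OF gderiv_J_expectation] by (rule gderiv_J_expectation)

text \<open>The baseline may be negative, so it is shifted by its bound \<open>b\<close>; the
  constant \<open>b\<close> is itself an admissible nonnegative function of the state.\<close>

lemma expectation_baseline_score:
  assumes t[measurable]: "t < horizon P"
  shows "(\<integral>\<tau>. baseline P t (fst (\<tau> t)) *\<^sub>R score P \<theta> (fst (\<tau> t)) (snd (\<tau> t)) \<partial>traj_law P \<theta>) = 0"
proof -
  note baseline_measurable[OF t, measurable]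
  let ?s = "\<lambda>\<tau>. score P \<theta> (fst (\<tau> t)) (snd (\<tau> t))"
  have bs: "\<bar>baseline P t (fst (\<tau> t))\<bar> \<le> b" if "\<tau> \<in> space (traj_ref P)" for \<tau>
    using baseline_bound[OF t] traj_coord_space that t by blast
  have i1: "integrable (traj_law P \<theta>) (\<lambda>\<tau>. (baseline P t (fst (\<tau> t)) + b) *\<^sub>R ?s \<tau>)"
  proof (rule integrable_traj_law[where K="(2 * b) * G"])
    fix \<tau> assume \<tau>: "\<tau> \<in> space (traj_ref P)"
    show "norm ((baseline P t (fst (\<tau> t)) + b) *\<^sub>R ?s \<tau>) \<le> (2 * b) * G"
      using bs[OF \<tau>] score_bound[OF traj_coord_space[OF \<tau> t]] bound_nonneg
      by (simp only: norm_scaleR, intro mult_mono) auto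
  qed simp
  have i2: "integrable (traj_law P \<theta>) (\<lambda>\<tau>. b *\<^sub>R ?s \<tau>)"
  proof (rule integrable_traj_law[where K="b * G"])
    fix \<tau> assume \<tau>: "\<tau> \<in> space (traj_ref P)"
    show "norm (b *\<^sub>R ?s \<tau>) \<le> b * G"
      using score_bound[OF traj_coord_space[OF \<tau> t]] bound_nonneg
      by (simp only: norm_scaleR, intro mult_mono) auto
  qed simp
  have "(\<integral>\<tau>. baseline P t (fst (\<tau> t)) *\<^sub>R ?s \<tau> \<partial>traj_law P \<theta>)
    = (\<integral>\<tau>. (baseline P t (fst (\<tau> t)) + b) *\<^sub>R ?s \<tau> - b *\<^sub>R ?s \<tau> \<partial>traj_law P \<theta>)"
    by (simp add: scaleR_add_left)
  also have "\<dots> = (\<integral>\<tau>. (baseline P t (fst (\<tau> t)) + b) *\<^sub>R ?s \<tau> \<partial>traj_law P \<theta>)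
      - (\<integral>\<tau>. b *\<^sub>R ?s \<tau> \<partial>traj_law P \<theta>)"
    by (rule Bochner_Integration.integral_diff[OF i1 i2])
  also have "(\<integral>\<tau>. (baseline P t (fst (\<tau> t)) + b) *\<^sub>R ?s \<tau> \<partial>traj_law P \<theta>) = 0"
  proof (rule expectation_state_score[where K="2 * b", OF _ _ t])
    show "0 \<le> baseline P t s + b \<and> baseline P t s + b \<le> 2 * b" if "s \<in> space (state_ref P)" for s
      using baseline_bound[OF t that] by linarith
  qed simp
  also have "(\<integral>\<tau>. b *\<^sub>R ?s \<tau> \<partial>traj_law P \<theta>) = 0"
    by (rule expectation_state_score[where u="\<lambda>_. b" and K=b, OF _ _ t]) (auto simp: bound_nonneg)
  finally show ?thesis by simp
qed

lemma expectation_grad_est: "(\<integral>\<tau>. grad_est P \<tau> \<theta> \<partial>traj_law P \<theta>) = grad (J P) \<theta>"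
proof -
  let ?s = "\<lambda>t \<tau>. score P \<theta> (fst (\<tau> t)) (snd (\<tau> t))"
  have i1: "integrable (traj_law P \<theta>) (\<lambda>\<tau>. traj_return P \<tau> *\<^sub>R (\<Sum>t<horizon P. ?s t \<tau>))"
  proof (rule integrable_traj_law[where K="R / (1 - discount P) * (\<Sum>t<horizon P. G)"])
    show "(\<lambda>\<tau>. traj_return P \<tau> *\<^sub>R (\<Sum>t<horizon P. ?s t \<tau>)) \<in> borel_measurable (traj_ref P)"
      by (intro borel_measurable_scaleR borel_measurable_sum) auto
    fix \<tau> assume \<tau>: "\<tau> \<in> space (traj_ref P)"
    have "norm (\<Sum>t<horizon P. ?s t \<tau>) \<le> (\<Sum>t<horizon P. G)"
      using \<tau> traj_coord_space by (intro sum_norm_le score_bound) auto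
    then show "norm (traj_return P \<tau> *\<^sub>R (\<Sum>t<horizon P. ?s t \<tau>)) \<le> R / (1 - discount P) * (\<Sum>t<horizon P. G)"
      using return_bound[OF \<tau>] R_pos discount by (simp only: norm_scaleR, intro mult_mono) auto
  qed
  have i2: "integrable (traj_law P \<theta>) (\<lambda>\<tau>. baseline P t (fst (\<tau> t)) *\<^sub>R ?s t \<tau>)" if t[measurable]: "t < horizon P" for t
  proof (rule integrable_traj_law[where K="b * G"])
    note baseline_measurable[OF t, measurable]
    show "(\<lambda>\<tau>. baseline P t (fst (\<tau> t)) *\<^sub>R ?s t \<tau>) \<in> borel_measurable (traj_ref P)" by measurable
    fix \<tau> assume \<tau>: "\<tau> \<in> space (traj_ref P)"
    show "norm (baseline P t (fst (\<tau> t)) *\<^sub>R ?s t \<tau>) \<le> b * G"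
      using baseline_bound[OF t traj_coord_space(1)[OF \<tau> t]] score_bound[OF traj_coord_space[OF \<tau> t]] bound_nonneg
      by (simp only: norm_scaleR, intro mult_mono) auto
  qed
  have i3: "integrable (traj_law P \<theta>) (\<lambda>\<tau>. \<Sum>t<horizon P. baseline P t (fst (\<tau> t)) *\<^sub>R ?s t \<tau>)"
    by (rule Bochner_Integration.integrable_sum) (simp add: i2)
  have "grad_est P \<tau> \<theta> = traj_return P \<tau> *\<^sub>R (\<Sum>t<horizon P. ?s t \<tau>)
      - (\<Sum>t<horizon P. baseline P t (fst (\<tau> t)) *\<^sub>R ?s t \<tau>)" for \<tau>
    by (simp add: grad_est_def scaleR_diff_left sum_subtractf scaleR_sum_right)
  then have "(\<integral>\<tau>. grad_est P \<tau> \<theta> \<partial>traj_law P \<theta>)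
    = (\<integral>\<tau>. traj_return P \<tau> *\<^sub>R (\<Sum>t<horizon P. ?s t \<tau>) \<partial>traj_law P \<theta>)
      - (\<Sum>t<horizon P. \<integral>\<tau>. baseline P t (fst (\<tau> t)) *\<^sub>R ?s t \<tau> \<partial>traj_law P \<theta>)"
    using i1 i3 i2 by (subst Bochner_Integration.integral_sum[symmetric])
      (auto simp: Bochner_Integration.integral_diff)
  also have "\<dots> = grad (J P) \<theta>"
    using grad_eqI[OF gderiv_J_expectation] by (simp add: expectation_baseline_score)
  finally show ?thesis .
qed

end

section \<open>Importance weights and the variance of the estimators\<close>

lemma scaleR_mean_diff:
  fixes c :: "'v::real_vector"
  assumes "0 < n"
  shows "(a / real n) *\<^sub>R (\<Sum>i<n. x i - c) = (a / real n) *\<^sub>R (\<Sum>i<n. x i) - a *\<^sub>R c"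
proof -
  have "(\<Sum>i<n. x i - c) = (\<Sum>i<n. x i) - real n *\<^sub>R c"
    by (simp only: sum_subtractf sum_constant_scaleR card_lessThan)
  then show ?thesis using assms by (simp only: scaleR_diff_right scaleR_scaleR) simp
qed

context rl_setting
begin

lemma measure_traj_law_space [simp]: "measure (traj_law P \<theta>) (space (traj_ref P)) = 1"
  using prob_space.prob_space[OF prob_space_traj_law] by simp

text \<open>The identity can fail where the density in the denominator vanishes, since the quotient
  is then 0 by convention; that set is null for the law in question.\<close>

lemma imp_weight_eq_exp:
  "AE \<tau> in traj_law P \<theta>. imp_weight P \<tau> \<theta> \<theta>' = exp (traj_log_ratio \<theta> \<theta>' \<tau>)"
proof -
  have "AE \<tau> in traj_ref P. 0 < ennreal (traj_density P \<theta> \<tau>) \<longrightarrow>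
      imp_weight P \<tau> \<theta> \<theta>' = exp (traj_log_ratio \<theta> \<theta>' \<tau>)"
    by (rule AE_I2) (simp add: imp_weight_def traj_density_exp[of _ \<theta>' \<theta>])
  then show ?thesis unfolding traj_law_def by (subst AE_density) auto
qed

lemma expectation_exp_traj_log_ratio:
  "(\<integral>\<tau>. exp (traj_log_ratio \<theta> \<theta>' \<tau>) \<partial>traj_law P \<theta>) = 1"
proof -
  interpret T': prob_space "traj_law P \<theta>'" by (rule prob_space_traj_law)
  show ?thesis
    using integral_traj_law_change[of "\<lambda>_. 1::real" \<theta>' \<theta>] T'.prob_space by simp
qed

lemma imp_weight_var_eq:
  "imp_weight_var P \<theta> \<theta>' = (\<integral>\<tau>. (exp (traj_log_ratio \<theta> \<theta>' \<tau>) - 1)\<^sup>2 \<partial>traj_law P \<theta>)"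
proof -
  have "(\<integral>\<tau>. imp_weight P \<tau> \<theta> \<theta>' \<partial>traj_law P \<theta>) = (\<integral>\<tau>. exp (traj_log_ratio \<theta> \<theta>' \<tau>) \<partial>traj_law P \<theta>)"
    by (rule integral_cong_AE) (use imp_weight_eq_exp in auto)
  then have 1: "(\<integral>\<tau>. imp_weight P \<tau> \<theta> \<theta>' \<partial>traj_law P \<theta>) = 1"
    by (simp only: expectation_exp_traj_log_ratio)
  show ?thesis unfolding imp_weight_var_def 1
  proof (rule integral_cong_AE)
    show "AE \<tau> in traj_law P \<theta>. (imp_weight P \<tau> \<theta> \<theta>' - 1)\<^sup>2 = (exp (traj_log_ratio \<theta> \<theta>' \<tau>) - 1)\<^sup>2"
      using imp_weight_eq_exp[of \<theta> \<theta>'] by eventually_elim simp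
  qed simp_all
qed

lemma integrable_exp_traj_log_ratio:
  "integrable (traj_law P \<theta>) (\<lambda>\<tau>. exp (traj_log_ratio \<theta> \<theta>' \<tau>))"
  by (rule integrable_traj_law[where K="exp (real (horizon P) * G * norm (\<theta>' - \<theta>))"])
    (auto intro: abs_le_D1[OF traj_log_ratio_bound])

lemma integrable_exp_traj_log_ratio_diff_square:
  "integrable (traj_law P \<theta>) (\<lambda>\<tau>. (exp (traj_log_ratio \<theta> \<theta>' \<tau>) - 1)\<^sup>2)"
proof (rule Bochner_Integration.integrable_bound)
  let ?a = "real (horizon P) * G * norm (\<theta>' - \<theta>)"
  show "integrable (traj_law P \<theta>) (\<lambda>\<tau>. (exp ?a + exp (- ?a) - 2) * exp (traj_log_ratio \<theta> \<theta>' \<tau>))"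
    using integrable_exp_traj_log_ratio by simp
  show "AE \<tau> in traj_law P \<theta>. norm ((exp (traj_log_ratio \<theta> \<theta>' \<tau>) - 1)\<^sup>2)
      \<le> norm ((exp ?a + exp (- ?a) - 2) * exp (traj_log_ratio \<theta> \<theta>' \<tau>))"
    by (rule AE_I2)
      (use square_exp_diff_bound[OF traj_log_ratio_bound] in \<open>auto intro: order_trans[OF _ abs_ge_self]\<close>)
qed simp

text \<open>The weights lie in \<open>[exp (-a), exp a]\<close> and have mean 1, so the Bhatia-Davis inequality
  bounds their variance by \<open>exp a + exp (-a) - 2\<close>, which is quadratic in \<open>a\<close> for \<open>a \<le> 1\<close>; for
  larger \<open>a\<close> the bound by \<open>W\<close> suffices.\<close>

lemma imp_weight_var_quadratic:
  assumes W: "imp_weight_var P \<theta> \<theta>' \<le> W"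
  shows "imp_weight_var P \<theta> \<theta>' \<le> C_\<omega> P G M W * (norm (\<theta> - \<theta>'))\<^sup>2"
proof -
  define a where "a = real (horizon P) * G * norm (\<theta>' - \<theta>)"
  have a: "0 \<le> a" using G_pos by (simp add: a_def)
  let ?V = "imp_weight_var P \<theta> \<theta>'"
  have V0: "0 \<le> ?V" unfolding imp_weight_var_eq by (rule integral_nonneg_AE) simp
  have "?V \<le> (\<integral>\<tau>. (exp a + exp (- a) - 2) * exp (traj_log_ratio \<theta> \<theta>' \<tau>) \<partial>traj_law P \<theta>)"
    unfolding imp_weight_var_eq
    by (rule integral_mono[OF integrable_exp_traj_log_ratio_diff_square])
      (use square_exp_diff_bound[OF traj_log_ratio_bound] integrable_exp_traj_log_ratio in \<open>auto simp: a_def\<close>)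
  then have V: "?V \<le> exp a + exp (- a) - 2"
    by (simp add: expectation_exp_traj_log_ratio)
  \<comment> \<open>Carrying the factor V + 1 gives both ranges of \<open>a\<close> the same bound:
    near 0 it is at least 1, and for a > 1 the factor a^2 is. Only afterwards is V replaced by
    W.\<close>
  have "?V \<le> 2 * a\<^sup>2 * (?V + 1)"
  proof (cases "a \<le> 1")
    case True
    have "2 * a\<^sup>2 * 1 \<le> 2 * a\<^sup>2 * (?V + 1)" using V0 by (intro mult_left_mono) auto
    then show ?thesis using V exp_plus_exp_minus_bound[OF a True] by simp
  next
    case False
    then have "1 \<le> a\<^sup>2" by simp
    then have "1 * (?V + 1) \<le> 2 * a\<^sup>2 * (?V + 1)" using V0 by (intro mult_right_mono) auto
    then show ?thesis by simp
  qed
  also have "\<dots> \<le> 2 * a\<^sup>2 * (W + 1)" using W by (intro mult_left_mono) auto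
  also have "\<dots> = real (horizon P) * (2 * real (horizon P) * G\<^sup>2) * (W + 1) * (norm (\<theta> - \<theta>'))\<^sup>2"
    by (simp add: a_def power_mult_distrib norm_minus_commute power2_eq_square)
  also have "\<dots> \<le> C_\<omega> P G M W * (norm (\<theta> - \<theta>'))\<^sup>2"
    unfolding C_\<omega>_def using M_pos W V0
    by (intro mult_right_mono mult_left_mono) auto
  finally show ?thesis .
qed

text \<open>One summand of the recursive part of the estimator. The weight compensates for drawing
  from the law of the new parameter, so its mean is the difference of the exact gradients.\<close>

definition correction :: "real^'q \<Rightarrow> real^'q \<Rightarrow> (nat \<Rightarrow> 's \<times> 'a) \<Rightarrow> real^'q" where
  "correction \<theta> \<theta>' \<tau> = grad_est P \<tau> \<theta> - imp_weight P \<tau> \<theta> \<theta>' *\<^sub>R grad_est P \<tau> \<theta>'"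

lemma correction_measurable [measurable]: "correction \<theta> \<theta>' \<in> borel_measurable (traj_ref P)"
  unfolding correction_def[abs_def] by measurable

lemma correction_eq_exp:
  "AE \<tau> in traj_law P \<theta>. correction \<theta> \<theta>' \<tau> =
     grad_est P \<tau> \<theta> - exp (traj_log_ratio \<theta> \<theta>' \<tau>) *\<^sub>R grad_est P \<tau> \<theta>'"
  using imp_weight_eq_exp[of \<theta> \<theta>'] by eventually_elim (simp add: correction_def)

text \<open>The bound depends on the two parameters and serves integrability only; the quantitative
  estimate is the second moment.\<close>

lemma correction_bounded:
  obtains K where "AE \<tau> in traj_law P \<theta>. norm (correction \<theta> \<theta>' \<tau>) \<le> K"
proof
  have C: "0 \<le> C_g P R G b"
    unfolding C_g_def using G_pos R_pos bound_nonneg discount by auto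
  have "AE \<tau> in traj_law P \<theta>. norm (grad_est P \<tau> \<theta> - exp (traj_log_ratio \<theta> \<theta>' \<tau>) *\<^sub>R grad_est P \<tau> \<theta>')
     \<le> C_g P R G b + exp (real (horizon P) * G * norm (\<theta>' - \<theta>)) * C_g P R G b"
  proof (rule AE_I2)
    fix \<tau> assume "\<tau> \<in> space (traj_law P \<theta>)"
    then have \<tau>: "\<tau> \<in> space (traj_ref P)" by simp
    have "exp (traj_log_ratio \<theta> \<theta>' \<tau>) \<le> exp (real (horizon P) * G * norm (\<theta>' - \<theta>))"
      using abs_le_D1[OF traj_log_ratio_bound[OF \<tau>]] by simp
    then have "norm (exp (traj_log_ratio \<theta> \<theta>' \<tau>) *\<^sub>R grad_est P \<tau> \<theta>')
        \<le> exp (real (horizon P) * G * norm (\<theta>' - \<theta>)) * C_g P R G b"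
      using grad_est_bound[OF \<tau>] by (simp only: norm_scaleR abs_exp_cancel) (intro mult_mono, auto)
    with grad_est_bound[OF \<tau>, of \<theta>] norm_triangle_ineq4[of "grad_est P \<tau> \<theta>" "exp (traj_log_ratio \<theta> \<theta>' \<tau>) *\<^sub>R grad_est P \<tau> \<theta>'"]
    show "norm (grad_est P \<tau> \<theta> - exp (traj_log_ratio \<theta> \<theta>' \<tau>) *\<^sub>R grad_est P \<tau> \<theta>')
     \<le> C_g P R G b + exp (real (horizon P) * G * norm (\<theta>' - \<theta>)) * C_g P R G b"
      by linarith
  qed
  with correction_eq_exp[of \<theta> \<theta>']
  show "AE \<tau> in traj_law P \<theta>. norm (correction \<theta> \<theta>' \<tau>)
     \<le> C_g P R G b + exp (real (horizon P) * G * norm (\<theta>' - \<theta>)) * C_g P R G b"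
    by eventually_elim simp
qed

lemma integrable_correction: "integrable (traj_law P \<theta>) (correction \<theta> \<theta>')"
proof -
  interpret T: prob_space "traj_law P \<theta>" by (rule prob_space_traj_law)
  obtain K where "AE \<tau> in traj_law P \<theta>. norm (correction \<theta> \<theta>' \<tau>) \<le> K" by (rule correction_bounded)
  then show ?thesis by (rule T.integrable_const_bound) simp
qed

lemma integrable_correction_square: "integrable (traj_law P \<theta>) (\<lambda>\<tau>. (norm (correction \<theta> \<theta>' \<tau> - c))\<^sup>2)"
proof -
  interpret T: prob_space "traj_law P \<theta>" by (rule prob_space_traj_law)
  obtain K where "AE \<tau> in traj_law P \<theta>. norm (correction \<theta> \<theta>' \<tau>) \<le> K" by (rule correction_bounded)
  then have "AE \<tau> in traj_law P \<theta>. norm ((norm (correction \<theta> \<theta>' \<tau> - c))\<^sup>2) \<le> (K + norm c)\<^sup>2"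
  proof eventually_elim
    case (elim \<tau>)
    then have "norm (correction \<theta> \<theta>' \<tau> - c) \<le> K + norm c"
      using norm_triangle_ineq4[of "correction \<theta> \<theta>' \<tau>" c] by linarith
    from power_mono[OF this, of 2] show ?case by simp
  qed
  then show ?thesis by (rule T.integrable_const_bound) simp
qed

lemma expectation_correction:
  "(\<integral>\<tau>. correction \<theta> \<theta>' \<tau> \<partial>traj_law P \<theta>) = grad (J P) \<theta> - grad (J P) \<theta>'"
proof -
  have 1: "integrable (traj_law P \<theta>) (\<lambda>\<tau>. grad_est P \<tau> \<theta>)"
    by (rule integrable_traj_law[OF _ grad_est_bound]) simp
  have "integrable (traj_law P \<theta>) (\<lambda>\<tau>. grad_est P \<tau> \<theta> - correction \<theta> \<theta>' \<tau>)"
    by (rule Bochner_Integration.integrable_diff[OF 1 integrable_correction])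
  then have 2: "integrable (traj_law P \<theta>) (\<lambda>\<tau>. imp_weight P \<tau> \<theta> \<theta>' *\<^sub>R grad_est P \<tau> \<theta>')"
    by (simp add: correction_def)
  have "(\<integral>\<tau>. imp_weight P \<tau> \<theta> \<theta>' *\<^sub>R grad_est P \<tau> \<theta>' \<partial>traj_law P \<theta>)
    = (\<integral>\<tau>. exp (traj_log_ratio \<theta> \<theta>' \<tau>) *\<^sub>R grad_est P \<tau> \<theta>' \<partial>traj_law P \<theta>)"
    by (rule integral_cong_AE) (use imp_weight_eq_exp[of \<theta> \<theta>'] in auto)
  also have "\<dots> = grad (J P) \<theta>'"
    by (simp add: expectation_grad_est flip: integral_traj_law_change)
  finally show ?thesis
    unfolding correction_def by (simp add: Bochner_Integration.integral_diff[OF 1 2] expectation_grad_est)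
qed

text \<open>Centring only lowers the second moment. The correction splits into a difference of
  estimators, controlled by \<open>L_g\<close>, and (weight - 1) times an estimator, controlled by
  \<open>C_g\<close> and the variance of the weight; squaring the sum of the two costs the factor 2
  in front of \<open>C_bar\<close>.\<close>

lemma correction_second_moment:
  assumes W: "imp_weight_var P \<theta> \<theta>' \<le> W"
  shows "(\<integral>\<tau>. (norm (correction \<theta> \<theta>' \<tau> - (grad (J P) \<theta> - grad (J P) \<theta>')))\<^sup>2 \<partial>traj_law P \<theta>)
    \<le> 2 * C_bar P R G M b W * (norm (\<theta> - \<theta>'))\<^sup>2"
proof -
  interpret T: prob_space "traj_law P \<theta>" by (rule prob_space_traj_law)
  define c where "c = grad (J P) \<theta> - grad (J P) \<theta>'"
  let ?Y = "correction \<theta> \<theta>'" and ?u = "norm (\<theta> - \<theta>')" and ?C = "C_g P R G b" and ?L = "L_g P R M b"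
  let ?E = "\<lambda>\<tau>. exp (traj_log_ratio \<theta> \<theta>' \<tau>)"
  have sq: "(norm (?Y \<tau> - c))\<^sup>2 = (norm (?Y \<tau>))\<^sup>2 - 2 * (c \<bullet> ?Y \<tau>) + (norm c)\<^sup>2" for \<tau>
    by (simp add: power2_norm_eq_inner inner_diff_left inner_diff_right inner_commute)
  have int: "integrable (traj_law P \<theta>) (\<lambda>\<tau>. (norm (?Y \<tau>))\<^sup>2)" "integrable (traj_law P \<theta>) (\<lambda>\<tau>. c \<bullet> ?Y \<tau>)"
    using integrable_correction_square[of \<theta> \<theta>' 0] integrable_correction[of \<theta> \<theta>'] by auto
  have "(\<integral>\<tau>. c \<bullet> ?Y \<tau> \<partial>traj_law P \<theta>) = c \<bullet> c"
    using integrable_correction by (simp add: expectation_correction c_def)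
  then have "(\<integral>\<tau>. (norm (?Y \<tau> - c))\<^sup>2 \<partial>traj_law P \<theta>) = (\<integral>\<tau>. (norm (?Y \<tau>))\<^sup>2 \<partial>traj_law P \<theta>) - (norm c)\<^sup>2"
    unfolding sq using int by (simp add: T.prob_space power2_norm_eq_inner)
  also have "\<dots> \<le> (\<integral>\<tau>. (norm (?Y \<tau>))\<^sup>2 \<partial>traj_law P \<theta>)" by simp
  also have "\<dots> \<le> (\<integral>\<tau>. 2 * ?L\<^sup>2 * ?u\<^sup>2 + 2 * ?C\<^sup>2 * (?E \<tau> - 1)\<^sup>2 \<partial>traj_law P \<theta>)"
  proof (rule integral_mono_AE[OF int(1)])
    show "integrable (traj_law P \<theta>) (\<lambda>\<tau>. 2 * ?L\<^sup>2 * ?u\<^sup>2 + 2 * ?C\<^sup>2 * (?E \<tau> - 1)\<^sup>2)"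
      using integrable_exp_traj_log_ratio_diff_square by simp
    have "AE \<tau> in traj_law P \<theta>. (norm (grad_est P \<tau> \<theta> - ?E \<tau> *\<^sub>R grad_est P \<tau> \<theta>'))\<^sup>2
        \<le> 2 * ?L\<^sup>2 * ?u\<^sup>2 + 2 * ?C\<^sup>2 * (?E \<tau> - 1)\<^sup>2"
    proof (rule AE_I2)
      fix \<tau> assume "\<tau> \<in> space (traj_law P \<theta>)"
      then have \<tau>: "\<tau> \<in> space (traj_ref P)" by simp
      have "grad_est P \<tau> \<theta> - ?E \<tau> *\<^sub>R grad_est P \<tau> \<theta>'
          = (grad_est P \<tau> \<theta> - grad_est P \<tau> \<theta>') - (?E \<tau> - 1) *\<^sub>R grad_est P \<tau> \<theta>'"
        by (simp add: algebra_simps)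
      then have "norm (grad_est P \<tau> \<theta> - ?E \<tau> *\<^sub>R grad_est P \<tau> \<theta>')
          \<le> norm (grad_est P \<tau> \<theta> - grad_est P \<tau> \<theta>') + \<bar>?E \<tau> - 1\<bar> * norm (grad_est P \<tau> \<theta>')"
        by (simp only: norm_triangle_ineq4 flip: norm_scaleR)
      also have "\<dots> \<le> ?L * ?u + \<bar>?E \<tau> - 1\<bar> * ?C"
        by (intro add_mono mult_left_mono grad_est_lipschitz grad_est_bound \<tau>) simp
      finally have "(norm (grad_est P \<tau> \<theta> - ?E \<tau> *\<^sub>R grad_est P \<tau> \<theta>'))\<^sup>2 \<le> (?L * ?u + \<bar>?E \<tau> - 1\<bar> * ?C)\<^sup>2"
        by (intro power_mono) auto
      also have "\<dots> \<le> 2 * (?L * ?u)\<^sup>2 + 2 * (\<bar>?E \<tau> - 1\<bar> * ?C)\<^sup>2"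
        using sum_squares_bound[of "?L * ?u" "\<bar>?E \<tau> - 1\<bar> * ?C"] by (simp add: power2_sum)
      finally show "(norm (grad_est P \<tau> \<theta> - ?E \<tau> *\<^sub>R grad_est P \<tau> \<theta>'))\<^sup>2
          \<le> 2 * ?L\<^sup>2 * ?u\<^sup>2 + 2 * ?C\<^sup>2 * (?E \<tau> - 1)\<^sup>2"
        by (simp add: power_mult_distrib mult_ac)
    qed
    with correction_eq_exp[of \<theta> \<theta>']
    show "AE \<tau> in traj_law P \<theta>. (norm (?Y \<tau>))\<^sup>2 \<le> 2 * ?L\<^sup>2 * ?u\<^sup>2 + 2 * ?C\<^sup>2 * (?E \<tau> - 1)\<^sup>2"
      by eventually_elim simp
  qed
  also have "\<dots> = 2 * ?L\<^sup>2 * ?u\<^sup>2 + 2 * ?C\<^sup>2 * imp_weight_var P \<theta> \<theta>'"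
    using integrable_exp_traj_log_ratio_diff_square by (simp add: imp_weight_var_eq T.prob_space)
  also have "\<dots> \<le> 2 * ?L\<^sup>2 * ?u\<^sup>2 + 2 * ?C\<^sup>2 * (C_\<omega> P G M W * ?u\<^sup>2)"
    by (intro add_left_mono mult_left_mono imp_weight_var_quadratic[OF W]) auto
  also have "\<dots> = 2 * C_bar P R G M b W * ?u\<^sup>2" by (simp add: C_bar_def algebra_simps)
  finally show ?thesis unfolding c_def .
qed

lemma grad_est_noise:
  assumes \<sigma>: "\<And>\<tau>. \<tau> \<in> space (traj_ref P) \<Longrightarrow> (norm (grad_est P \<tau> \<theta> - grad (J P) \<theta>))\<^sup>2 \<le> \<sigma>\<^sup>2"
  shows "integrable (traj_law P \<theta>) (\<lambda>\<tau>. grad_est P \<tau> \<theta> - grad (J P) \<theta>)"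
    "integrable (traj_law P \<theta>) (\<lambda>\<tau>. (norm (grad_est P \<tau> \<theta> - grad (J P) \<theta>))\<^sup>2)"
    "(\<integral>\<tau>. grad_est P \<tau> \<theta> - grad (J P) \<theta> \<partial>traj_law P \<theta>) = 0"
    "(\<integral>\<tau>. (norm (grad_est P \<tau> \<theta> - grad (J P) \<theta>))\<^sup>2 \<partial>traj_law P \<theta>) \<le> \<sigma>\<^sup>2"
proof -
  interpret T: prob_space "traj_law P \<theta>" by (rule prob_space_traj_law)
  have 1: "integrable (traj_law P \<theta>) (\<lambda>\<tau>. grad_est P \<tau> \<theta>)"
    by (rule integrable_traj_law[OF _ grad_est_bound]) simp
  then show "integrable (traj_law P \<theta>) (\<lambda>\<tau>. grad_est P \<tau> \<theta> - grad (J P) \<theta>)" by simp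
  show 2: "integrable (traj_law P \<theta>) (\<lambda>\<tau>. (norm (grad_est P \<tau> \<theta> - grad (J P) \<theta>))\<^sup>2)"
    by (rule integrable_traj_law[where K="\<sigma>\<^sup>2"]) (use \<sigma> in auto)
  show "(\<integral>\<tau>. grad_est P \<tau> \<theta> - grad (J P) \<theta> \<partial>traj_law P \<theta>) = 0"
    using 1 by (simp add: expectation_grad_est T.prob_space)
  show "(\<integral>\<tau>. (norm (grad_est P \<tau> \<theta> - grad (J P) \<theta>))\<^sup>2 \<partial>traj_law P \<theta>) \<le> \<sigma>\<^sup>2"
    by (rule T.integral_le_const[OF 2]) (use \<sigma> in auto)
qed

lemma init_est_error:
  assumes \<sigma>: "\<And>\<tau>. \<tau> \<in> space (traj_ref P) \<Longrightarrow> (norm (grad_est P \<tau> \<theta> - grad (J P) \<theta>))\<^sup>2 \<le> \<sigma>\<^sup>2"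
    and N: "0 < N"
  shows "(\<integral>\<^sup>+X. ennreal ((norm (init_est P N \<theta> X - grad (J P) \<theta>))\<^sup>2) \<partial>batch_law P N \<theta>) \<le> ennreal (\<sigma>\<^sup>2 / real N)"
proof -
  interpret T: prob_space "traj_law P \<theta>" by (rule prob_space_traj_law)
  have "init_est P N \<theta> X - grad (J P) \<theta> = 0 + (1 / real N) *\<^sub>R (\<Sum>i<N. grad_est P (X i) \<theta> - grad (J P) \<theta>)" for X
    unfolding scaleR_mean_diff[OF N] init_est_def by simp
  then show ?thesis unfolding batch_law_def
    using T.nn_integral_batch_square[OF grad_est_noise[OF \<sigma>], where c=0 and a="1 / real N" and n=N] N
    by (simp add: power2_eq_square field_simps)
qed

lemma hybrid_est_error:
  assumes \<sigma>: "\<And>\<tau>. \<tau> \<in> space (traj_ref P) \<Longrightarrow> (norm (grad_est P \<tau> \<theta> - grad (J P) \<theta>))\<^sup>2 \<le> \<sigma>\<^sup>2"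
    and B: "0 < B" and W: "imp_weight_var P \<theta> \<theta>' \<le> W"
  shows "(\<integral>\<^sup>+(X, Y). ennreal ((norm (hybrid_est P B B \<beta> v \<theta>' \<theta> X Y - grad (J P) \<theta>))\<^sup>2)
        \<partial>(batch_law P B \<theta> \<Otimes>\<^sub>M batch_law P B \<theta>))
    \<le> ennreal (\<beta>\<^sup>2 * (norm (v - grad (J P) \<theta>'))\<^sup>2
        + \<beta>\<^sup>2 * (2 * C_bar P R G M b W * (norm (\<theta> - \<theta>'))\<^sup>2) / real B + (1 - \<beta>)\<^sup>2 * \<sigma>\<^sup>2 / real B)"
proof -
  interpret T: prob_space "traj_law P \<theta>" by (rule prob_space_traj_law)
  define c where "c = grad (J P) \<theta> - grad (J P) \<theta>'"
  \<comment> \<open>The error separates into the damped old error and two centred batch sums. The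
    exact gradients cancel because \<open>\<beta>\<close> times the mean \<open>c\<close> of the
    correction moves the reference point from the old to the new gradient.\<close>
  have eq: "hybrid_est P B B \<beta> v \<theta>' \<theta> X Y - grad (J P) \<theta> = \<beta> *\<^sub>R (v - grad (J P) \<theta>')
     + (\<beta> / real B) *\<^sub>R (\<Sum>i<B. correction \<theta> \<theta>' (X i) - c)
     + ((1 - \<beta>) / real B) *\<^sub>R (\<Sum>i<B. grad_est P (Y i) \<theta> - grad (J P) \<theta>)" for X Y
    unfolding scaleR_mean_diff[OF B] hybrid_est_def correction_def[symmetric]
    by (simp add: c_def scaleR_diff_left scaleR_diff_right)
  have corr: "integrable (traj_law P \<theta>) (\<lambda>\<tau>. correction \<theta> \<theta>' \<tau> - c)"
    "(\<integral>\<tau>. correction \<theta> \<theta>' \<tau> - c \<partial>traj_law P \<theta>) = 0"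
    using integrable_correction[of \<theta> \<theta>'] by (simp_all add: expectation_correction c_def)
  have "(\<integral>\<^sup>+(X, Y). ennreal ((norm (hybrid_est P B B \<beta> v \<theta>' \<theta> X Y - grad (J P) \<theta>))\<^sup>2)
        \<partial>(batch_law P B \<theta> \<Otimes>\<^sub>M batch_law P B \<theta>))
    \<le> ennreal ((norm (\<beta> *\<^sub>R (v - grad (J P) \<theta>')))\<^sup>2
        + real B * ((\<beta> / real B)\<^sup>2 * (2 * C_bar P R G M b W * (norm (\<theta> - \<theta>'))\<^sup>2))
        + real B * (((1 - \<beta>) / real B)\<^sup>2 * \<sigma>\<^sup>2))"
    unfolding batch_law_def eq
    by (rule T.nn_integral_two_batches_square[OF corr(1) integrable_correction_square corr(2)
          correction_second_moment[OF W, folded c_def] grad_est_noise[OF \<sigma>]])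
  also have "(norm (\<beta> *\<^sub>R (v - grad (J P) \<theta>')))\<^sup>2
        + real B * ((\<beta> / real B)\<^sup>2 * (2 * C_bar P R G M b W * (norm (\<theta> - \<theta>'))\<^sup>2))
        + real B * (((1 - \<beta>) / real B)\<^sup>2 * \<sigma>\<^sup>2)
     = \<beta>\<^sup>2 * (norm (v - grad (J P) \<theta>'))\<^sup>2
        + \<beta>\<^sup>2 * (2 * C_bar P R G M b W * (norm (\<theta> - \<theta>'))\<^sup>2) / real B + (1 - \<beta>)\<^sup>2 * \<sigma>\<^sup>2 / real B"
    using B by (simp add: power_mult_distrib power2_eq_square)
  finally show ?thesis .
qed

end

section \<open>Measurability of the algorithm\<close>

text \<open>Measurability is tested on rectangles, a generator stable under intersections, where the
  product measure is a finite product of measurable functions.\<close>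

lemma measurable_PiM_subprob_algebra:
  assumes K: "K \<in> N \<rightarrow>\<^sub>M subprob_algebra L" and prob: "\<And>x. x \<in> space N \<Longrightarrow> prob_space (K x)"
    and I: "finite I"
  shows "(\<lambda>x. PiM I (\<lambda>_. K x)) \<in> N \<rightarrow>\<^sub>M subprob_algebra (PiM I (\<lambda>_. L))"
proof (rule measurable_subprob_algebra_generated[OF sets_PiM Int_stable_prod_algebra prod_algebra_sets_into_space])
  have sets: "sets (K x) = sets L" if "x \<in> space N" for x
    by (rule subprob_measurableD(2)[OF K that])
  fix x assume x: "x \<in> space N"
  show "subprob_space (PiM I (\<lambda>_. K x))"
    by (intro prob_space_imp_subprob_space prob_space_PiM prob x)
  show "sets (PiM I (\<lambda>_. K x)) = sets (PiM I (\<lambda>_. L))"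
    by (intro sets_PiM_cong refl sets x)
next
  have sets: "sets (K x) = sets L" "space (K x) = space L" if "x \<in> space N" for x
    using subprob_measurableD[OF K that] by auto
  have em: "emeasure (PiM I (\<lambda>_. K x)) (Pi\<^sub>E I E) = (\<Prod>i\<in>I. emeasure (K x) (E i))"
    if "x \<in> space N" "\<And>i. i \<in> I \<Longrightarrow> E i \<in> sets L" for x E
  proof -
    interpret prob_space "K x" by (rule prob[OF that(1)])
    interpret product_sigma_finite "\<lambda>_. K x" by unfold_locales
    show ?thesis using that(2) sets[OF that(1)] by (intro emeasure_PiM I) auto
  qed
  have meas: "(\<lambda>x. emeasure (PiM I (\<lambda>_. K x)) (Pi\<^sub>E I E)) \<in> borel_measurable N"
    if E: "\<And>i. i \<in> I \<Longrightarrow> E i \<in> sets L" for E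
  proof (subst measurable_cong)
    show "emeasure (PiM I (\<lambda>_. K x)) (Pi\<^sub>E I E) = (\<Prod>i\<in>I. emeasure (K x) (E i))" if "x \<in> space N" for x
      by (rule em[OF that E])
    show "(\<lambda>x. \<Prod>i\<in>I. emeasure (K x) (E i)) \<in> borel_measurable N"
      by (intro borel_measurable_prod_ennreal measurable_compose[OF K] measurable_emeasure_subprob_algebra E)
  qed
  show "(\<lambda>x. emeasure (PiM I (\<lambda>_. K x)) A) \<in> borel_measurable N" if A: "A \<in> prod_algebra I (\<lambda>_. L)" for A
    using prod_algebraE_all[OF A] meas by (metis Pi_iff)
  show "(\<lambda>x. emeasure (PiM I (\<lambda>_. K x)) (\<Pi>\<^sub>E i\<in>I. space L)) \<in> borel_measurable N"
    by (rule meas) simp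
qed

context rl_setting
begin

lemma sigma_finite_traj_ref: "sigma_finite_measure (traj_ref P)"
  unfolding traj_ref_def by (rule traj.sigma_finite) simp

text \<open>The density is jointly measurable in parameter and trajectory, so its integral over a
  fixed event is measurable in the parameter.\<close>

lemma traj_law_kernel: "traj_law P \<in> borel \<rightarrow>\<^sub>M subprob_algebra (traj_ref P)"
proof (rule measurable_subprob_algebra)
  interpret ref: sigma_finite_measure "traj_ref P" by (rule sigma_finite_traj_ref)
  show "subprob_space (traj_law P \<theta>)" for \<theta>
    by (intro prob_space_imp_subprob_space prob_space_traj_law)
  fix A assume [measurable]: "A \<in> sets (traj_ref P)"
  have "emeasure (traj_law P \<theta>) A = (\<integral>\<^sup>+\<tau>. ennreal (traj_density P \<theta> \<tau>) * indicator A \<tau> \<partial>traj_ref P)" for \<theta>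
    unfolding traj_law_def by (rule emeasure_density) auto
  moreover have "(\<lambda>\<theta>. \<integral>\<^sup>+\<tau>. ennreal (traj_density P \<theta> \<tau>) * indicator A \<tau> \<partial>traj_ref P) \<in> borel_measurable borel"
    by measurable
  ultimately show "(\<lambda>\<theta>. emeasure (traj_law P \<theta>) A) \<in> borel_measurable borel" by simp
qed simp

abbreviation "batch_ref n \<equiv> PiM {..<n} (\<lambda>_::nat. traj_ref P)"

lemma batch_law_kernel: "batch_law P n \<in> borel \<rightarrow>\<^sub>M subprob_algebra (batch_ref n)"
  unfolding batch_law_def[abs_def]
  by (rule measurable_PiM_subprob_algebra[OF traj_law_kernel]) (auto intro: prob_space_traj_law)

lemma prob_space_batch_law: "prob_space (batch_law P n \<theta>)"
  unfolding batch_law_def by (intro prob_space_PiM prob_space_traj_law)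

lemma sets_batch_law [measurable_cong, simp]: "sets (batch_law P n \<theta>) = sets (batch_ref n)"
  unfolding batch_law_def by (intro sets_PiM_cong) auto

lemma batch_coord_measurable [measurable (raw)]:
  assumes "X \<in> N \<rightarrow>\<^sub>M batch_ref n" "i < n"
  shows "(\<lambda>x. X x i) \<in> N \<rightarrow>\<^sub>M traj_ref P"
  using assms by (auto intro!: measurable_compose[OF _ measurable_component_singleton])

lemma init_est_measurable [measurable (raw)]:
  assumes [measurable]: "\<theta> \<in> borel_measurable N" "X \<in> N \<rightarrow>\<^sub>M batch_ref n"
  shows "(\<lambda>x. init_est P n (\<theta> x) (X x)) \<in> borel_measurable N"
  unfolding init_est_def by (intro borel_measurable_scaleR borel_measurable_sum) auto

lemma hybrid_est_measurable [measurable (raw)]: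
  assumes [measurable]: "v \<in> borel_measurable N" "\<theta>' \<in> borel_measurable N" "\<theta> \<in> borel_measurable N"
    "X \<in> N \<rightarrow>\<^sub>M batch_ref n" "Y \<in> N \<rightarrow>\<^sub>M batch_ref n'"
  shows "(\<lambda>x. hybrid_est P n n' \<beta> (v x) (\<theta>' x) (\<theta> x) (X x) (Y x)) \<in> borel_measurable N"
  unfolding hybrid_est_def
  by (intro borel_measurable_add borel_measurable_scaleR borel_measurable_sum borel_measurable_diff
      grad_est_measurable imp_weight_measurable borel_measurable_const batch_coord_measurable[of _ _ n]
      batch_coord_measurable[of _ _ n'] assms) auto

text \<open>The measure of integration varies with \<open>x\<close>; expressing both integrals
  against the fixed reference measure moves this dependence into the integrand.\<close>

lemma imp_weight_var_measurable [measurable (raw)]: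
  assumes [measurable]: "\<theta> \<in> borel_measurable N" "\<theta>' \<in> borel_measurable N"
  shows "(\<lambda>x. imp_weight_var P (\<theta> x) (\<theta>' x)) \<in> borel_measurable N"
proof -
  interpret ref: sigma_finite_measure "traj_ref P" by (rule sigma_finite_traj_ref)
  have law: "(\<integral>\<tau>. f \<tau> \<partial>traj_law P \<theta>) = (\<integral>\<tau>. traj_density P \<theta> \<tau> * f \<tau> \<partial>traj_ref P)"
    if [measurable]: "f \<in> borel_measurable (traj_ref P)" for f :: "_ \<Rightarrow> real" and \<theta>
    unfolding traj_law_def by (subst integral_density) (auto simp: traj_density_nonneg)
  have "imp_weight_var P (\<theta> x) (\<theta>' x) = (\<integral>\<tau>. traj_density P (\<theta> x) \<tau> *
      (imp_weight P \<tau> (\<theta> x) (\<theta>' x) - (\<integral>\<tau>'. traj_density P (\<theta> x) \<tau>' *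
        imp_weight P \<tau>' (\<theta> x) (\<theta>' x) \<partial>traj_ref P))\<^sup>2 \<partial>traj_ref P)" for x
    by (simp add: imp_weight_var_def law)
  then show ?thesis by simp
qed

end

text \<open>The powers of B, N and m are kept out of the potential argument: it sees them only
  through \<open>step_size\<close>, and \<open>\<beta> < 1\<close> keeps the error weight
  finite.\<close>

locale prox_hspga = rl_setting P R G M b
  for P :: "('s, 'a, 'q::finite) rl_problem" and R G M b +
  fixes W L \<sigma> \<alpha> \<beta> \<eta> :: real and m N B :: nat and \<theta>\<^sub>0 :: "real^'q"
  assumes A1: "assumption_A1 P"
    and A4: "assumption_A4 P N B B \<alpha> \<beta> \<eta> \<theta>\<^sub>0 m W"
    and L_pos: "0 < L"
    and L_lipschitz: "\<And>\<theta>\<^sub>1 \<theta>\<^sub>2. norm (grad (J P) \<theta>\<^sub>1 - grad (J P) \<theta>\<^sub>2) \<le> L * norm (\<theta>\<^sub>1 - \<theta>\<^sub>2)"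
    and noise_bound: "\<And>\<theta> \<tau>. \<tau> \<in> space (traj_ref P) \<Longrightarrow> (norm (grad_est P \<tau> \<theta> - grad (J P) \<theta>))\<^sup>2 \<le> \<sigma>\<^sup>2"
    and N_pos: "0 < N" and B_pos: "0 < B"
    and \<alpha>: "0 < \<alpha>" "\<alpha> \<le> 1" and \<beta>: "0 \<le> \<beta>" "\<beta> < 1"
    and \<eta>: "\<eta> = 2 / (4 + L * \<alpha>)"
    and step_size: "2 * \<beta>\<^sup>2 / (1 - \<beta>\<^sup>2) * C_bar P R G M b W * \<alpha>\<^sup>2 / real B \<le> 2/3"
begin

lemma \<eta>_pos: "0 < \<eta>"
  using L_pos \<alpha> by (simp add: \<eta> add_pos_nonneg)

lemma regularizer_ccp: "closed_convex_proper (regularizer P)"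
  using A1 by (simp add: assumption_A1_def closed_convex_proper_def)

lemma F_opt_real: obtains f where "F_opt P = ereal f"
proof -
  obtain \<theta> where "F P \<theta> > -\<infinity>" using A1 by (auto simp: assumption_A1_def)
  moreover have "F P \<theta> \<le> F_opt P" unfolding F_opt_def by (rule SUP_upper) simp
  ultimately have "F_opt P > -\<infinity>" by order
  moreover have "F_opt P < \<infinity>" using A1 by (simp add: assumption_A1_def)
  ultimately show thesis using that by (cases "F_opt P") auto
qed

lemma continuous_J: "continuous_on UNIV (J P)"
  using gderiv_J by (auto simp: continuous_on_eq_continuous_at gderiv_def intro: has_derivative_continuous)

lemma continuous_grad_J: "continuous_on UNIV (grad (J P))"
  by (rule lipschitz_on_continuous_on[OF lipschitz_onI, of _ _ L]) (use L_lipschitz L_pos in \<open>auto simp: dist_norm\<close>)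

lemma continuous_prox_reg: "continuous_on UNIV (prox_reg P \<eta>)"
  by (rule lipschitz_on_continuous_on[OF lipschitz_onI, of _ _ 1])
    (use prox_nonexpansive[OF ccp_scale[OF regularizer_ccp \<eta>_pos]] in \<open>auto simp: dist_norm prox_reg_def\<close>)

lemma J_measurable [measurable]: "J P \<in> borel_measurable borel"
  by (rule borel_measurable_continuous_onI[OF continuous_J])

lemma grad_J_measurable [measurable]: "grad (J P) \<in> borel_measurable borel"
  by (rule borel_measurable_continuous_onI[OF continuous_grad_J])

lemma prox_reg_measurable [measurable]: "prox_reg P \<eta> \<in> borel_measurable borel"
  by (rule borel_measurable_continuous_onI[OF continuous_prox_reg])

lemma regularizer_measurable [measurable]: "regularizer P \<in> borel_measurable borel"
  by (rule ccp_measurable[OF regularizer_ccp])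

lemma prox_step_measurable [measurable (raw)]:
  assumes [measurable]: "\<theta> \<in> borel_measurable K" "v \<in> borel_measurable K"
  shows "(\<lambda>x. prox_step P \<alpha> \<eta> (\<theta> x) (v x)) \<in> borel_measurable K"
  unfolding prox_step_def by measurable

lemma grad_mapping_measurable [measurable]: "grad_mapping P \<eta> \<in> borel_measurable borel"
  unfolding grad_mapping_def[abs_def] by measurable

text \<open>Taken in \<open>ennreal\<close>, the gap is infinite exactly outside the domain of the
  regularizer and can be integrated without further conditions.\<close>

definition gap :: "real^'q \<Rightarrow> ennreal" where
  "gap \<theta> = e2ennreal (F_opt P - F P \<theta>)"

lemma gap_measurable [measurable]: "gap \<in> borel_measurable borel"
  unfolding gap_def[abs_def] F_def[abs_def] by measurable

lemma gap_infinite: "regularizer P \<theta> = \<infinity> \<Longrightarrow> gap \<theta> = \<infinity>"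
  by (rule F_opt_real) (simp add: gap_def F_def)

lemma gap_finite:
  assumes "regularizer P \<theta> = ereal q" "F_opt P = ereal f"
  shows "gap \<theta> = ennreal (f - (J P \<theta> - q))" "0 \<le> f - (J P \<theta> - q)"
proof -
  show "gap \<theta> = ennreal (f - (J P \<theta> - q))"
    using assms by (simp add: gap_def F_def)
  have "F P \<theta> \<le> F_opt P" unfolding F_opt_def by (rule SUP_upper) simp
  then show "0 \<le> f - (J P \<theta> - q)" using assms by (simp add: F_def)
qed

text \<open>Outside the domain the right-hand side is infinite; inside, this is the real inequality
  for one step with the gap in place of F. The factor 1 / \<alpha>^2 appears because the iterate
  moves by \<alpha> times the proximal displacement.\<close>

lemma prox_step_descent:
  shows "ennreal (\<eta>\<^sup>2 * (norm (grad_mapping P \<eta> \<theta>))\<^sup>2)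
     + ennreal (1/\<alpha>) * gap (prox_step P \<alpha> \<eta> \<theta> v)
     + ennreal (2/3 / \<alpha>\<^sup>2 * (norm (prox_step P \<alpha> \<eta> \<theta> v - \<theta>))\<^sup>2)
    \<le> ennreal (1/\<alpha>) * gap \<theta> + ennreal ((norm (v - grad (J P) \<theta>))\<^sup>2)"
proof (cases "regularizer P \<theta>")
  case (real q)
  obtain f where f: "F_opt P = ereal f" by (rule F_opt_real)
  define p where "p = prox_reg P \<eta> (\<theta> + \<eta> *\<^sub>R v)"
  define ps where "ps = prox_reg P \<eta> (\<theta> + \<eta> *\<^sub>R grad (J P) \<theta>)"
  define \<theta>' where "\<theta>' = prox_step P \<alpha> \<eta> \<theta> v"
  obtain q' where q': "regularizer P \<theta>' = ereal q'"
    "(norm (ps - \<theta>))\<^sup>2 + 2/3 * (norm (p - \<theta>))\<^sup>2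
      \<le> (J P \<theta>' - q' - (J P \<theta> - q)) / \<alpha> + (norm (v - grad (J P) \<theta>))\<^sup>2"
    using prox_gradient_step[OF regularizer_ccp gderiv_J L_pos L_lipschitz \<alpha> \<eta> real, of v]
    unfolding \<theta>'_def prox_step_def p_def ps_def prox_reg_def by metis
  have 1: "\<eta>\<^sup>2 * (norm (grad_mapping P \<eta> \<theta>))\<^sup>2 = (norm (ps - \<theta>))\<^sup>2"
    using \<eta>_pos by (simp add: grad_mapping_def ps_def power_mult_distrib power_divide)
  have "\<theta>' - \<theta> = \<alpha> *\<^sub>R (p - \<theta>)" by (simp add: \<theta>'_def prox_step_def p_def algebra_simps)
  then have 2: "2/3 / \<alpha>\<^sup>2 * (norm (\<theta>' - \<theta>))\<^sup>2 = 2/3 * (norm (p - \<theta>))\<^sup>2"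
    using \<alpha> by (simp add: power_mult_distrib)
  have "(norm (ps - \<theta>))\<^sup>2 + (f - (J P \<theta>' - q')) / \<alpha> + 2/3 * (norm (p - \<theta>))\<^sup>2
      \<le> (f - (J P \<theta> - q)) / \<alpha> + (norm (v - grad (J P) \<theta>))\<^sup>2"
    using q'(2) by (simp add: diff_divide_distrib)
  moreover have "ennreal (1/\<alpha>) * gap \<theta> = ennreal ((f - (J P \<theta> - q)) / \<alpha>)"
      "ennreal (1/\<alpha>) * gap \<theta>' = ennreal ((f - (J P \<theta>' - q')) / \<alpha>)"
    using gap_finite[OF real f] gap_finite[OF q'(1) f] \<alpha> by (simp_all flip: ennreal_mult)
  ultimately show ?thesis
    using gap_finite[OF real f] gap_finite[OF q'(1) f] \<alpha>
    unfolding \<theta>'_def[symmetric] 1 2 by (simp flip: ennreal_plus)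
next
  case PInf
  then show ?thesis using \<alpha> by (simp add: gap_infinite ennreal_mult_top)
next
  case MInf
  then show ?thesis using A1 by (simp add: assumption_A1_def)
qed

end

section \<open>Potential argument along a run\<close>

lemma space_run_space [simp]: "space run_space = UNIV"
  by (simp add: run_space_def space_pair_measure space_PiM)

lemma iterate_measurable [measurable (raw)]:
  assumes "f \<in> N \<rightarrow>\<^sub>M (run_space :: ((nat \<Rightarrow> real^'q::finite) \<times> (real^'q)) measure)"
  shows "(\<lambda>x. fst (f x) i) \<in> borel_measurable N"
proof -
  have "(\<lambda>x. fst (f x)) \<in> N \<rightarrow>\<^sub>M PiM UNIV (\<lambda>_. borel)"
    using assms by (auto simp: run_space_def intro: measurable_compose[OF _ measurable_fst])
  then show ?thesis by (rule measurable_compose) (rule measurable_component_singleton, simp)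
qed

lemma estimate_measurable [measurable (raw)]:
  assumes "f \<in> N \<rightarrow>\<^sub>M (run_space :: ((nat \<Rightarrow> real^'q::finite) \<times> (real^'q)) measure)"
  shows "(\<lambda>x. snd (f x)) \<in> borel_measurable N"
  using assms by (auto simp: run_space_def intro: measurable_compose[OF _ measurable_snd])

lemma run_space_measurable_Pair:
  assumes "\<And>i. (\<lambda>x. f x i) \<in> borel_measurable N" "g \<in> borel_measurable N"
  shows "(\<lambda>x. (f x, g x)) \<in> N \<rightarrow>\<^sub>M (run_space :: ((nat \<Rightarrow> real^'q::finite) \<times> (real^'q)) measure)"
  unfolding run_space_def
  by (intro measurable_Pair assms measurable_PiM_single') (auto intro: assms(1))

context prox_hspga
begin

abbreviation "algo t \<equiv> run P N B B \<alpha> \<beta> \<eta> \<theta>\<^sub>0 t"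

definition next_state :: "nat \<Rightarrow> (nat \<Rightarrow> real^'q) \<times> (real^'q) \<Rightarrow>
    (nat \<Rightarrow> nat \<Rightarrow> 's \<times> 'a) \<times> (nat \<Rightarrow> nat \<Rightarrow> 's \<times> 'a) \<Rightarrow> (nat \<Rightarrow> real^'q) \<times> (real^'q)" where
  "next_state t z XY =
     (let v = hybrid_est P B B \<beta> (snd z) (fst z t) (fst z (Suc t)) (fst XY) (snd XY)
      in ((fst z)(Suc (Suc t) := prox_step P \<alpha> \<eta> (fst z (Suc t)) v), v))"

definition step_law :: "nat \<Rightarrow> (nat \<Rightarrow> real^'q) \<times> (real^'q) \<Rightarrow> ((nat \<Rightarrow> real^'q) \<times> (real^'q)) measure" where
  "step_law t z = distr (batch_law P B (fst z (Suc t)) \<Otimes>\<^sub>M batch_law P B (fst z (Suc t))) run_space (next_state t z)"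

lemma run_Suc: "algo (Suc t) = Giry_Monad.bind (algo t) (step_law t)"
  by (simp add: step_law_def[abs_def] next_state_def[abs_def] case_prod_beta' Let_def)

declare run.simps(2) [simp del]

lemma next_state_measurable:
  "(\<lambda>(z, XY). next_state t z XY) \<in> run_space \<Otimes>\<^sub>M (batch_ref B \<Otimes>\<^sub>M batch_ref B) \<rightarrow>\<^sub>M run_space"
  unfolding next_state_def Let_def case_prod_beta
  by (intro run_space_measurable_Pair) (auto simp: fun_upd_apply)

lemma next_state_measurable_snd [measurable]:
  "next_state t z \<in> batch_ref B \<Otimes>\<^sub>M batch_ref B \<rightarrow>\<^sub>M run_space"
  using measurable_compose[OF measurable_Pair1' next_state_measurable, of z t] by simp

lemma step_law_kernel: "step_law t \<in> run_space \<rightarrow>\<^sub>M subprob_algebra run_space"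
proof -
  have "(\<lambda>z. fst z (Suc t)) \<in> borel_measurable (run_space :: ((nat \<Rightarrow> real^'q) \<times> (real^'q)) measure)"
    by (rule iterate_measurable) simp
  from measurable_compose[OF this batch_law_kernel]
  have batch: "(\<lambda>z. batch_law P B (fst z (Suc t))) \<in> run_space \<rightarrow>\<^sub>M subprob_algebra (batch_ref B)" .
  show ?thesis unfolding step_law_def[abs_def]
    by (rule measurable_distr2[OF next_state_measurable measurable_pair_measure[OF batch batch]])
qed

lemma prob_space_step_law: "prob_space (step_law t z)"
proof -
  interpret X: prob_space "batch_law P B (fst z (Suc t))" by (rule prob_space_batch_law)
  interpret pair_prob_space "batch_law P B (fst z (Suc t))" "batch_law P B (fst z (Suc t))" ..
  show ?thesis unfolding step_law_def by (rule prob_space_distr) measurable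
qed

lemma sets_step_law [simp]: "sets (step_law t z) = sets run_space"
  by (simp add: step_law_def)

lemma nn_integral_step_law:
  assumes "f \<in> borel_measurable run_space"
  shows "(\<integral>\<^sup>+z'. f z' \<partial>step_law t z)
    = (\<integral>\<^sup>+XY. f (next_state t z XY) \<partial>(batch_law P B (fst z (Suc t)) \<Otimes>\<^sub>M batch_law P B (fst z (Suc t))))"
  unfolding step_law_def using assms by (subst nn_integral_distr) auto

definition init_state :: "(nat \<Rightarrow> nat \<Rightarrow> 's \<times> 'a) \<Rightarrow> (nat \<Rightarrow> real^'q) \<times> (real^'q)" where
  "init_state X = (let v = init_est P N \<theta>\<^sub>0 X in ((\<lambda>_. \<theta>\<^sub>0)(1 := prox_step P \<alpha> \<eta> \<theta>\<^sub>0 v), v))"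

lemma run_0: "algo 0 = distr (batch_law P N \<theta>\<^sub>0) run_space init_state"
  by (simp add: init_state_def[abs_def])

declare run.simps(1) [simp del]

lemma init_state_measurable [measurable]: "init_state \<in> batch_ref N \<rightarrow>\<^sub>M run_space"
  unfolding init_state_def[abs_def] Let_def
  by (intro run_space_measurable_Pair) (auto simp: fun_upd_apply)

text \<open>Both claims are proved together, since the kernel property that the bind requires
  depends on the sigma-algebra of the preceding stage.\<close>

lemma run_prob_space: "prob_space (algo t) \<and> sets (algo t) = sets run_space"
proof (induction t)
  case 0
  interpret X: prob_space "batch_law P N \<theta>\<^sub>0" by (rule prob_space_batch_law)
  show ?case unfolding run_0 by (auto intro!: X.prob_space_distr)
next
  case (Suc t)
  then interpret R: prob_space "algo t" by simp
  have K: "step_law t \<in> algo t \<rightarrow>\<^sub>M subprob_algebra run_space"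
    using step_law_kernel Suc by (simp cong: measurable_cong_sets)
  show ?case unfolding run_Suc
    by (auto intro!: R.prob_space_bind[OF _ K] AE_I2 prob_space_step_law simp: R.not_empty)
qed

lemma sets_run [measurable_cong, simp]: "sets (algo t) = sets run_space"
  using run_prob_space by simp

lemma space_run [simp]: "space (algo t) = UNIV"
  using sets_eq_imp_space_eq[OF sets_run] by simp

lemma step_law_kernel_run: "step_law t \<in> algo t \<rightarrow>\<^sub>M subprob_algebra run_space"
  using step_law_kernel by (simp cong: measurable_cong_sets)

text \<open>This transfers the variance bound, assumed for the complete run, to its earlier stages: a step
  only appends to the sequence of iterates.\<close>

lemma AE_run_Suc:
  assumes [measurable]: "Measurable.pred run_space Q"
    and prefix: "\<And>z z'. (\<And>i. i \<le> Suc t \<Longrightarrow> fst z i = fst z' i) \<Longrightarrow> Q z \<Longrightarrow> Q z'"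
    and "AE z in algo (Suc t). Q z"
  shows "AE z in algo t. Q z"
proof -
  have Q: "{z. Q z} \<in> sets run_space" using assms(1) by (simp add: pred_def)
  have "AE z in algo t. AE z' in step_law t z. Q z'"
    using assms(3) unfolding run_Suc by (subst (asm) AE_bind[OF step_law_kernel_run]) auto
  then show ?thesis
  proof eventually_elim
    case (elim z)
    interpret X: prob_space "batch_law P B (fst z (Suc t))" by (rule prob_space_batch_law)
    interpret XY: pair_prob_space "batch_law P B (fst z (Suc t))" "batch_law P B (fst z (Suc t))" ..
    have "AE XY in batch_law P B (fst z (Suc t)) \<Otimes>\<^sub>M batch_law P B (fst z (Suc t)). Q (next_state t z XY)"
      using elim Q unfolding step_law_def by (subst (asm) AE_distr_iff) auto
    then have "AE XY in batch_law P B (fst z (Suc t)) \<Otimes>\<^sub>M batch_law P B (fst z (Suc t)). Q z"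
      by eventually_elim (rule prefix, auto simp: next_state_def Let_def)
    then show "Q z" by (simp add: XY.AE_const)
  qed
qed

lemma AE_run_var:
  assumes "t < m"
  shows "AE z in algo t. imp_weight_var P (fst z (Suc t)) (fst z t) \<le> W"
proof -
  have "AE z in algo m. \<forall>t\<in>{1..m}. imp_weight_var P (fst z t) (fst z (t - 1)) \<le> W"
    using A4 by (simp add: assumption_A4_def case_prod_beta)
  then have end_of_run: "AE z in algo m. imp_weight_var P (fst z (Suc t)) (fst z t) \<le> W"
    by eventually_elim (use assms in \<open>auto dest: bspec[of _ _ "Suc t"]\<close>)
  \<comment> \<open>Induction downwards from the end of the run. The case \<open>n = t\<close> is
    included because stage \<open>t\<close> already contains the iterate
    \<open>t + 1\<close>.\<close>
  have "AE z in algo n. imp_weight_var P (fst z (Suc t)) (fst z t) \<le> W" if "n + k = m" "t \<le> n" for n k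
    using that
  proof (induction k arbitrary: n)
    case 0
    then have "n = m" by simp
    then show ?case by (rule ssubst) (rule end_of_run)
  next
    case (Suc k)
    show ?case
    proof (rule AE_run_Suc)
      show "AE z in algo (Suc n). imp_weight_var P (fst z (Suc t)) (fst z t) \<le> W"
        by (rule Suc.IH) (use Suc.prems in auto)
    qed (use Suc.prems in auto)
  qed
  from this[of t "m - t"] show ?thesis using assms by simp
qed

text \<open>The sum of the even powers \<beta>^2, \<beta>^4, ...: the total weight with which a
  present error returns in later iterations.\<close>

definition lam :: real where "lam = \<beta>\<^sup>2 / (1 - \<beta>\<^sup>2)"

text \<open>The gap is evaluated at index \<open>t + 1\<close>, since stage \<open>t\<close>
  includes that proximal step. The squared displacement is retained as a reserve from which the
  variance of the next correction will be paid.\<close>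

definition potential :: "nat \<Rightarrow> (nat \<Rightarrow> real^'q) \<times> (real^'q) \<Rightarrow> ennreal" where
  "potential t z = (\<Sum>s\<le>t. ennreal (\<eta>\<^sup>2 * (norm (grad_mapping P \<eta> (fst z s)))\<^sup>2))
     + ennreal (1/\<alpha>) * gap (fst z (Suc t))
     + ennreal (lam * (norm (snd z - grad (J P) (fst z t)))\<^sup>2
         + 2/3 / \<alpha>\<^sup>2 * (norm (fst z (Suc t) - fst z t))\<^sup>2)"

lemma potential_measurable [measurable]: "potential t \<in> borel_measurable run_space"
  unfolding potential_def[abs_def] by measurable

lemma beta_square: "\<beta>\<^sup>2 < 1"
  using \<beta> by (simp add: power_less_one_iff abs_square_less_1)

lemma lam: "0 \<le> lam" "(1 + lam) * \<beta>\<^sup>2 = lam" "1 + lam = 1 / (1 - \<beta>\<^sup>2)"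
  using beta_square by (auto simp: lam_def field_simps)

text \<open>The proximal step produces one further copy of the squared error, hence the weight 1 +
  lam. The accumulated sum \<open>S\<close> is arbitrary so that the initial and the later
  iterations are covered alike.\<close>

lemma prox_step_potential:
  fixes S :: ennreal
  shows "S + ennreal (\<eta>\<^sup>2 * (norm (grad_mapping P \<eta> \<theta>))\<^sup>2) + ennreal (1/\<alpha>) * gap (prox_step P \<alpha> \<eta> \<theta> v)
     + ennreal (lam * (norm (v - grad (J P) \<theta>))\<^sup>2 + 2/3 / \<alpha>\<^sup>2 * (norm (prox_step P \<alpha> \<eta> \<theta> v - \<theta>))\<^sup>2)
    \<le> S + ennreal (1/\<alpha>) * gap \<theta> + ennreal (1 + lam) * ennreal ((norm (v - grad (J P) \<theta>))\<^sup>2)"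
proof -
  let ?e = "(norm (v - grad (J P) \<theta>))\<^sup>2" and ?d = "2/3 / \<alpha>\<^sup>2 * (norm (prox_step P \<alpha> \<eta> \<theta> v - \<theta>))\<^sup>2"
  let ?g = "ennreal (\<eta>\<^sup>2 * (norm (grad_mapping P \<eta> \<theta>))\<^sup>2)" and ?h = "ennreal (1/\<alpha>) * gap (prox_step P \<alpha> \<eta> \<theta> v)"
  have "S + ?g + ?h + ennreal (lam * ?e + ?d) = (S + ennreal (lam * ?e)) + (?g + ?h + ennreal ?d)"
    using lam(1) \<alpha> by (simp add: ennreal_plus ac_simps)
  also have "\<dots> \<le> (S + ennreal (lam * ?e)) + (ennreal (1/\<alpha>) * gap \<theta> + ennreal ?e)"
    by (intro add_left_mono prox_step_descent)
  also have "\<dots> = S + ennreal (1/\<alpha>) * gap \<theta> + ennreal (1 + lam) * ennreal ?e"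
    using lam(1) by (simp add: ennreal_plus ennreal_mult distrib_right ac_simps)
  finally show ?thesis .
qed

lemma potential_0:
  "(\<integral>\<^sup>+z. potential 0 z \<partial>algo 0) \<le> ennreal (1/\<alpha>) * gap \<theta>\<^sub>0 + ennreal ((1 + lam) * (\<sigma>\<^sup>2 / real N))"
proof -
  interpret X: prob_space "batch_law P N \<theta>\<^sub>0" by (rule prob_space_batch_law)
  let ?e = "\<lambda>X. ennreal ((norm (init_est P N \<theta>\<^sub>0 X - grad (J P) \<theta>\<^sub>0))\<^sup>2)"
  have "(\<integral>\<^sup>+z. potential 0 z \<partial>algo 0) = (\<integral>\<^sup>+X. potential 0 (init_state X) \<partial>batch_law P N \<theta>\<^sub>0)"
    unfolding run_0 by (subst nn_integral_distr) auto
  also have "\<dots> \<le> (\<integral>\<^sup>+X. ennreal (1/\<alpha>) * gap \<theta>\<^sub>0 + ennreal (1 + lam) * ?e X \<partial>batch_law P N \<theta>\<^sub>0)"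
    using prox_step_potential[of 0]
    by (intro nn_integral_mono) (simp add: potential_def init_state_def Let_def)
  also have "\<dots> = ennreal (1/\<alpha>) * gap \<theta>\<^sub>0 + ennreal (1 + lam) * (\<integral>\<^sup>+X. ?e X \<partial>batch_law P N \<theta>\<^sub>0)"
    by (subst nn_integral_add) (auto simp: X.emeasure_space_1 nn_integral_cmult)
  also have "\<dots> \<le> ennreal (1/\<alpha>) * gap \<theta>\<^sub>0 + ennreal (1 + lam) * ennreal (\<sigma>\<^sup>2 / real N)"
    by (intro add_left_mono mult_left_mono init_est_error noise_bound N_pos) auto
  also have "ennreal (1 + lam) * ennreal (\<sigma>\<^sup>2 / real N) = ennreal ((1 + lam) * (\<sigma>\<^sup>2 / real N))"
    using lam(1) by (intro ennreal_mult[symmetric]) auto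
  finally show ?thesis .
qed

lemma potential_step:
  assumes W: "imp_weight_var P (fst z (Suc t)) (fst z t) \<le> W"
  shows "(\<integral>\<^sup>+z'. potential (Suc t) z' \<partial>step_law t z)
    \<le> potential t z + ennreal ((1 + lam) * ((1 - \<beta>)\<^sup>2 * \<sigma>\<^sup>2 / real B))"
proof -
  define \<theta> where "\<theta> = fst z (Suc t)"
  define \<theta>' where "\<theta>' = fst z t"
  define v where "v = snd z"
  interpret X: prob_space "batch_law P B \<theta>" by (rule prob_space_batch_law)
  interpret XY: pair_prob_space "batch_law P B \<theta>" "batch_law P B \<theta>" ..
  let ?D = "batch_law P B \<theta> \<Otimes>\<^sub>M batch_law P B \<theta>"
  let ?C = "C_bar P R G M b W"
  define S where "S = (\<Sum>s\<le>t. ennreal (\<eta>\<^sup>2 * (norm (grad_mapping P \<eta> (fst z s)))\<^sup>2))"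
  define e where "e = (norm (v - grad (J P) \<theta>'))\<^sup>2"
  define u where "u = (norm (\<theta> - \<theta>'))\<^sup>2"
  let ?e = "\<lambda>(X, Y). ennreal ((norm (hybrid_est P B B \<beta> v \<theta>' \<theta> X Y - grad (J P) \<theta>))\<^sup>2)"
  have C: "0 \<le> u" "0 \<le> e" "0 < real B" using B_pos by (auto simp: u_def e_def)
  have "(\<integral>\<^sup>+z'. potential (Suc t) z' \<partial>step_law t z) = (\<integral>\<^sup>+XY. potential (Suc t) (next_state t z XY) \<partial>?D)"
    unfolding \<theta>_def by (rule nn_integral_step_law) simp
  also have "\<dots> \<le> (\<integral>\<^sup>+XY. (S + ennreal (1/\<alpha>) * gap \<theta>) + ennreal (1 + lam) * ?e XY \<partial>?D)"
  proof (rule nn_integral_mono)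
    fix XY
    show "potential (Suc t) (next_state t z XY) \<le> (S + ennreal (1/\<alpha>) * gap \<theta>) + ennreal (1 + lam) * ?e XY"
      using prox_step_potential[of S \<theta> "hybrid_est P B B \<beta> v \<theta>' \<theta> (fst XY) (snd XY)"]
      by (simp add: potential_def next_state_def Let_def S_def \<theta>_def \<theta>'_def v_def case_prod_beta)
  qed
  also have "\<dots> = (S + ennreal (1/\<alpha>) * gap \<theta>) + ennreal (1 + lam) * (\<integral>\<^sup>+XY. ?e XY \<partial>?D)"
    by (subst nn_integral_add) (auto simp: XY.emeasure_space_1 nn_integral_cmult)
  also have "\<dots> \<le> (S + ennreal (1/\<alpha>) * gap \<theta>) + ennreal (1 + lam) *
      ennreal (\<beta>\<^sup>2 * e + \<beta>\<^sup>2 * (2 * ?C * u) / real B + (1 - \<beta>)\<^sup>2 * \<sigma>\<^sup>2 / real B)"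
    unfolding e_def u_def
    by (intro add_left_mono mult_left_mono hybrid_est_error noise_bound B_pos W[folded \<theta>_def \<theta>'_def]) auto
  also have "ennreal (1 + lam) * ennreal (\<beta>\<^sup>2 * e + \<beta>\<^sup>2 * (2 * ?C * u) / real B + (1 - \<beta>)\<^sup>2 * \<sigma>\<^sup>2 / real B)
     = ennreal ((1 + lam) * (\<beta>\<^sup>2 * e + \<beta>\<^sup>2 * (2 * ?C * u) / real B + (1 - \<beta>)\<^sup>2 * \<sigma>\<^sup>2 / real B))"
    using lam(1) by (simp add: ennreal_mult')
  also have "\<dots> \<le> ennreal ((lam * e + 2/3 / \<alpha>\<^sup>2 * u) + (1 + lam) * ((1 - \<beta>)\<^sup>2 * \<sigma>\<^sup>2 / real B))"
  proof (rule ennreal_leI)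
    \<comment> \<open>In this form the step-size condition says that the correction variance,
      weighted by 1 + lam, is covered by the retained displacement.\<close>
    have "2 * \<beta>\<^sup>2 / (1 - \<beta>\<^sup>2) * ?C / real B \<le> 2/3 / \<alpha>\<^sup>2"
      using step_size \<alpha> by (simp add: field_simps)
    then have "2 * \<beta>\<^sup>2 / (1 - \<beta>\<^sup>2) * ?C / real B * u \<le> 2/3 / \<alpha>\<^sup>2 * u"
      using C by (intro mult_right_mono)
    moreover have "(1 + lam) * (\<beta>\<^sup>2 * (2 * ?C * u) / real B) = 2 * \<beta>\<^sup>2 / (1 - \<beta>\<^sup>2) * ?C / real B * u"
      unfolding lam(3) by simp
    moreover have "(1 + lam) * (\<beta>\<^sup>2 * e) = lam * e" by (simp only: lam(2) flip: mult.assoc)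
    ultimately show "(1 + lam) * (\<beta>\<^sup>2 * e + \<beta>\<^sup>2 * (2 * ?C * u) / real B + (1 - \<beta>)\<^sup>2 * \<sigma>\<^sup>2 / real B)
      \<le> (lam * e + 2/3 / \<alpha>\<^sup>2 * u) + (1 + lam) * ((1 - \<beta>)\<^sup>2 * \<sigma>\<^sup>2 / real B)"
      by (simp only: distrib_left)
  qed
  also have "\<dots> = ennreal (lam * e + 2/3 / \<alpha>\<^sup>2 * u) + ennreal ((1 + lam) * ((1 - \<beta>)\<^sup>2 * \<sigma>\<^sup>2 / real B))"
    using lam(1) C by (intro ennreal_plus) auto
  finally show ?thesis
    by (simp add: potential_def S_def e_def u_def \<theta>_def \<theta>'_def v_def add.assoc add_left_mono)
qed

lemma potential_bound:
  assumes "t \<le> m"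
  shows "(\<integral>\<^sup>+z. potential t z \<partial>algo t) \<le> ennreal (1/\<alpha>) * gap \<theta>\<^sub>0
    + ennreal ((1 + lam) * (\<sigma>\<^sup>2 / real N + real t * ((1 - \<beta>)\<^sup>2 * \<sigma>\<^sup>2 / real B)))"
  using assms
proof (induction t)
  case 0
  then show ?case using potential_0 by simp
next
  case (Suc t)
  interpret R: prob_space "algo t" using run_prob_space by blast
  let ?c = "(1 - \<beta>)\<^sup>2 * \<sigma>\<^sup>2 / real B"
  have "(\<integral>\<^sup>+z. potential (Suc t) z \<partial>algo (Suc t)) = (\<integral>\<^sup>+z. (\<integral>\<^sup>+z'. potential (Suc t) z' \<partial>step_law t z) \<partial>algo t)"
    unfolding run_Suc by (rule nn_integral_bind[OF _ step_law_kernel_run]) simp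
  also have "\<dots> \<le> (\<integral>\<^sup>+z. potential t z + ennreal ((1 + lam) * ?c) \<partial>algo t)"
  proof (rule nn_integral_mono_AE)
    have "AE z in algo t. imp_weight_var P (fst z (Suc t)) (fst z t) \<le> W"
      by (rule AE_run_var) (use Suc.prems in simp)
    then show "AE z in algo t. (\<integral>\<^sup>+z'. potential (Suc t) z' \<partial>step_law t z) \<le> potential t z + ennreal ((1 + lam) * ?c)"
      by (rule eventually_mono) (rule potential_step)
  qed
  also have "\<dots> = (\<integral>\<^sup>+z. potential t z \<partial>algo t) + ennreal ((1 + lam) * ?c)"
    by (subst nn_integral_add) (use R.emeasure_space_1 in auto)
  also have "\<dots> \<le> (ennreal (1/\<alpha>) * gap \<theta>\<^sub>0 + ennreal ((1 + lam) * (\<sigma>\<^sup>2 / real N + real t * ?c)))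
      + ennreal ((1 + lam) * ?c)"
    by (intro add_right_mono Suc.IH) (use Suc.prems in simp)
  also have "\<dots> = ennreal (1/\<alpha>) * gap \<theta>\<^sub>0 + ennreal ((1 + lam) * (\<sigma>\<^sup>2 / real N + real t * ?c) + (1 + lam) * ?c)"
    using lam(1) by (subst ennreal_plus) (auto simp: add.assoc)
  also have "(1 + lam) * (\<sigma>\<^sup>2 / real N + real t * ?c) + (1 + lam) * ?c
      = (1 + lam) * (\<sigma>\<^sup>2 / real N + real (Suc t) * ?c)"
    using B_pos by (simp add: field_simps)
  finally show ?case .
qed

section \<open>The uniformly drawn output index\<close>

lemma output_law_kernel:
  "(\<lambda>(\<theta>s, v). distr (uniform_count_measure {0..m}) borel (\<lambda>T. \<theta>s T))
    \<in> algo m \<rightarrow>\<^sub>M subprob_algebra (borel :: (real^'q) measure)"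
proof -
  have "(\<lambda>z. distr (uniform_count_measure {0..m}) borel (\<lambda>T. fst z T)) \<in> run_space \<rightarrow>\<^sub>M subprob_algebra (borel :: (real^'q) measure)"
  proof (rule measurable_distr2[where M="count_space {0..m}"])
    show "(\<lambda>(z, T). fst z T) \<in> run_space \<Otimes>\<^sub>M count_space {0..m} \<rightarrow>\<^sub>M (borel :: (real^'q) measure)"
      unfolding case_prod_beta'
      by (rule measurable_compose_countable'[where f="\<lambda>T x. fst (fst x) T" and g=snd and I="{0..m}"]) auto
    have "prob_space (uniform_count_measure {0..m})"
      by (rule prob_space_uniform_count_measure) auto
    then have "uniform_count_measure {0..m} \<in> space (subprob_algebra (count_space {0..m}))"
      by (simp add: space_subprob_algebra prob_space_imp_subprob_space sets_uniform_count_measure_count_space)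
    then show "(\<lambda>z. uniform_count_measure {0..m}) \<in> run_space \<rightarrow>\<^sub>M subprob_algebra (count_space {0..m})"
      by simp
  qed
  then show ?thesis by (simp add: case_prod_beta cong: measurable_cong_sets)
qed

lemma nn_integral_output_law:
  assumes [measurable]: "f \<in> borel_measurable borel"
  shows "(\<integral>\<^sup>+\<theta>. f \<theta> \<partial>output_law P N B B \<alpha> \<beta> \<eta> \<theta>\<^sub>0 m)
    = (\<integral>\<^sup>+z. ennreal (1 / (real m + 1)) * (\<Sum>s\<le>m. f (fst z s)) \<partial>algo m)"
proof -
  have "(\<integral>\<^sup>+\<theta>. f \<theta> \<partial>distr (uniform_count_measure {0..m}) borel (\<lambda>T. fst z T))
      = ennreal (1 / (real m + 1)) * (\<Sum>s\<le>m. f (fst z s))" for z :: "(nat \<Rightarrow> real^'q) \<times> (real^'q)"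
    by (subst nn_integral_distr)
      (auto simp: uniform_count_measure_def nn_integral_point_measure_finite sum_distrib_left
        atLeast0AtMost add.commute measurable_point_measure_eq1)
  then show ?thesis unfolding output_law_def
    by (subst nn_integral_bind[OF assms output_law_kernel]) (simp add: case_prod_beta)
qed

text \<open>Of the final potential only the sum over the iterates is kept; the gap and the error
  terms are nonnegative. The factor 1 / \<eta>^2 converts proximal displacements into gradient
  mappings.\<close>

lemma output_bound:
  "(\<integral>\<^sup>+\<theta>. ennreal ((norm (grad_mapping P \<eta> \<theta>))\<^sup>2) \<partial>output_law P N B B \<alpha> \<beta> \<eta> \<theta>\<^sub>0 m)
    \<le> ennreal (1 / (\<eta>\<^sup>2 * (real m + 1))) * (ennreal (1/\<alpha>) * gap \<theta>\<^sub>0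
    + ennreal ((1 + lam) * (\<sigma>\<^sup>2 / real N + real m * ((1 - \<beta>)\<^sup>2 * \<sigma>\<^sup>2 / real B))))"
proof -
  have "ennreal (1 / (real m + 1)) * (\<Sum>s\<le>m. ennreal ((norm (grad_mapping P \<eta> (fst z s)))\<^sup>2))
      \<le> ennreal (1 / (\<eta>\<^sup>2 * (real m + 1))) * potential m z" for z
  proof -
    have "ennreal (1 / (real m + 1)) * ennreal ((norm (grad_mapping P \<eta> (fst z s)))\<^sup>2)
      = ennreal (1 / (\<eta>\<^sup>2 * (real m + 1))) * ennreal (\<eta>\<^sup>2 * (norm (grad_mapping P \<eta> (fst z s)))\<^sup>2)" for s
      using \<eta>_pos by (simp flip: ennreal_mult)
    then have "ennreal (1 / (real m + 1)) * (\<Sum>s\<le>m. ennreal ((norm (grad_mapping P \<eta> (fst z s)))\<^sup>2))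
      = ennreal (1 / (\<eta>\<^sup>2 * (real m + 1))) * (\<Sum>s\<le>m. ennreal (\<eta>\<^sup>2 * (norm (grad_mapping P \<eta> (fst z s)))\<^sup>2))"
      by (simp only: sum_distrib_left)
    also have "\<dots> \<le> ennreal (1 / (\<eta>\<^sup>2 * (real m + 1))) * potential m z"
      by (intro mult_left_mono) (auto simp: potential_def add.assoc)
    finally show ?thesis .
  qed
  then have "(\<integral>\<^sup>+\<theta>. ennreal ((norm (grad_mapping P \<eta> \<theta>))\<^sup>2) \<partial>output_law P N B B \<alpha> \<beta> \<eta> \<theta>\<^sub>0 m)
    \<le> (\<integral>\<^sup>+z. ennreal (1 / (\<eta>\<^sup>2 * (real m + 1))) * potential m z \<partial>algo m)"
    by (subst nn_integral_output_law) (auto intro: nn_integral_mono)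
  also have "\<dots> = ennreal (1 / (\<eta>\<^sup>2 * (real m + 1))) * (\<integral>\<^sup>+z. potential m z \<partial>algo m)"
    by (rule nn_integral_cmult) simp
  also have "\<dots> \<le> ennreal (1 / (\<eta>\<^sup>2 * (real m + 1))) * (ennreal (1/\<alpha>) * gap \<theta>\<^sub>0
    + ennreal ((1 + lam) * (\<sigma>\<^sup>2 / real N + real m * ((1 - \<beta>)\<^sup>2 * \<sigma>\<^sup>2 / real B))))"
    by (intro mult_left_mono potential_bound) auto
  finally show ?thesis .
qed

end


section \<open>Substituting the parameters\<close>

lemma powr_quarter_square: "0 \<le> x \<Longrightarrow> (x powr (1/4))\<^sup>2 = sqrt x" for x :: real
  by (simp add: power2_eq_square powr_half_sqrt flip: powr_add)

lemma powr_three_quarters_square: "0 \<le> x \<Longrightarrow> (x powr (3/4))\<^sup>2 = x * sqrt x" for x :: real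
proof -
  assume x: "0 \<le> x"
  have "(x powr (3/4))\<^sup>2 = x powr (1 + 1/2)" by (simp add: power2_eq_square flip: powr_add)
  also have "\<dots> = x * sqrt x" using x by (simp only: powr_add powr_one powr_half_sqrt)
  finally show ?thesis .
qed

lemma (in rl_setting) C_bar_pos:
  assumes "0 < W"
  shows "0 < C_bar P R G M b W"
proof -
  have "0 < L_g P R M b"
    unfolding L_g_def using R_pos M_pos bound_nonneg discount horizon by (auto intro!: divide_pos_pos mult_pos_pos)
  moreover have "0 \<le> C_\<omega> P G M W"
    unfolding C_\<omega>_def using assms M_pos by auto
  ultimately show ?thesis by (simp add: C_bar_def add_nonneg_pos)
qed

text \<open>The left-hand side is a nonnegative integral, so for \<open>\<theta>\<^sub>0\<close> in
  the domain the bound includes finiteness of the expectation; outside the domain the right-hand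
  side is infinite.\<close>

theorem theorem4p1:
  fixes P :: "('s, 'a, 'q::finite) rl_problem"
    and R G M W b L \<sigma> c_hat \<alpha> \<beta> \<eta> Cbar :: real
    and m N B :: nat
    and \<theta>\<^sub>0 :: "real^'q"
  assumes model: "rl_model P"
    and A1: "assumption_A1 P"
    and A2: "assumption_A2 P R"
    and A3: "assumption_A3 P G M"
    and A4: "assumption_A4 P N B B \<alpha> \<beta> \<eta> \<theta>\<^sub>0 m W"
    and baseline_bound: "\<And>t s. t < horizon P \<Longrightarrow> s \<in> space (state_ref P) \<Longrightarrow>
                           \<bar>baseline P t s\<bar> \<le> b"
    and L: "L > 0" "\<And>\<theta>\<^sub>1 \<theta>\<^sub>2. norm (grad (J P) \<theta>\<^sub>1 - grad (J P) \<theta>\<^sub>2) \<le> L * norm (\<theta>\<^sub>1 - \<theta>\<^sub>2)"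
    and \<sigma>: "\<sigma> > 0" "\<And>\<theta> \<tau>. \<tau> \<in> space (traj_ref P) \<Longrightarrow>
                (norm (grad_est P \<tau> \<theta> - grad (J P) \<theta>))\<^sup>2 \<le> \<sigma>\<^sup>2"
    and Cbar: "Cbar = C_bar P R G M b W"
    and pos: "m > 0" "N > 0" "B > 0"
    and c_hat: "0 < c_hat" "c_hat \<le> 1"
    and \<beta>: "\<beta> = 1 - sqrt (real B) / sqrt (real N * (real m + 1))" "0 \<le> \<beta>" "\<beta> \<le> 1"
    and \<alpha>: "\<alpha> = c_hat * sqrt 2 * real B powr (3/4) /
                 (sqrt (3 * Cbar) * real N powr (1/4) * (real m + 1) powr (1/4))"
           "0 \<le> \<alpha>" "\<alpha> \<le> 1"
    and \<eta>: "\<eta> = 2 / (4 + L * \<alpha>)"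
  shows "enn2ereal (\<integral>\<^sup>+ \<theta>. ennreal ((norm (grad_mapping P \<eta> \<theta>))\<^sup>2)
                      \<partial>output_law P N B B \<alpha> \<beta> \<eta> \<theta>\<^sub>0 m)
         \<le> ereal (3 * (4 + L)\<^sup>2 * \<sigma>\<^sup>2 / (4 * (real B * real N * (real m + 1)) powr (1/2)))
           + ereal ((4 + L)\<^sup>2 * sqrt (3 * Cbar) * real N powr (1/4) /
                    (4 * c_hat * sqrt 2 * (real B * (real m + 1)) powr (3/4)))
             * (F_opt P - F P \<theta>\<^sub>0)"
proof -
  interpret rl_setting P R G M b
    by unfold_locales (use model A2 A3 baseline_bound in auto)
  note \<alpha>_eq = \<alpha>(1) and \<alpha>_le = \<alpha>(3) and \<beta>_nonneg = \<beta>(2)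
  have W: "0 < W" using A4 by (simp add: assumption_A4_def)
  have C: "0 < Cbar" unfolding Cbar by (rule C_bar_pos[OF W])
  define n c s where "n = sqrt (real N)" and "c = sqrt (real B)" and "s = sqrt (real m + 1)"
  have ncs: "0 < n" "0 < c" "0 < s" "n\<^sup>2 = real N" "c\<^sup>2 = real B" "s\<^sup>2 = real m + 1"
    using pos by (auto simp: n_def c_def s_def)
  have \<alpha>_pos: "0 < \<alpha>" unfolding \<alpha>(1) using c_hat pos C by auto
  have \<beta>_eq: "1 - \<beta> = c / (n * s)" by (simp add: \<beta>(1) n_def c_def s_def real_sqrt_mult)
  then have \<beta>1: "\<beta> < 1" using ncs by (smt (verit) divide_pos_pos mult_pos_pos)
  have "\<alpha>\<^sup>2 = c_hat\<^sup>2 * 2 * (c\<^sup>2 * c) / (3 * Cbar * n * s)"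
    unfolding \<alpha>(1) using C
    by (simp add: power_divide power_mult_distrib powr_quarter_square powr_three_quarters_square
        n_def c_def s_def)
  \<comment> \<open>This is the purpose of the fractional powers in \<alpha>: its square is
    proportional to 1 - \<beta>, which cancels against the factor 1 - \<beta> of 1 - \<beta>^2 in
    the denominator of lam.\<close>
  then have "Cbar * \<alpha>\<^sup>2 / real B = 2/3 * c_hat\<^sup>2 * (1 - \<beta>)"
    using C ncs unfolding \<beta>_eq ncs(5)[symmetric] by (simp add: field_simps power2_eq_square)
  moreover have \<beta>2: "1 - \<beta>\<^sup>2 = (1 - \<beta>) * (1 + \<beta>)" by (simp add: power2_eq_square algebra_simps)
  ultimately have "2 * \<beta>\<^sup>2 / (1 - \<beta>\<^sup>2) * Cbar * \<alpha>\<^sup>2 / real B = 2/3 * (c_hat\<^sup>2 * (2 * \<beta>\<^sup>2 / (1 + \<beta>)))"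
  proof -
    assume *: "Cbar * \<alpha>\<^sup>2 / real B = 2/3 * c_hat\<^sup>2 * (1 - \<beta>)"
    have "2 * \<beta>\<^sup>2 / (1 - \<beta>\<^sup>2) * Cbar * \<alpha>\<^sup>2 / real B
        = 2 * \<beta>\<^sup>2 / ((1 - \<beta>) * (1 + \<beta>)) * (Cbar * \<alpha>\<^sup>2 / real B)"
      by (simp add: \<beta>2)
    also have "\<dots> = 2/3 * (c_hat\<^sup>2 * (2 * \<beta>\<^sup>2 / (1 + \<beta>)))"
      unfolding * using \<beta>1 \<beta>(2) by (simp add: divide_simps)
    finally show ?thesis .
  qed
  also have "\<dots> \<le> 2/3 * (1 * 1)"
  proof (intro mult_left_mono mult_mono)
    show "c_hat\<^sup>2 \<le> 1" using c_hat by (simp add: power_le_one)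
    have "\<beta>\<^sup>2 \<le> \<beta>" using \<beta>(2,3) by (simp add: power2_eq_square mult_left_le)
    then show "2 * \<beta>\<^sup>2 / (1 + \<beta>) \<le> 1" using \<beta>(2,3) by (simp add: field_simps)
  qed (use \<beta> in auto)
  finally have step_size: "2 * \<beta>\<^sup>2 / (1 - \<beta>\<^sup>2) * C_bar P R G M b W * \<alpha>\<^sup>2 / real B \<le> 2/3"
    by (simp add: Cbar)
  interpret prox_hspga P R G M b W L \<sigma> \<alpha> \<beta> \<eta> m N B \<theta>\<^sub>0
    by unfold_locales (use A1 A4 L \<sigma> pos \<alpha>_pos \<alpha> \<beta> \<beta>1 \<eta> step_size in auto)
  define k where "k = (4 + L)\<^sup>2 / (4 * \<alpha> * (real m + 1))"
  have k: "0 < k" using L \<alpha>_pos by (simp add: k_def)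
  have k_eq: "(4 + L)\<^sup>2 * sqrt (3 * Cbar) * real N powr (1/4) /
      (4 * c_hat * sqrt 2 * (real B * (real m + 1)) powr (3/4)) = k"
  proof -
    define p r x where "p = (real m + 1) powr (1/4)" and "r = (real m + 1) powr (3/4)"
      and "x = sqrt (3 * Cbar) * real N powr (1/4)"
    \<comment> \<open>One factor (m + 1) from averaging over the iterates, divided by the quarter
      power in \<alpha>, leaves the exponent 3/4 of the statement.\<close>
    have "r * p = real m + 1" unfolding r_def p_def by (simp flip: powr_add)
    then have "k = (4 + L)\<^sup>2 / (4 * (c_hat * sqrt 2 * real B powr (3/4) / (x * p)) * (r * p))"
      by (simp add: k_def \<alpha>_eq p_def x_def)
    also have "\<dots> = (4 + L)\<^sup>2 * x / (4 * c_hat * sqrt 2 * (real B powr (3/4) * r))"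
      using C pos c_hat by (simp add: p_def x_def r_def field_simps)
    finally show ?thesis by (simp add: x_def r_def powr_mult mult.assoc)
  qed
  define a where "a = 3 * (4 + L)\<^sup>2 * \<sigma>\<^sup>2 / (4 * (c * n * s))"
  have a_nonneg: "0 \<le> a" using ncs(1-3) by (simp add: a_def)
  have a_eq: "3 * (4 + L)\<^sup>2 * \<sigma>\<^sup>2 / (4 * (real B * real N * (real m + 1)) powr (1/2)) = a"
    by (simp add: a_def powr_half_sqrt real_sqrt_mult n_def c_def s_def)
  define X where "X = (\<integral>\<^sup>+ \<theta>. ennreal ((norm (grad_mapping P \<eta> \<theta>))\<^sup>2) \<partial>output_law P N B B \<alpha> \<beta> \<eta> \<theta>\<^sub>0 m)"
  obtain f where f: "F_opt P = ereal f" by (rule F_opt_real)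
  show ?thesis unfolding k_eq a_eq X_def[symmetric]
  proof (cases "regularizer P \<theta>\<^sub>0")
    case PInf
    then show "enn2ereal X \<le> ereal a + ereal k * (F_opt P - F P \<theta>\<^sub>0)"
      using k by (simp add: F_def f)
  next
    case MInf
    then show "enn2ereal X \<le> ereal a + ereal k * (F_opt P - F P \<theta>\<^sub>0)"
      using A1 by (simp add: assumption_A1_def)
  next
    case (real q)
    define g where "g = f - (J P \<theta>\<^sub>0 - q)"
    have g: "gap \<theta>\<^sub>0 = ennreal g" "0 \<le> g" using gap_finite[OF real f] by (auto simp: g_def)
    define D where "D = (1 + lam) * (\<sigma>\<^sup>2 / real N + real m * ((1 - \<beta>)\<^sup>2 * \<sigma>\<^sup>2 / real B))"
    define K where "K = 1 / (\<eta>\<^sup>2 * (real m + 1))"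
    have D0: "0 \<le> D" using lam(1) by (simp add: D_def)
    have K0: "0 \<le> K" by (simp add: K_def)
    have "1 / \<eta>\<^sup>2 = (4 + L * \<alpha>)\<^sup>2 / 4" by (simp add: \<eta> power_divide)
    also have "\<dots> \<le> (4 + L)\<^sup>2 / 4"
      using L \<alpha>_pos \<alpha>_le by (intro divide_right_mono power_mono) (auto simp: mult_left_le)
    finally have "1 / \<eta>\<^sup>2 / (real m + 1) \<le> (4 + L)\<^sup>2 / 4 / (real m + 1)"
      by (rule divide_right_mono) simp
    then have K: "K \<le> (4 + L)\<^sup>2 / (4 * s\<^sup>2)" by (simp add: K_def ncs)
    have "D \<le> 2 * \<sigma>\<^sup>2 * s / (n * c)"
    proof -
      have "1 / (1 - \<beta>\<^sup>2) \<le> 1 / (1 - \<beta>)"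
        unfolding \<beta>2 using \<beta>1 \<beta>_nonneg by (intro divide_left_mono) (auto simp: mult_le_cancel_left1)
      then have "D \<le> 1 / (1 - \<beta>) * (\<sigma>\<^sup>2 / real N + real m * ((1 - \<beta>)\<^sup>2 * \<sigma>\<^sup>2 / real B))"
        unfolding D_def lam(3) by (rule mult_right_mono) simp
      \<comment> \<open>Replacing \<open>m\<close> by \<open>m + 1\<close> makes the two
        contributions equal: with the given \<beta> the accumulated noise becomes exactly \<sigma>^2
        / N.\<close>
      also have "\<dots> \<le> 1 / (1 - \<beta>) * (\<sigma>\<^sup>2 / real N + (real m + 1) * ((1 - \<beta>)\<^sup>2 * \<sigma>\<^sup>2 / real B))"
        using \<beta>1 by (intro mult_left_mono add_left_mono mult_right_mono) auto
      also have "\<dots> = 2 * \<sigma>\<^sup>2 * s / (n * c)"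
        unfolding \<beta>_eq ncs(4-6)[symmetric] using ncs(1-3) by (simp add: field_simps power2_eq_square)
      finally show ?thesis .
    qed
    then have "K * D \<le> (4 + L)\<^sup>2 / (4 * s\<^sup>2) * (2 * \<sigma>\<^sup>2 * s / (n * c))"
      using D0 K by (intro mult_mono) auto
    \<comment> \<open>The estimate reaches the variance term with constant 2, against the 3 of the
      statement.\<close>
    also have "\<dots> = 2 / 3 * a" using ncs(1-3) by (simp add: a_def field_simps power2_eq_square)
    also have "\<dots> \<le> a" using a_nonneg by simp
    finally have KD: "K * D \<le> a" .
    have "K * (1 / \<alpha> * g) \<le> (4 + L)\<^sup>2 / (4 * s\<^sup>2) * (1 / \<alpha> * g)"
      using K g(2) \<alpha>_pos by (intro mult_right_mono) auto
    also have "\<dots> = k * g" by (simp add: k_def ncs)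
    finally have Kg: "K * (1 / \<alpha> * g) \<le> k * g" .
    have "X \<le> ennreal K * (ennreal (1/\<alpha>) * gap \<theta>\<^sub>0 + ennreal D)"
      unfolding X_def K_def D_def by (rule output_bound)
    also have "\<dots> = ennreal (K * (1 / \<alpha> * g + D))"
      unfolding g(1) using g(2) D0 K0 \<alpha>_pos by (simp flip: ennreal_mult ennreal_plus)
    also have "\<dots> \<le> ennreal (a + k * g)"
      using KD Kg by (intro ennreal_leI) (simp add: distrib_left)
    finally have "enn2ereal X \<le> enn2ereal (ennreal (a + k * g))" by (simp only: less_eq_ennreal.rep_eq)
    also have "\<dots> = ereal (a + k * g)"
      using g(2) k a_nonneg by (intro enn2ereal_ennreal) simp
    also have "\<dots> = ereal a + ereal k * (F_opt P - F P \<theta>\<^sub>0)"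
      by (simp add: F_def f real g_def)
    finally show "enn2ereal X \<le> ereal a + ereal k * (F_opt P - F P \<theta>\<^sub>0)" .
  qed
qed



end
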